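(* For every $W\in\mathrm{Gr}^{ad}$, the fractional right ideals $R_{b(W)}$ and $b(L_W)$ of $A_1$ are isomorphic as right $A_1$-modules. Equivalently, under the bijection $\alpha:\mathrm{Gr}^{ad}\to\mathcal R$, $W\mapsto[R_W]$, the action of the anti-automorphism $b$ of $A_1$ on $\mathcal R$ (given by $b\star[I]=[b(I)']$) corresponds to the bispectral involution $W\mapsto b(W)$.
   Context: $A_1=\mathbb C[z,\partial]$, $\partial=d/dz$, with quotient skew field $Q\supset\mathbb C(z)[\partial]$. $b$ is the anti-automorphism of $A_1$ (extended to $Q$) with $b(z)=\partial$, $b(\partial)=z$. For a left fractional ideal $J$, $J'=\{q\in Q: Jq\subset A_1\}$. $\mathcal R$ = isomorphism classes of nonzero right ideals. Adelic Grassmannian: a linear subspace $V\subset\mathbb C[z]$ is $\lambda$-primary if $(z-\lambda)^r\mathbb C[z]\subset V$ for some $r$, primary decomposable if a finite intersection $\bigcap_\lambda V_\lambda$ of $\lambda$-primary subspaces (distinct $\lambda$); $m_V=\prod(z-\lambda)^{k_\lambda}$, $k_\lambda=\dim\mathbb C[z]/V_\lambda$; $\mathrm{Gr}^{ad}=\{m_V^{-1}V\}$. With $\Gamma=\{e^{p(z)}\}$ acting on $\mathrm{Gr}^{ad}$ via $\gamma W=m_V^{-1}((\gamma\overline V)\cap\mathbb C[z])$ ($\overline V$ the closure in the space of entire functions), the stationary Baker function is $\psi_W(x,z)=e^{xz}\tilde\psi_W(x,z)$, where $\tilde\psi_W(x,\cdot)$ is the unique element of $e^{-xz}W$ of the form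 $1+O(z^{-1})$ (defined for all but finitely many $x$). The bispectral involution $b$ on $\mathrm{Gr}^{ad}$ is defined by $\psi_{b(W)}(x,z)=\psi_W(z,x)$ (it is known that such $b(W)\in\mathrm{Gr}^{ad}$ exists). $\mathcal D(U,V)=\{D\in\mathbb C(z)[\partial]: D.U\subset V\}$, $R_W=\mathcal D(\mathbb C[z],W)$, $L_W=\mathcal D(W,\mathbb C[z])$. *)

theory Defs
  imports "HOL-Analysis.Analysis" "HOL-Computational_Algebra.Polynomial"
          "HOL-Computational_Algebra.Fraction_Field"
begin

type_synonym ratfun = "complex poly fract"

definition ratpoly :: "complex poly \<Rightarrow> ratfun" where
  "ratpoly p = Fract p 1"

definition ratfun_deriv :: "ratfun \<Rightarrow> ratfun" where
  "ratfun_deriv r = (SOME s. \<exists>p q. q \<noteq> 0 \<and> r = Fract p q \<and>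
       s = Fract (pderiv p * q - p * pderiv q) (q * q))"

definition ratfun_defined_at :: "ratfun \<Rightarrow> complex \<Rightarrow> bool" where
  "ratfun_defined_at r z = (\<exists>p q. r = Fract p q \<and> poly q z \<noteq> 0)"

definition ratfun_eval :: "ratfun \<Rightarrow> complex \<Rightarrow> complex" where
  "ratfun_eval r z = (SOME v. \<exists>p q. r = Fract p q \<and> poly q z \<noteq> 0 \<and> v = poly p z / poly q z)"

text \<open>r is of the form 1 + O(z^{-1}) at infinity\<close>
definition one_plus_O :: "ratfun \<Rightarrow> bool" where
  "one_plus_O r = (\<exists>p q. q \<noteq> 0 \<and> r = Fract p q \<and> degree (p - q) < degree q)"

text \<open>An operator sum_i a_i(z) d^i is encoded by its coefficient list a_i (as a
  polynomial in the formal variable d); the multiplication is the Leibniz one.\<close>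
type_synonym diffop = "ratfun poly"

definition dop_mult :: "diffop \<Rightarrow> diffop \<Rightarrow> diffop" where
  "dop_mult D E = (\<Sum>m\<le>degree D. \<Sum>n\<le>degree E. \<Sum>k\<le>m.
      monom (of_nat (m choose k) * coeff D m * (ratfun_deriv ^^ k) (coeff E n)) (m + n - k))"

definition dop_apply :: "diffop \<Rightarrow> ratfun \<Rightarrow> ratfun" where
  "dop_apply D f = (\<Sum>i\<le>degree D. coeff D i * (ratfun_deriv ^^ i) f)"

definition dop_const :: "complex \<Rightarrow> diffop" where
  "dop_const c = [: ratpoly [:c:] :]"

definition dop_z :: diffop where
  "dop_z = [: ratpoly [:0, 1:] :]"

definition dop_d :: diffop where
  "dop_d = [: 0, 1 :]"

definition weyl :: "diffop set" where
  "weyl = {D. \<forall>i. \<exists>p. coeff D i = ratpoly p}"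

definition poly_subspace :: "complex poly set \<Rightarrow> bool" where
  "poly_subspace V = (0 \<in> V \<and> (\<forall>f\<in>V. \<forall>g\<in>V. f + g \<in> V) \<and> (\<forall>c. \<forall>f\<in>V. smult c f \<in> V))"

definition primary :: "complex \<Rightarrow> complex poly set \<Rightarrow> bool" where
  "primary lam V = (poly_subspace V \<and>
      (\<exists>r::nat. \<forall>p. [:-lam, 1:] ^ r dvd p \<longrightarrow> p \<in> V))"

definition poly_codim :: "complex poly set \<Rightarrow> nat" where
  "poly_codim V = (LEAST n. \<exists>P :: complex poly list. length P = n \<and>
      (\<forall>f. \<exists>g\<in>V. \<exists>c. f = g + (\<Sum>i<n. smult (c i) (P ! i))))"

definition primary_decomp :: "complex poly set \<Rightarrow> complex set \<Rightarrow> (complex \<Rightarrow> complex poly set) \<Rightarrow> bool" where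
  "primary_decomp V Lam Vs = (finite Lam \<and> (\<forall>lam\<in>Lam. primary lam (Vs lam)) \<and>
      V = (\<Inter>lam\<in>Lam. Vs lam))"

definition primary_decomposable :: "complex poly set \<Rightarrow> bool" where
  "primary_decomposable V = (poly_subspace V \<and> (\<exists>Lam Vs. primary_decomp V Lam Vs))"

definition m_poly :: "complex poly set \<Rightarrow> complex poly" where
  "m_poly V = (let LV = (SOME LV. primary_decomp V (fst LV) (snd LV))
     in \<Prod>lam\<in>fst LV. [:-lam, 1:] ^ poly_codim (snd LV lam))"

definition grad_rep :: "ratfun set \<Rightarrow> complex poly set \<Rightarrow> bool" where
  "grad_rep W V = (primary_decomposable V \<and> W = (\<lambda>p. Fract p (m_poly V)) ` V)"

definition Gr_ad :: "ratfun set set" where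
  "Gr_ad = {W. \<exists>V. grad_rep W V}"

definition ent_closure :: "complex poly set \<Rightarrow> (complex \<Rightarrow> complex) set" where
  "ent_closure V = {f. f holomorphic_on UNIV \<and> (\<exists>P. (\<forall>n. P n \<in> V) \<and>
      (\<forall>K. compact K \<longrightarrow> uniform_limit K (\<lambda>n. poly (P n)) f sequentially))}"

definition gamma_act :: "complex poly \<Rightarrow> ratfun set \<Rightarrow> ratfun set" where
  "gamma_act g W = (let V = (SOME V. grad_rep W V) in
     (\<lambda>p. Fract p (m_poly V)) `
       {p. \<exists>f\<in>ent_closure V. \<forall>z. poly p z = exp (poly g z) * f z})"

definition baker_tilde_exists :: "ratfun set \<Rightarrow> complex \<Rightarrow> bool" where
  "baker_tilde_exists W x = (\<exists>!r. r \<in> gamma_act [:0, -x:] W \<and> one_plus_O r)"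

definition baker_tilde :: "ratfun set \<Rightarrow> complex \<Rightarrow> ratfun" where
  "baker_tilde W x = (THE r. r \<in> gamma_act [:0, -x:] W \<and> one_plus_O r)"

definition baker_defined :: "ratfun set \<Rightarrow> complex \<Rightarrow> complex \<Rightarrow> bool" where
  "baker_defined W x z = (baker_tilde_exists W x \<and> ratfun_defined_at (baker_tilde W x) z)"

definition baker :: "ratfun set \<Rightarrow> complex \<Rightarrow> complex \<Rightarrow> complex" where
  "baker W x z = exp (x * z) * ratfun_eval (baker_tilde W x) z"

definition bisp :: "ratfun set \<Rightarrow> ratfun set" where
  "bisp W = (THE W'. W' \<in> Gr_ad \<and> (\<forall>x z. baker_defined W' x z \<and> baker_defined W z x \<longrightarrow>
      baker W' x z = baker W z x))"

definition R_of :: "ratfun set \<Rightarrow> diffop set" where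
  "R_of W = {D. \<forall>p. dop_apply D (ratpoly p) \<in> W}"

definition L_of :: "ratfun set \<Rightarrow> diffop set" where
  "L_of W = {D. \<forall>w\<in>W. dop_apply D w \<in> range ratpoly}"

definition weyl_quotient_field :: "(diffop \<Rightarrow> 'q::division_ring) \<Rightarrow> bool" where
  "weyl_quotient_field j = (inj j \<and> j 1 = 1 \<and> (\<forall>D E. j (D + E) = j D + j E) \<and>
      (\<forall>D E. j (dop_mult D E) = j D * j E) \<and>
      (\<forall>q. \<exists>a\<in>weyl. \<exists>c\<in>weyl. a \<noteq> 0 \<and> q = inverse (j a) * j c))"

definition bispectral_anti :: "(diffop \<Rightarrow> 'q::division_ring) \<Rightarrow> ('q \<Rightarrow> 'q) \<Rightarrow> bool" where
  "bispectral_anti j bQ = (bij bQ \<and> (\<forall>x y. bQ (x + y) = bQ x + bQ y) \<and>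
      (\<forall>x y. bQ (x * y) = bQ y * bQ x) \<and>
      (\<forall>c. bQ (j (dop_const c)) = j (dop_const c)) \<and>
      bQ (j dop_z) = j dop_d \<and> bQ (j dop_d) = j dop_z)"

definition right_mod_iso :: "(diffop \<Rightarrow> 'q::division_ring) \<Rightarrow> 'q set \<Rightarrow> 'q set \<Rightarrow> bool" where
  "right_mod_iso j I J = (\<exists>phi. bij_betw phi I J \<and>
      (\<forall>x\<in>I. \<forall>y\<in>I. phi (x + y) = phi x + phi y) \<and>
      (\<forall>x\<in>I. \<forall>a\<in>weyl. phi (x * j a) = phi x * j a))"

end

theory Submission
  imports Defs "HOL-Complex_Analysis.Cauchy_Integral_Formula"
    "HOL-Computational_Algebra.Fundamental_Theorem_Algebra"
begin

text \<open>
  A point \<open>W = m\<^sup>-\<^sup>1 V\<close> of the adelic Grassmannian is given by finitely many functionals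
  \<open>f \<mapsto> (u(\<partial>)f)(l)\<close> vanishing on \<open>V\<close>. Let \<open>L\<close> be the monic operator over \<open>\<complex>(x)\<close> annihilating
  the quasi-polynomials \<open>e\<^sup>l\<^sup>x u(x)\<close>; then \<open>\<psi>\<^sub>W = m(z)\<^sup>-\<^sup>1 L e\<^sup>x\<^sup>z\<close>. An operator in \<open>z\<close> acts on
  \<open>e\<^sup>x\<^sup>z\<close> as its image under \<open>b\<close> acts in \<open>x\<close>, so \<open>D \<in> R\<^sub>W\<close> if and only if
  \<open>b(m D) \<in> \<complex>(x)[\<partial>] L\<close>. Put \<open>K = L b(m)\<^sup>-\<^sup>1\<close>. Exchanging \<open>x\<close> and \<open>z\<close> in \<open>\<psi>\<^sub>W\<close> means that the
  operator of the dual point is \<open>b(K)\<close>, whence \<open>R\<^bsub>b(W)\<^esub> = \<complex>(z)[\<partial>] \<inter> K b(\<complex>(z)[\<partial>])\<close>, while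
  \<open>b(L\<^sub>W) = K\<^sup>-\<^sup>1 \<complex>(z)[\<partial>] \<inter> b(\<complex>(z)[\<partial>])\<close>. Left multiplication by \<open>K\<^sup>-\<^sup>1\<close> is the isomorphism.

  The dual point is \<open>V'/q\<close> with \<open>V' = q L.\<complex>[z] + q f \<complex>[z]\<close>, where \<open>q\<close> clears the denominators of
  \<open>L\<close> and \<open>f\<close> is divisible enough. Trivial monodromy of \<open>L\<close> gives that \<open>V'\<close> has
  codimension \<open>deg q\<close>, and the limit of its Baker function as \<open>x\<close> tends to infinity shows that \<open>q\<close> is
  the polynomial \<open>m\<^sub>V\<^sub>'\<close> attached to \<open>V'\<close>.
\<close>

subsection \<open>Rational functions\<close>

text \<open>K lives only in the skew field, and b of an operator with rational coefficients need not
  be an operator. The relation K' = b(K) is therefore carried through the proof with denominators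
  cleared, as m L' b(q) = b(q L) b(m'). There b is applied only to elements of the Weyl algebra,
  where it is the exchange of variables \<open>swap_op\<close>; the skew field enters in the last
  part. Wronskian determinants are replaced by the factorisation of L into first order factors: the
  quotient of two solutions satisfies f' = c f, and a rational f of this kind is constant.
  \<open>bisp\<close> is a definite description, so uniqueness of the dual point is part of the
  work: the Baker function determines K, K determines the ideal R_W, and R_W generates W from C[z].
  The equality of Baker functions is also required where m or m' vanishes but the pole is removable,
  so vanishing factors must be divided out of the numerators. For the codimension of V',
  divisibility of b(q L) b(m') by the operator of V' bounds it above by deg q; trivial monodromy
  supplies the opposite bound.\<close>

lemma ratpoly_0 [simp]: "ratpoly 0 = 0"
  by (simp add: ratpoly_def Zero_fract_def)

lemma ratpoly_1 [simp]: "ratpoly 1 = 1"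
  by (simp add: ratpoly_def One_fract_def)

lemma ratpoly_add: "ratpoly (p + q) = ratpoly p + ratpoly q"
  by (simp add: ratpoly_def)

lemma ratpoly_diff: "ratpoly (p - q) = ratpoly p - ratpoly q"
  by (simp add: ratpoly_def)

lemma ratpoly_minus: "ratpoly (- p) = - ratpoly p"
  by (simp add: ratpoly_def)

lemma ratpoly_mult: "ratpoly (p * q) = ratpoly p * ratpoly q"
  by (simp add: ratpoly_def)

lemma ratpoly_sum: "ratpoly (sum f A) = (\<Sum>x\<in>A. ratpoly (f x))"
  by (induction A rule: infinite_finite_induct) (simp_all add: ratpoly_add)

lemma ratpoly_of_nat [simp]: "ratpoly (of_nat n) = of_nat n"
  by (induction n) (simp_all add: ratpoly_add)

lemma ratpoly_eq_iff [simp]: "ratpoly p = ratpoly q \<longleftrightarrow> p = q"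
  by (simp add: ratpoly_def eq_fract)

lemma ratpoly_eq_0_iff [simp]: "ratpoly p = 0 \<longleftrightarrow> p = 0"
  using ratpoly_eq_iff[of p 0] by (simp del: ratpoly_eq_iff)

lemma Fract_eq_divide: "Fract p q = ratpoly p / ratpoly q"
  by (simp add: ratpoly_def)

lemma ratfun_cases:
  obtains p q where "q \<noteq> 0" "r = ratpoly p / ratpoly q"
  by (cases r) (auto simp: Fract_eq_divide)

lemma ratfun_deriv_Fract:
  assumes "q \<noteq> 0"
  shows "ratfun_deriv (Fract p q) = Fract (pderiv p * q - p * pderiv q) (q * q)"
  unfolding ratfun_deriv_def
proof (rule some_equality)
  show "\<exists>p' q'. q' \<noteq> 0 \<and> Fract p q = Fract p' q' \<and>
     Fract (pderiv p * q - p * pderiv q) (q * q) = Fract (pderiv p' * q' - p' * pderiv q') (q' * q')"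
    using assms by blast
next
  fix s assume "\<exists>p' q'. q' \<noteq> 0 \<and> Fract p q = Fract p' q' \<and>
     s = Fract (pderiv p' * q' - p' * pderiv q') (q' * q')"
  then obtain p' q' where *: "q' \<noteq> 0" "Fract p q = Fract p' q'"
     and s: "s = Fract (pderiv p' * q' - p' * pderiv q') (q' * q')" by blast
  have e: "p * q' = p' * q" using * assms by (simp add: eq_fract)
  have "pderiv (p * q') = pderiv (p' * q)" using e by simp
  hence d: "p * pderiv q' + q' * pderiv p = p' * pderiv q + q * pderiv p'"
    by (simp add: pderiv_mult)
  have "(pderiv p' * q' - p' * pderiv q') * (q * q) = (pderiv p * q - p * pderiv q) * (q' * q')"
    using d e by algebra
  thus "s = Fract (pderiv p * q - p * pderiv q) (q * q)"
    using s * assms by (simp add: eq_fract)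
qed

lemma ratfun_deriv_ratpoly [simp]: "ratfun_deriv (ratpoly p) = ratpoly (pderiv p)"
  by (simp add: ratpoly_def ratfun_deriv_Fract)

lemma ratfun_deriv_0 [simp]: "ratfun_deriv 0 = 0"
  using ratfun_deriv_ratpoly[of 0] by simp

lemma ratfun_deriv_add: "ratfun_deriv (r + s) = ratfun_deriv r + ratfun_deriv s"
proof (cases r, cases s)
  fix p q p' q' assume "r = Fract p q" "q \<noteq> 0" "s = Fract p' q'" "q' \<noteq> 0"
  thus ?thesis
    by (simp add: ratfun_deriv_Fract eq_fract pderiv_mult pderiv_add) (simp add: algebra_simps)
qed

lemma ratfun_deriv_mult: "ratfun_deriv (r * s) = ratfun_deriv r * s + r * ratfun_deriv s"
proof (cases r, cases s)
  fix p q p' q' assume "r = Fract p q" "q \<noteq> 0" "s = Fract p' q'" "q' \<noteq> 0"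
  thus ?thesis
    by (simp add: ratfun_deriv_Fract eq_fract pderiv_mult) (simp add: algebra_simps)
qed

lemma ratfun_deriv_minus: "ratfun_deriv (- r) = - ratfun_deriv r"
  using ratfun_deriv_add[of r "-r"] by (simp add: add_eq_0_iff)

lemma ratfun_deriv_diff: "ratfun_deriv (r - s) = ratfun_deriv r - ratfun_deriv s"
  using ratfun_deriv_add[of r "-s"] by (simp add: ratfun_deriv_minus)

abbreviation rconst :: "complex \<Rightarrow> ratfun" where "rconst c \<equiv> ratpoly [:c:]"

lemma rconst_1 [simp]: "rconst 1 = 1" by (metis one_pCons ratpoly_1)

lemma ratpoly_smult: "ratpoly (smult c p) = rconst c * ratpoly p"
  by (metis mult_zero_right ratpoly_mult smult_0_left smult_0_right smult_eq_iff smult_one mult_smult_left mult.left_neutral smult_1_left smult_pCons mult.right_neutral one_pCons)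

lemma rconst_mult: "rconst (c * d) = rconst c * rconst d"
  by (simp flip: ratpoly_mult)

lemma rconst_add: "rconst (c + d) = rconst c + rconst d"
  by (simp flip: ratpoly_add)

lemma rconst_diff: "rconst (c - d) = rconst c - rconst d"
  by (simp flip: ratpoly_diff)

subsection \<open>Operators acting on twisted rational functions\<close>

text \<open>\<open>tderiv l w\<close> and \<open>act l D w\<close> describe the action on \<open>e\<^sup>l\<^sup>z w(z)\<close> with the exponential
  factor stripped off.\<close>

definition tderiv :: "complex \<Rightarrow> ratfun \<Rightarrow> ratfun" where
  "tderiv l w = ratfun_deriv w + rconst l * w"

definition act :: "complex \<Rightarrow> diffop \<Rightarrow> ratfun \<Rightarrow> ratfun" where
  "act l D w = (\<Sum>i\<le>degree D. coeff D i * (tderiv l ^^ i) w)"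

lemma tderiv_0_left [simp]: "tderiv 0 = ratfun_deriv"
  by (simp add: tderiv_def fun_eq_iff)

lemma dop_apply_eq_act: "dop_apply = act 0"
  by (simp add: fun_eq_iff dop_apply_def act_def)

lemma tderiv_add: "tderiv l (v + w) = tderiv l v + tderiv l w"
  by (simp add: tderiv_def ratfun_deriv_add algebra_simps)

lemma tderiv_0 [simp]: "tderiv l 0 = 0"
  by (simp add: tderiv_def)

lemma tderiv_const: "tderiv l (rconst c * w) = rconst c * tderiv l w"
  by (simp add: tderiv_def ratfun_deriv_mult algebra_simps)

lemma tderiv_mult: "tderiv (l + x) (v * w) = tderiv l v * w + v * tderiv x w"
  by (simp add: tderiv_def ratfun_deriv_mult rconst_add algebra_simps)

lemma tderiv_mult': "tderiv l (v * w) = ratfun_deriv v * w + v * tderiv l w"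
  using tderiv_mult[of 0 l v w] by simp

lemma tderiv_funpow_0 [simp]: "(tderiv l ^^ i) 0 = 0"
  by (induction i) simp_all

lemma tderiv_funpow_add: "(tderiv l ^^ i) (v + w) = (tderiv l ^^ i) v + (tderiv l ^^ i) w"
  by (induction i) (simp_all add: tderiv_add)

lemma tderiv_funpow_const: "(tderiv l ^^ i) (rconst c * w) = rconst c * (tderiv l ^^ i) w"
  by (induction i) (simp_all add: tderiv_const)

lemma tderiv_funpow_sum: "(tderiv l ^^ i) (sum f A) = (\<Sum>x\<in>A. (tderiv l ^^ i) (f x))"
  by (induction A rule: infinite_finite_induct) (simp_all add: tderiv_funpow_add)

lemma act_altdef:
  assumes "degree D \<le> n"
  shows "act l D w = (\<Sum>i\<le>n. coeff D i * (tderiv l ^^ i) w)"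
  unfolding act_def
  by (rule sum.mono_neutral_left) (use assms in \<open>auto simp: coeff_eq_0\<close>)

lemma act_0 [simp]: "act l 0 w = 0" and act_0_right [simp]: "act l D 0 = 0"
  by (simp_all add: act_def)

lemma act_1 [simp]: "act l 1 w = w"
  by (simp add: act_def)

lemma act_const [simp]: "act l [:a:] w = a * w"
  by (simp add: act_def)

lemma act_add: "act l (D + E) w = act l D w + act l E w"
proof -
  define n where "n = max (degree D) (degree E)"
  have "degree (D + E) \<le> n" "degree D \<le> n" "degree E \<le> n"
    by (auto simp: n_def degree_add_le)
  thus ?thesis by (simp add: act_altdef[of _ n] sum.distrib algebra_simps)
qed

lemma act_smult: "act l (smult a D) w = a * act l D w"
proof -
  have "degree (smult a D) \<le> degree D" by simp
  thus ?thesis by (simp add: act_altdef[of _ "degree D"] sum_distrib_left mult.assoc)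
qed

lemma act_diff: "act l (D - E) w = act l D w - act l E w"
  using act_add[of l "D - E" E w] by simp

lemma act_sum: "act l (sum f A) w = (\<Sum>x\<in>A. act l (f x) w)"
  by (induction A rule: infinite_finite_induct) (simp_all add: act_add)

lemma act_monom: "act l (monom a n) w = a * (tderiv l ^^ n) w"
proof -
  have "degree (monom a n) \<le> n" by (simp add: degree_monom_le)
  thus ?thesis by (simp add: act_altdef[of _ n] if_distrib[of "\<lambda>x. x * _"] cong: if_cong)
qed

lemma act_pCons: "act l (pCons a D) w = a * w + act l D (tderiv l w)"
proof -
  have "degree (pCons a D) \<le> Suc (degree D)" by (simp add: degree_pCons_eq_if)
  thus ?thesis
    by (simp add: act_altdef[of _ "Suc (degree D)"] sum.atMost_Suc_shift funpow_swap1 act_def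
      del: sum.atMost_Suc)
qed

lemma act_add_right: "act l D (v + w) = act l D v + act l D w"
  by (simp add: act_def tderiv_funpow_add sum.distrib algebra_simps)

lemma act_const_right: "act l D (rconst c * w) = rconst c * act l D w"
  by (simp add: act_def tderiv_funpow_const sum_distrib_left mult.left_commute)

lemma act_diff_right: "act l D (v - w) = act l D v - act l D w"
  using act_add_right[of l D "v - w" w] by simp

lemma tderiv_funpow_mult:
  "(tderiv l ^^ m) (a * w) =
     (\<Sum>k\<le>m. of_nat (m choose k) * (ratfun_deriv ^^ k) a * (tderiv l ^^ (m - k)) w)"
proof (induction m)
  case (Suc m)
  let ?D = "ratfun_deriv" and ?T = "tderiv l"
  have t: "?T (of_nat c * x * y) = of_nat c * ?D x * y + of_nat c * x * ?T y" for c x y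
    using tderiv_mult'[of l "of_nat c * x" y] ratfun_deriv_mult[of "of_nat c" x]
      ratfun_deriv_ratpoly[of "of_nat c"] by (simp add: algebra_simps)
  have s: "?T (sum f A) = (\<Sum>x\<in>A. ?T (f x))" for f and A :: "nat set"
    using tderiv_funpow_sum[of 1 l f A] by simp
  have "(?T ^^ Suc m) (a * w) = (\<Sum>k\<le>m. of_nat (m choose k) * (?D ^^ Suc k) a * (?T ^^ (m - k)) w)
     + (\<Sum>k\<le>m. of_nat (m choose k) * (?D ^^ k) a * (?T ^^ (Suc m - k)) w)"
    by (simp add: Suc.IH s t sum.distrib) (auto intro!: sum.cong simp: Suc_diff_le)
  also have "(\<Sum>k\<le>m. of_nat (m choose k) * (?D ^^ k) a * (?T ^^ (Suc m - k)) w)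
     = (\<Sum>k\<le>Suc m. of_nat (m choose k) * (?D ^^ k) a * (?T ^^ (Suc m - k)) w)"
    by (simp add: binomial_eq_0)
  also have "\<dots> = a * (?T ^^ Suc m) w +
      (\<Sum>k\<le>m. of_nat (m choose Suc k) * (?D ^^ Suc k) a * (?T ^^ (m - k)) w)"
    by (subst sum.atMost_Suc_shift) simp
  also have "(\<Sum>k\<le>m. of_nat (m choose k) * (?D ^^ Suc k) a * (?T ^^ (m - k)) w) +
      (a * (?T ^^ Suc m) w +
      (\<Sum>k\<le>m. of_nat (m choose Suc k) * (?D ^^ Suc k) a * (?T ^^ (m - k)) w)) =
      a * (?T ^^ Suc m) w +
      (\<Sum>k\<le>m. of_nat (Suc m choose Suc k) * (?D ^^ Suc k) a * (?T ^^ (m - k)) w)"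
    by (simp add: sum.distrib algebra_simps)
  also have "\<dots> = (\<Sum>k\<le>Suc m. of_nat (Suc m choose k) * (?D ^^ k) a * (?T ^^ (Suc m - k)) w)"
    by (subst sum.atMost_Suc_shift) simp
  finally show ?case .
qed simp

text \<open>Leibniz's rule produces exactly the triple sum in \<open>dop_mult\<close>. Together with
  \<open>diffop_eqI\<close> this reduces the algebraic laws of the product to composition of
  maps.\<close>

lemma act_dop_mult: "act l (dop_mult D E) w = act l D (act l E w)"
proof -
  have "act l D (act l E w) = (\<Sum>m\<le>degree D. \<Sum>n\<le>degree E. coeff D m *
      (tderiv l ^^ m) (coeff E n * (tderiv l ^^ n) w))"
    by (simp add: act_def tderiv_funpow_sum sum_distrib_left)
  also have "\<dots> = (\<Sum>m\<le>degree D. \<Sum>n\<le>degree E. \<Sum>k\<le>m. act l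
      (monom (of_nat (m choose k) * coeff D m * (ratfun_deriv ^^ k) (coeff E n)) (m + n - k)) w)"
  proof (intro sum.cong refl)
    fix m n
    have "coeff D m * (tderiv l ^^ m) (coeff E n * (tderiv l ^^ n) w) = (\<Sum>k\<le>m. coeff D m *
      (of_nat (m choose k) * (ratfun_deriv ^^ k) (coeff E n) * (tderiv l ^^ (m - k)) ((tderiv l ^^ n) w)))"
      by (simp add: tderiv_funpow_mult sum_distrib_left)
    also have "\<dots> = (\<Sum>k\<le>m. act l
      (monom (of_nat (m choose k) * coeff D m * (ratfun_deriv ^^ k) (coeff E n)) (m + n - k)) w)"
    proof (rule sum.cong [OF refl])
      fix k assume "k \<in> {..m}"
      hence "m + n - k = (m - k) + n" by simp
      thus "coeff D m *
      (of_nat (m choose k) * (ratfun_deriv ^^ k) (coeff E n) * (tderiv l ^^ (m - k)) ((tderiv l ^^ n) w)) =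
       act l (monom (of_nat (m choose k) * coeff D m * (ratfun_deriv ^^ k) (coeff E n)) (m + n - k)) w"
        by (simp only: act_monom funpow_add o_apply) (simp add: algebra_simps)
    qed
    finally show "coeff D m * (tderiv l ^^ m) (coeff E n * (tderiv l ^^ n) w) = \<dots>" .
  qed
  finally show ?thesis by (simp add: dop_mult_def act_sum)
qed

lemma ratfun_deriv_funpow_ratpoly: "(ratfun_deriv ^^ i) (ratpoly p) = ratpoly ((pderiv ^^ i) p)"
  by (induction i) simp_all

lemma pderiv_funpow_monom_self: "(pderiv ^^ i) (monom 1 i) = [:fact i :: complex:]"
proof (induction i)
  case (Suc i)
  have "(pderiv ^^ i) (smult c p) = smult c ((pderiv ^^ i) p)" for c and p :: "complex poly"
    by (induction i) (simp_all add: pderiv_smult)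
  moreover have "pderiv (monom 1 (Suc i)) = smult (of_nat (Suc i)) (monom (1::complex) i)"
    by (simp add: pderiv_monom smult_monom)
  ultimately show ?case using Suc by (simp add: funpow_Suc_right del: funpow.simps)
qed (simp add: one_pCons)

lemma pderiv_funpow_eq_0: "degree p < i \<Longrightarrow> (pderiv ^^ i) p = 0" for p :: "complex poly"
proof (induction i arbitrary: p)
  case (Suc i)
  show ?case
  proof (cases "degree p = 0")
    case True
    then obtain c where "p = [:c:]" by (meson degree_0_id degree_eq_zeroE)
    have "pderiv p = 0" using True by (simp add: pderiv_eq_0_iff)
    moreover have "(pderiv ^^ i) 0 = (0::complex poly)" by (induction i) simp_all
    ultimately show ?thesis by (simp add: funpow_Suc_right del: funpow.simps)
  next
    case False
    have "(pderiv ^^ i) (pderiv p) = 0" using Suc.prems False by (intro Suc.IH) (simp add: degree_pderiv)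
    thus ?thesis by (simp add: funpow_Suc_right del: funpow.simps)
  qed
qed simp

text \<open>Testing an operator on 1, z, z^2, ... gives a triangular system for its coefficients
  with diagonal entries i!. Faithfulness of the action and \<open>weylI\<close> both solve it by
  strong induction.\<close>

lemma act_monom_triangular:
  "act 0 D (ratpoly (monom 1 i)) =
     coeff D i * rconst (fact i) + (\<Sum>k<i. coeff D k * ratpoly ((pderiv ^^ k) (monom 1 i)))"
proof -
  define n where "n = max i (degree D)"
  have "act 0 D (ratpoly (monom 1 i)) = (\<Sum>k\<le>n. coeff D k * ratpoly ((pderiv ^^ k) (monom 1 i)))"
    by (simp add: act_altdef[of _ n] n_def ratfun_deriv_funpow_ratpoly)
  also have "\<dots> = (\<Sum>k\<le>i. coeff D k * ratpoly ((pderiv ^^ k) (monom 1 i)))"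
    by (rule sum.mono_neutral_right) (auto simp: n_def pderiv_funpow_eq_0 degree_monom_eq)
  also have "\<dots> = coeff D i * rconst (fact i) + (\<Sum>k<i. coeff D k * ratpoly ((pderiv ^^ k) (monom 1 i)))"
    by (simp add: pderiv_funpow_monom_self lessThan_Suc_atMost[symmetric])
  finally show ?thesis .
qed

lemma diffop_eqI:
  assumes "\<And>w. act 0 D w = act 0 E w"
  shows "D = E"
proof -
  have "coeff (D - E) i = 0" for i
  proof (induction i rule: less_induct)
    case (less i)
    have "act 0 (D - E) (ratpoly (monom 1 i)) = 0" using assms by (simp add: act_diff)
    moreover have "(\<Sum>k<i. coeff (D - E) k * ratpoly ((pderiv ^^ k) (monom 1 i))) = 0"
      by (rule sum.neutral) (use less in simp)
    ultimately show ?case by (subst (asm) act_monom_triangular) simp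
  qed
  thus ?thesis by (simp add: poly_eq_iff)
qed

lemma weylI:
  assumes "\<And>f. act 0 D (ratpoly f) \<in> range ratpoly"
  shows "D \<in> weyl"
proof -
  have "coeff D i \<in> range ratpoly" for i
  proof (induction i rule: less_induct)
    case (less i)
    have "\<forall>k\<in>{..<i}. \<exists>c. coeff D k = ratpoly c" using less by auto
    then obtain c where c: "\<And>k. k < i \<Longrightarrow> coeff D k = ratpoly (c k)" by (metis lessThan_iff)
    obtain g where g: "act 0 D (ratpoly (monom 1 i)) = ratpoly g" using assms by blast
    have "(\<Sum>k<i. coeff D k * ratpoly ((pderiv ^^ k) (monom 1 i))) =
        ratpoly (\<Sum>k<i. c k * (pderiv ^^ k) (monom 1 i))"
      by (simp add: ratpoly_sum ratpoly_mult c)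
    hence "coeff D i * rconst (fact i) = ratpoly (g - (\<Sum>k<i. c k * (pderiv ^^ k) (monom 1 i)))"
      using g by (subst (asm) act_monom_triangular) (simp add: ratpoly_diff algebra_simps)
    hence "coeff D i * rconst (fact i) * rconst (1 / fact i) = 
        ratpoly ((g - (\<Sum>k<i. c k * (pderiv ^^ k) (monom 1 i))) * [:1 / fact i:])"
      by (simp only: ratpoly_mult)
    moreover have "rconst (fact i) * rconst (1 / fact i) = 1"
      by (simp flip: rconst_mult)
    ultimately have "coeff D i = ratpoly ((g - (\<Sum>k<i. c k * (pderiv ^^ k) (monom 1 i))) * [:1 / fact i:])"
      by (metis mult.assoc mult.right_neutral)
    thus ?case by blast
  qed
  thus ?thesis by (auto simp: weyl_def)
qed

lemma dop_mult_assoc: "dop_mult (dop_mult A B) C = dop_mult A (dop_mult B C)"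
  by (rule diffop_eqI) (simp add: act_dop_mult)

lemma dop_mult_add_left: "dop_mult (A + B) C = dop_mult A C + dop_mult B C"
  by (rule diffop_eqI) (simp add: act_dop_mult act_add)

lemma dop_mult_add_right: "dop_mult A (B + C) = dop_mult A B + dop_mult A C"
  by (rule diffop_eqI) (simp add: act_dop_mult act_add act_add_right)

lemma dop_mult_0_left [simp]: "dop_mult 0 A = 0"
  and dop_mult_0_right [simp]: "dop_mult A 0 = 0"
  by (rule diffop_eqI, simp add: act_dop_mult)+

lemma dop_mult_1_left [simp]: "dop_mult 1 A = A"
  and dop_mult_1_right [simp]: "dop_mult A 1 = A"
  by (rule diffop_eqI, simp add: act_dop_mult)+

lemma dop_mult_const_left [simp]: "dop_mult [:a:] D = smult a D"
  by (rule diffop_eqI) (simp add: act_dop_mult act_smult)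

lemma dop_mult_d_right: "dop_mult D [:0, 1:] = pCons 0 D"
  by (rule diffop_eqI) (simp add: act_dop_mult act_pCons)

lemma dop_mult_const_right: "dop_mult D [:rconst c:] = smult (rconst c) D"
  by (rule diffop_eqI) (simp add: act_dop_mult act_smult act_const_right)

lemma dop_mult_pCons_left: "dop_mult (pCons a D) E = smult a E + dop_mult D (dop_mult [:0,1:] E)"
  by (rule diffop_eqI) (simp add: act_dop_mult act_smult act_pCons act_add)

subsection \<open>Operators with polynomial coefficients and the exponential pairing\<close>

definition dpoly :: "complex \<Rightarrow> complex poly \<Rightarrow> complex poly" where
  "dpoly l f = pderiv f + smult l f"

definition pact :: "complex \<Rightarrow> complex poly poly \<Rightarrow> complex poly \<Rightarrow> complex poly" where
  "pact l P f = (\<Sum>i\<le>degree P. coeff P i * (dpoly l ^^ i) f)"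

definition dop_of :: "complex poly poly \<Rightarrow> diffop" where
  "dop_of P = map_poly ratpoly P"

definition const_op :: "complex poly \<Rightarrow> complex poly poly" where
  "const_op p = map_poly (\<lambda>c. [:c:]) p"

text \<open>Exchanging the two variables of \<open>\<Sum> c\<^sub>i\<^sub>j z\<^sup>j \<partial>\<^sup>i\<close> is the anti-automorphism \<open>b\<close> of the
  Weyl algebra, because both sides are written in normal order.\<close>

definition swap_op :: "complex poly poly \<Rightarrow> complex poly poly" where
  "swap_op P = (\<Sum>i\<le>degree P. \<Sum>j\<le>degree (coeff P i). monom (monom (coeff (coeff P i) j) i) j)"

text \<open>\<open>pairing l u x p\<close> is \<open>e\<^sup>-\<^sup>x\<^sup>l\<close> times the value of the functional
  \<open>f \<mapsto> (u(\<partial>)f)(l)\<close> at \<open>f(z) = e\<^sup>x\<^sup>z p(z)\<close>.\<close>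

definition pairing :: "complex \<Rightarrow> complex poly \<Rightarrow> complex \<Rightarrow> complex poly \<Rightarrow> complex" where
  "pairing l u x p = (\<Sum>j\<le>degree u. coeff u j * poly ((dpoly x ^^ j) p) l)"

lemma dpoly_0 [simp]: "dpoly l 0 = 0" by (simp add: dpoly_def)

lemma dpoly_add: "dpoly l (f + g) = dpoly l f + dpoly l g"
  by (simp add: dpoly_def pderiv_add smult_add_right)

lemma dpoly_smult: "dpoly l (smult c f) = smult c (dpoly l f)"
  by (simp add: dpoly_def pderiv_smult smult_add_right mult.commute)

lemma dpoly_funpow_0 [simp]: "(dpoly l ^^ i) 0 = 0"
  by (induction i) simp_all

lemma dpoly_funpow_add: "(dpoly l ^^ i) (f + g) = (dpoly l ^^ i) f + (dpoly l ^^ i) g"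
  by (induction i) (simp_all add: dpoly_add)

lemma dpoly_funpow_smult: "(dpoly l ^^ i) (smult c f) = smult c ((dpoly l ^^ i) f)"
  by (induction i) (simp_all add: dpoly_smult)

lemma tderiv_ratpoly [simp]: "tderiv l (ratpoly f) = ratpoly (dpoly l f)"
  by (simp add: tderiv_def dpoly_def ratpoly_add ratpoly_smult)

lemma tderiv_funpow_ratpoly [simp]: "(tderiv l ^^ i) (ratpoly f) = ratpoly ((dpoly l ^^ i) f)"
  by (induction i) simp_all

lemma coeff_dop_of [simp]: "coeff (dop_of P) i = ratpoly (coeff P i)"
  by (simp add: dop_of_def coeff_map_poly)

lemma degree_dop_of [simp]: "degree (dop_of P) = degree P"
  by (simp add: dop_of_def degree_map_poly)

lemma dop_of_eq_iff [simp]: "dop_of P = dop_of Q \<longleftrightarrow> P = Q"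
  by (auto simp: poly_eq_iff[of "dop_of P"] intro: poly_eqI)

lemma dop_of_0 [simp]: "dop_of 0 = 0" by (simp add: dop_of_def)

lemma dop_of_eq_0_iff [simp]: "dop_of P = 0 \<longleftrightarrow> P = 0"
  using dop_of_eq_iff[of P 0] by (simp del: dop_of_eq_iff)

lemma dop_of_add: "dop_of (P + Q) = dop_of P + dop_of Q"
  by (rule poly_eqI) (simp add: ratpoly_add)

lemma dop_of_smult: "dop_of (smult p Q) = smult (ratpoly p) (dop_of Q)"
  by (rule poly_eqI) (simp add: ratpoly_mult)

lemma dop_of_pCons: "dop_of (pCons a P) = pCons (ratpoly a) (dop_of P)"
  by (simp add: dop_of_def map_poly_pCons)

lemma dop_of_mult: "dop_of (P * Q) = dop_of P * dop_of Q"
  by (rule poly_eqI) (simp add: coeff_mult ratpoly_sum ratpoly_mult)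

lemma weyl_eq: "weyl = range dop_of"
proof (intro equalityI subsetI)
  fix D assume "D \<in> weyl"
  then obtain c where c: "\<And>i. coeff D i = ratpoly (c i)" by (auto simp: weyl_def) metis
  have "D = dop_of (\<Sum>i\<le>degree D. monom (c i) i)"
  proof (rule poly_eqI)
    fix n
    show "coeff D n = coeff (dop_of (\<Sum>i\<le>degree D. monom (c i) i)) n"
    proof (cases "n \<le> degree D")
      case True
      thus ?thesis by (simp add: coeff_sum c)
    next
      case False
      thus ?thesis by (simp add: coeff_sum coeff_eq_0)
    qed
  qed
  thus "D \<in> range dop_of" by blast
qed (auto simp: weyl_def)

lemma act_dop_of [simp]: "act l (dop_of P) (ratpoly f) = ratpoly (pact l P f)"
  by (simp add: act_def pact_def ratpoly_sum ratpoly_mult)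

lemma pact_0 [simp]: "pact l 0 f = 0" and pact_0_right [simp]: "pact l P 0 = 0"
  by (simp_all add: pact_def)

lemma pact_pCons: "pact l (pCons a P) f = a * f + pact l P (dpoly l f)"
proof -
  have "ratpoly (pact l (pCons a P) f) = ratpoly (a * f + pact l P (dpoly l f))"
    by (simp add: dop_of_pCons act_pCons ratpoly_add ratpoly_mult flip: act_dop_of)
  thus ?thesis by simp
qed

lemma pact_add: "pact l (P + Q) f = pact l P f + pact l Q f"
proof -
  have "ratpoly (pact l (P + Q) f) = ratpoly (pact l P f + pact l Q f)"
    by (simp add: dop_of_add act_add ratpoly_add flip: act_dop_of)
  thus ?thesis by simp
qed

lemma pact_smult: "pact l (smult a P) f = a * pact l P f"
proof -
  have "ratpoly (pact l (smult a P) f) = ratpoly (a * pact l P f)"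
    by (simp add: dop_of_smult act_smult ratpoly_mult flip: act_dop_of)
  thus ?thesis by simp
qed

lemma pact_add_right: "pact l P (f + g) = pact l P f + pact l P g"
  by (simp add: pact_def dpoly_funpow_add sum.distrib algebra_simps)

lemma pact_smult_right: "pact l P (smult c g) = smult c (pact l P g)"
proof -
  have "ratpoly (pact l P (smult c g)) = ratpoly (smult c (pact l P g))"
    by (simp add: ratpoly_smult act_const_right flip: act_dop_of)
  thus ?thesis by simp
qed

lemma coeff_const_op [simp]: "coeff (const_op p) i = [:coeff p i:]"
  by (simp add: const_op_def coeff_map_poly)

lemma const_op_0 [simp]: "const_op 0 = 0" by (simp add: const_op_def)

lemma const_op_pCons: "const_op (pCons c p) = pCons [:c:] (const_op p)"
  by (simp add: const_op_def map_poly_pCons)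

lemma degree_const_op [simp]: "degree (const_op p) = degree p"
  by (simp add: const_op_def degree_map_poly)

lemma coeff_swap_op [simp]: "coeff (coeff (swap_op P) j) i = coeff (coeff P i) j"
proof -
  have "coeff (coeff (swap_op P) j) i =
     (\<Sum>i'\<le>degree P. \<Sum>j'\<le>degree (coeff P i'). if j' = j \<and> i' = i then coeff (coeff P i') j' else 0)"
    unfolding swap_op_def coeff_sum by (intro sum.cong) auto
  also have "\<dots> = (\<Sum>i'\<le>degree P. if i' = i then coeff (coeff P i') j else 0)"
  proof (rule sum.cong [OF refl])
    fix i'
    have "(\<Sum>j'\<le>degree (coeff P i'). if j' = j \<and> i' = i then coeff (coeff P i') j' else 0)
      = (\<Sum>j'\<le>degree (coeff P i'). if j' = j then (if i' = i then coeff (coeff P i') j else 0) else 0)"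
      by (intro sum.cong) auto
    also have "\<dots> = (if i' = i then coeff (coeff P i') j else 0)"
      by (auto simp: coeff_eq_0)
    finally show "(\<Sum>j'\<le>degree (coeff P i'). if j' = j \<and> i' = i then coeff (coeff P i') j' else 0) =
       (if i' = i then coeff (coeff P i') j else 0)" .
  qed
  also have "\<dots> = coeff (coeff P i) j"
    by (auto simp: coeff_eq_0)
  finally show ?thesis .
qed

lemma bipoly_eqI: "(\<And>i j. coeff (coeff P i) j = coeff (coeff Q i) j) \<Longrightarrow> P = Q"
  by (intro poly_eqI) simp

lemma swap_op_swap_op [simp]: "swap_op (swap_op P) = P"
  by (rule bipoly_eqI) simp

lemma swap_op_0 [simp]: "swap_op 0 = 0"
  by (rule bipoly_eqI) simp

lemma swap_op_const [simp]: "swap_op [:p:] = const_op p"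
  by (rule bipoly_eqI) (simp add: coeff_pCons split: nat.splits)

lemma swap_op_const_op [simp]: "swap_op (const_op p) = [:p:]"
  using swap_op_swap_op[of "[:p:]"] by simp

lemma swap_op_smult: "swap_op (smult p P) = const_op p * swap_op P"
proof (rule bipoly_eqI)
  fix i j
  have "coeff (coeff (const_op p * swap_op P) i) j =
     (\<Sum>k\<le>i. coeff p k * coeff (coeff (swap_op P) (i - k)) j)"
    by (simp add: coeff_mult coeff_sum)
  also have "\<dots> = coeff (coeff (swap_op (smult p P)) i) j"
    by (simp add: coeff_mult)
  finally show "coeff (coeff (swap_op (smult p P)) i) j = coeff (coeff (const_op p * swap_op P) i) j" ..
qed

lemma swap_op_pCons: "swap_op (pCons a P) = const_op a + smult [:0, 1:] (swap_op P)"
  by (rule bipoly_eqI) (simp add: coeff_pCons split: nat.splits)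

lemma const_op_eq_0_iff [simp]: "const_op p = 0 \<longleftrightarrow> p = 0"
proof
  assume "const_op p = 0"
  hence "[:p:] = 0" by (metis swap_op_const_op swap_op_0)
  thus "p = 0" by simp
qed simp

lemma pairing_altdef:
  "degree u \<le> n \<Longrightarrow> pairing l u x p = (\<Sum>j\<le>n. coeff u j * poly ((dpoly x ^^ j) p) l)"
  unfolding pairing_def by (rule sum.mono_neutral_left) (auto simp: coeff_eq_0)

lemma pairing_0 [simp]: "pairing l 0 x p = 0" and pairing_0_right [simp]: "pairing l u x 0 = 0"
  by (simp_all add: pairing_def)

lemma pairing_add: "pairing l (u + v) x p = pairing l u x p + pairing l v x p"
proof -
  define n where "n = max (degree u) (degree v)"
  have "degree (u + v) \<le> n" "degree u \<le> n" "degree v \<le> n"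
    by (auto simp: n_def degree_add_le)
  thus ?thesis by (simp add: pairing_altdef[of _ n] sum.distrib algebra_simps)
qed

lemma pairing_smult: "pairing l (smult c u) x p = c * pairing l u x p"
  using degree_smult_le[of c u]
  by (simp add: pairing_altdef[of _ "degree u"] sum_distrib_left mult.assoc)

lemma pairing_add_right: "pairing l u x (p + q) = pairing l u x p + pairing l u x q"
  by (simp add: pairing_def dpoly_funpow_add sum.distrib algebra_simps)

lemma pairing_smult_right: "pairing l u x (smult c p) = c * pairing l u x p"
  by (simp add: pairing_def dpoly_funpow_smult sum_distrib_left algebra_simps)

lemma pairing_diff_right: "pairing l u x (p - q) = pairing l u x p - pairing l u x q"
  using pairing_add_right[of l u x "p - q" q] by simp

lemma pairing_sum_right: "pairing l u x (sum f A) = (\<Sum>a\<in>A. pairing l u x (f a))"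
  by (induction A rule: infinite_finite_induct) (simp_all add: pairing_add_right)

lemma pairing_pCons: "pairing l (pCons a u) x p = a * poly p l + pairing l u x (dpoly x p)"
proof -
  have "degree (pCons a u) \<le> Suc (degree u)" by (simp add: degree_pCons_eq_if)
  thus ?thesis
    by (simp add: pairing_altdef[of _ "Suc (degree u)"] sum.atMost_Suc_shift funpow_swap1 pairing_def
      del: sum.atMost_Suc)
qed

lemma pairing_one_right: "pairing l u x 1 = poly u x"
proof -
  have "(dpoly x ^^ j) 1 = [:x ^ j:]" for j
    by (induction j) (simp_all add: dpoly_def one_pCons)
  thus ?thesis by (simp add: pairing_def poly_altdef)
qed

lemma pairing_z_right: "pairing l u x (pCons 0 p) = pairing l (dpoly l u) x p"
proof (induction u arbitrary: p)
  case (pCons a u)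
  have *: "dpoly x (pCons 0 p) = pCons 0 (dpoly x p) + p"
    by (simp add: dpoly_def pderiv_pCons)
  have "dpoly l (pCons a u) = u + pCons (l * a) (dpoly l u)"
    by (simp add: dpoly_def pderiv_pCons)
  thus ?case by (simp add: pairing_pCons pairing_add * pairing_add_right pCons.IH)
qed simp

text \<open>Both sides are e^(-xl) times u(d/dz) p(d/dx) e^(xz) at z = l, and the two derivations
  commute. Every exchange of space and spectral variable goes back to this.\<close>

theorem pairing_symmetric: "pairing l u x p = pairing x p l u"
proof (induction p arbitrary: u)
  case (pCons a p)
  have "pCons a p = smult a 1 + pCons 0 p" by (simp add: one_pCons)
  hence "pairing l u x (pCons a p) = a * poly u x + pairing l (dpoly l u) x p"
    by (metis pairing_add_right pairing_smult_right pairing_one_right pairing_z_right)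
  thus ?case by (simp add: pairing_pCons pCons.IH)
qed simp

lemma pairing_dpoly_right: "pairing l u x (dpoly x p) = pairing l (pCons 0 u) x p"
  by (simp add: pairing_pCons)

lemma pairing_mult_right: "pairing l u x (g * f) = pairing l (pact l (const_op g) u) x f"
proof (induction g arbitrary: u)
  case (pCons a g)
  have "pCons a g * f = smult a f + pCons 0 (g * f)" by simp
  thus ?case
    by (simp add: pairing_add_right pairing_smult_right pairing_z_right pCons.IH const_op_pCons
        pact_pCons pairing_add pairing_smult)
qed simp

text \<open>On the side of the functional, multiplication by z becomes \<open>dpoly l\<close> and
  \<open>dpoly x\<close> becomes multiplication by the variable, in reversed order. The transpose of
  an operator is therefore its image under b.\<close>

theorem pairing_transpose: "pairing l u x (pact x P f) = pairing l (pact l (swap_op P) u) x f"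
proof (induction P arbitrary: f)
  case (pCons a P)
  show ?case
    by (simp add: swap_op_pCons pact_pCons pairing_add_right pairing_mult_right pCons.IH pact_add pact_smult
        pairing_add pairing_dpoly_right del: swap_op_const)
qed simp

lemma pairing_shift: "pairing l u x ([:-l, 1:] * f) = pairing l (pderiv u) x f"
proof -
  have "[:-l, 1:] * f = pCons 0 f - smult l f" by simp
  thus ?thesis
    by (simp add: pairing_diff_right pairing_smult_right pairing_z_right dpoly_def pairing_add
        pairing_smult)
qed

text \<open>Multiplying the test polynomial by z - l differentiates \<open>u\<close>, so the
  induction forces \<open>u\<close> to be constant; the test polynomial 1 reads off the
  constant.\<close>

lemma pairing_nondegenerate:
  assumes "\<And>f. pairing l u x f = 0"
  shows "u = 0"
  using assms
proof (induction "degree u" arbitrary: u rule: less_induct)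
  case less
  have "pderiv u = 0"
  proof (cases "degree u = 0")
    case False
    thus ?thesis using less.prems pairing_shift[of l u x]
      by (intro less.hyps) (simp_all add: degree_pderiv)
  qed (simp add: pderiv_eq_0_iff)
  then obtain c where "u = [:c:]" by (metis pderiv_eq_0_iff degree_eq_zeroE)
  thus ?case using less.prems[of 1] by (simp add: pairing_one_right)
qed

lemma pairing_power_shift_eq_0:
  assumes "degree u < n" "[:-l, 1:] ^ n dvd f"
  shows "pairing l u x f = 0"
proof -
  obtain g where g: "f = [:-l, 1:] ^ n * g" using assms(2) by blast
  have "pairing l u x ([:-l, 1:] ^ n * g) = pairing l ((pderiv ^^ n) u) x g" for n
  proof (induction n arbitrary: u)
    case (Suc n)
    have "[:-l, 1:] ^ Suc n * g = [:-l, 1:] * ([:-l, 1:] ^ n * g)"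
      by (simp only: power_Suc mult.assoc)
    thus ?case using Suc[of "pderiv u"] by (simp only: pairing_shift funpow_swap1 funpow.simps o_apply)
  qed simp
  thus ?thesis using assms(1) g by (simp add: pderiv_funpow_eq_0)
qed

lemma pderiv_pcompose_shift: "pderiv (pcompose u [:t, 1:]) = pcompose (pderiv u) [:t, 1:]"
  by (simp add: pderiv_pcompose pderiv_pCons)

lemma dpoly_pcompose_shift: "dpoly l (pcompose u [:t, 1:]) = pcompose (dpoly l u) [:t, 1:]"
  by (simp add: dpoly_def pderiv_pcompose_shift pcompose_add pcompose_smult)

lemma dpoly_funpow_pcompose_shift:
  "(dpoly l ^^ n) (pcompose u [:t, 1:]) = pcompose ((dpoly l ^^ n) u) [:t, 1:]"
  by (induction n) (simp_all add: dpoly_pcompose_shift)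

text \<open>Passing a factor e^(tz) through u(d/dz) replaces u by its translate. Conditions at
  different spectral values become comparable in this way.\<close>

lemma pairing_pcompose_shift: "pairing l (pcompose u [:t, 1:]) x f = pairing l u (x + t) f"
  unfolding pairing_symmetric[of l] pairing_def[of x] pairing_def[of "x + t"]
  by (simp add: dpoly_funpow_pcompose_shift poly_pcompose add.commute)

subsection \<open>The annihilating operator of a family of quasi-polynomials\<close>

lemma coeff_mult_degree_le:
  assumes "degree a \<le> m" "degree b \<le> n"
  shows "coeff (a * b) (m + n) = coeff a m * coeff b n"
proof -
  have "coeff a i * coeff b (m + n - i) = 0" if "i \<noteq> m" for i
  proof (cases "i < m")
    case True
    hence "degree b < m + n - i" using assms(2) by linarith
    thus ?thesis by (simp add: coeff_eq_0)
  next
    case False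
    hence "degree a < i" using assms(1) that by linarith
    thus ?thesis by (simp add: coeff_eq_0)
  qed
  hence "coeff (a * b) (m + n) = (\<Sum>i\<le>m + n. if i = m then coeff a m * coeff b n else 0)"
    unfolding coeff_mult by (intro sum.cong) auto
  thus ?thesis by simp
qed

text \<open>The top coefficient of p' q - p q' = c p q forces c = 0, the next one forces p and q to
  have equal degree. It stands in for Wronskian arguments: it separates exponentials of different
  rates and identifies constants of integration.\<close>

lemma ratfun_deriv_eigen_imp:
  assumes "ratfun_deriv f = rconst c * f" "f \<noteq> 0"
  shows "c = 0 \<and> f \<in> range rconst"
proof -
  have main: "c = 0 \<and> degree p = degree q"
    if d: "ratfun_deriv (Fract p q) = rconst c * Fract p q" and nz: "p \<noteq> 0" "q \<noteq> 0"
    for c p q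
  proof -
    have "Fract (pderiv p * q - p * pderiv q) (q * q) = Fract ([:c:] * p) q"
      using d nz by (simp add: ratfun_deriv_Fract ratpoly_def)
    hence "(pderiv p * q - p * pderiv q) * q = smult c (p * q) * q"
      using nz by (simp add: eq_fract algebra_simps)
    hence e: "pderiv p * q - p * pderiv q = smult c (p * q)"
      using nz(2) by (rule mult_right_cancel[THEN iffD1, rotated])
    have "coeff (pderiv p * q) (degree p + degree q) = 0"
      by (subst coeff_mult_degree_le) (simp_all add: degree_pderiv coeff_pderiv coeff_eq_0)
    moreover have "coeff (p * pderiv q) (degree p + degree q) = 0"
      by (subst coeff_mult_degree_le) (simp_all add: degree_pderiv coeff_pderiv coeff_eq_0)
    moreover have "coeff (p * q) (degree p + degree q) \<noteq> 0"
      using nz by (simp add: coeff_mult_degree_sum)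
    ultimately have c: "c = 0"
      using arg_cong[OF e, of "\<lambda>r. coeff r (degree p + degree q)"] by simp
    have z1: "degree (pCons 0 (pderiv r)) \<le> degree r" for r :: "complex poly"
    proof (cases "pderiv r = 0")
      case False
      hence "degree r \<noteq> 0" by (simp add: pderiv_eq_0_iff)
      thus ?thesis using False by (simp add: degree_pderiv)
    qed simp
    have z2: "coeff (pCons 0 (pderiv r)) (degree r) = of_nat (degree r) * lead_coeff r"
      for r :: "complex poly"
      by (cases "degree r") (simp_all add: coeff_pderiv)
    \<comment> \<open>The extra factor z gives z p' degree at most deg p, with coefficient deg p
      times the leading one, so a single coefficient comparison yields deg p = deg q.\<close>
    have "pCons 0 (pderiv p) * q = p * pCons 0 (pderiv q)"
      using e c by simp
    hence "coeff (pCons 0 (pderiv p) * q) (degree p + degree q) = 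
       coeff (p * pCons 0 (pderiv q)) (degree p + degree q)" by (simp only:)
    hence "coeff (pCons 0 (pderiv p)) (degree p) * lead_coeff q = 
       lead_coeff p * coeff (pCons 0 (pderiv q)) (degree q)"
      by (simp only: coeff_mult_degree_le z1 order.refl)
    hence "of_nat (degree p) * (lead_coeff p * lead_coeff q) = 
       of_nat (degree q) * (lead_coeff p * lead_coeff q)"
      unfolding z2 by (simp add: algebra_simps)
    thus ?thesis using nz c by simp
  qed
  obtain p q where f: "f = Fract p q" "q \<noteq> 0" by (cases f) auto
  have p: "p \<noteq> 0" using assms(2) f by (auto simp: fract_collapse)
  have *: "c = 0" "degree p = degree q" using main[of p q c] assms f p by auto
  \<comment> \<open>The value of \<open>f\<close> at infinity. If f - \<open>a\<close> were
    non-zero, \<open>main\<close> would apply to it again, but the coefficient of its numerator in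
    degree deg q cancels.\<close>
  define a where "a = lead_coeff p / lead_coeff q"
  have "p - smult a q = 0"
  proof (rule ccontr)
    assume nz: "p - smult a q \<noteq> 0"
    have sub: "Fract (p - smult a q) q = f - rconst a"
      using f by (simp add: ratpoly_def eq_fract algebra_simps)
    have "ratfun_deriv (Fract (p - smult a q) q) = rconst 0 * Fract (p - smult a q) q"
      unfolding sub using assms(1) * by (simp add: ratfun_deriv_diff pderiv_pCons)
    hence deg: "degree (p - smult a q) = degree q" using main nz f(2) by blast
    moreover have "coeff (p - smult a q) (degree q) = 0"
      using * f(2) by (simp add: a_def)
    ultimately show False using nz by (metis leading_coeff_0_iff)
  qed
  hence "f = rconst a" using f by (simp add: ratpoly_def eq_fract)
  thus ?thesis using * by blast
qed

lemma tderiv_act: "tderiv l (act l D w) = act l D (tderiv l w) + act l (map_poly ratfun_deriv D) w"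
proof (induction D arbitrary: w)
  case (pCons a D)
  have "map_poly ratfun_deriv (pCons a D) = pCons (ratfun_deriv a) (map_poly ratfun_deriv D)"
    by (simp add: map_poly_pCons)
  thus ?case by (simp add: act_pCons tderiv_add tderiv_mult' pCons.IH algebra_simps)
qed simp

lemma dop_mult_d_left: "dop_mult [:0, 1:] D = pCons 0 D + map_poly ratfun_deriv D"
proof (rule diffop_eqI)
  fix w
  have "act 0 (dop_mult [:0, 1:] D) w = tderiv 0 (act 0 D w)"
    by (simp add: act_dop_mult act_pCons)
  also have "\<dots> = act 0 (pCons 0 D + map_poly ratfun_deriv D) w"
    by (subst tderiv_act) (simp add: act_add act_pCons)
  finally show "act 0 (dop_mult [:0, 1:] D) w = act 0 (pCons 0 D + map_poly ratfun_deriv D) w" .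
qed

lemma coeff_dop_mult_first_order:
  "coeff (dop_mult [:- s, 1:] D) i =
     (case i of 0 \<Rightarrow> 0 | Suc k \<Rightarrow> coeff D k) + ratfun_deriv (coeff D i) - s * coeff D i"
proof -
  have "dop_mult [:- s, 1:] D = smult (- s) D + dop_mult [:0, 1:] D"
    using dop_mult_pCons_left[of "-s" "[:1:]" D] by simp
  thus ?thesis
    by (simp add: dop_mult_d_left coeff_pCons coeff_map_poly split: nat.splits)
qed

lemma dop_right_division: "\<exists>T c. D = dop_mult T [:- s, 1:] + [:c:]"
proof -
  \<comment> \<open>Composition with an arbitrary function \<open>f\<close> is what makes the
    induction close: moving one derivation past \<open>f\<close> replaces it by
    \<open>f * s + ratfun_deriv f\<close>.\<close>
  have "\<exists>T c. dop_mult D [:f:] = dop_mult T [:- s, 1:] + [:c:]" for f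
  proof (induction D arbitrary: f)
    case 0
    show ?case by (rule exI[of _ 0], rule exI[of _ 0]) simp
  next
    case (pCons a D)
    have e: "dop_mult [:0, 1:] [:f:] = dop_mult [:f:] [:- s, 1:] + [:f * s + ratfun_deriv f:]"
      by (simp add: dop_mult_d_left map_poly_pCons)
    from pCons.IH[of "f * s + ratfun_deriv f"] obtain T c where
      T: "dop_mult D [:f * s + ratfun_deriv f:] = dop_mult T [:- s, 1:] + [:c:]"
      by blast
    have "dop_mult (pCons a D) [:f:] = [:a * f:] + dop_mult D (dop_mult [:0, 1:] [:f:])"
      by (subst dop_mult_pCons_left) simp
    also have "dop_mult D (dop_mult [:0, 1:] [:f:]) = 
        dop_mult (dop_mult D [:f:] + T) [:- s, 1:] + [:c:]"
      unfolding e dop_mult_add_right T by (simp only: dop_mult_assoc dop_mult_add_left add.assoc)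
    also have "[:a * f:] + (dop_mult (dop_mult D [:f:] + T) [:- s, 1:] + [:c:]) = 
       dop_mult (dop_mult D [:f:] + T) [:- s, 1:] + [:a * f + c:]" by simp
    finally show ?case by (intro exI)
  qed
  moreover have "dop_mult D [:1:] = D" using dop_mult_1_right[of D] by (simp only: one_pCons)
  ultimately show ?thesis by metis
qed

type_synonym conds = "(complex \<times> complex poly) list"

definition dlog :: "ratfun \<Rightarrow> ratfun" where
  "dlog r = ratfun_deriv r / r"

text \<open>The monic operator of order \<open>length xs\<close> annihilating all \<open>e\<^sup>l\<^sup>x u(x)\<close>,
  \<open>(l, u) \<in> set xs\<close>.\<close>

fun annop :: "conds \<Rightarrow> diffop" where
  "annop [] = 1"
| "annop ((l, u) # xs) =
     dop_mult [:- (rconst l + dlog (act l (annop xs) (ratpoly u))), 1:] (annop xs)"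

text \<open>The conditions at one point \<open>l\<close> are required to be linearly independent;
  conditions at different points do not interact.\<close>

fun indep_conds :: "conds \<Rightarrow> bool" where
  "indep_conds [] = True"
| "indep_conds ((l, u) # xs) = (indep_conds xs \<and>
     (\<exists>f. (\<forall>v. (l, v) \<in> set xs \<longrightarrow> pairing l v 0 f = 0) \<and> pairing l u 0 f \<noteq> 0))"

definition conds_space :: "conds \<Rightarrow> complex poly set" where
  "conds_space xs = {f. \<forall>(l, u) \<in> set xs. pairing l u 0 f = 0}"

definition conds_poly :: "conds \<Rightarrow> complex poly" where
  "conds_poly xs = (\<Prod>(l, u) \<leftarrow> xs. [:- l, 1:])"

lemma conds_poly_Nil [simp]: "conds_poly [] = 1"
  and conds_poly_Cons [simp]: "conds_poly ((l, u) # xs) = [:- l, 1:] * conds_poly xs"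
  by (simp_all add: conds_poly_def)

lemma conds_poly_append: "conds_poly (xs @ ys) = conds_poly xs * conds_poly ys"
  by (simp add: conds_poly_def)

lemma conds_poly_monic: "degree (conds_poly xs) = length xs \<and> lead_coeff (conds_poly xs) = 1"
proof (induction xs)
  case (Cons x xs)
  obtain l u where x: "x = (l, u)" by force
  have nz: "conds_poly xs \<noteq> 0" using Cons by auto
  have "degree ([:- l, 1:] * conds_poly xs) = Suc (length xs)"
    using nz Cons by (subst degree_mult_eq) auto
  moreover have "lead_coeff ([:- l, 1:] * conds_poly xs) = 1"
    using Cons by (subst lead_coeff_mult) (auto simp del: mult_pCons_left)
  ultimately show ?case by (simp add: x del: mult_pCons_left)
qed simp

lemma degree_conds_poly [simp]: "degree (conds_poly xs) = length xs"
  using conds_poly_monic by blast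

lemma conds_poly_nonzero [simp]: "conds_poly xs \<noteq> 0"
  using conds_poly_monic[of xs] by auto

lemma coeff_conds_poly [simp]: "coeff (conds_poly xs) (length xs) = 1"
  using conds_poly_monic[of xs] by auto

lemma poly_conds_poly_eq_0_iff: "poly (conds_poly xs) z = 0 \<longleftrightarrow> z \<in> fst ` set xs"
  by (induction xs) (auto simp del: mult_pCons_left)

lemma annop_monic: "degree (annop xs) = length xs \<and> coeff (annop xs) (length xs) = 1"
proof (induction xs)
  case (Cons x xs)
  obtain l u where x: "x = (l, u)" by force
  define s where "s = rconst l + dlog (act l (annop xs) (ratpoly u))"
  have L: "annop (x # xs) = dop_mult [:- s, 1:] (annop xs)" by (simp add: x s_def)
  have "coeff (annop (x # xs)) n = 0" if "n > Suc (length xs)" for n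
  proof -
    define m where "m = n - 1"
    have n: "n = Suc m" "m > length xs" using that by (auto simp: m_def)
    thus ?thesis unfolding L coeff_dop_mult_first_order using Cons by (simp add: coeff_eq_0)
  qed
  hence "degree (annop (x # xs)) \<le> Suc (length xs)" by (intro degree_le) auto
  moreover have c: "coeff (annop (x # xs)) (Suc (length xs)) = 1"
    unfolding L coeff_dop_mult_first_order using Cons by (simp add: coeff_eq_0)
  ultimately show ?case by (metis le_degree le_antisym length_Cons zero_neq_one)
qed simp

lemma degree_annop [simp]: "degree (annop xs) = length xs"
  and coeff_annop_length [simp]: "coeff (annop xs) (length xs) = 1"
  using annop_monic by auto

lemma annop_nonzero [simp]: "annop xs \<noteq> 0"
  using coeff_annop_length[of xs] by (metis coeff_0 zero_neq_one)

lemma act_annop_Cons: "act l' (annop ((l, u) # xs)) w =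
   tderiv l' (act l' (annop xs) w) -
     (rconst l + dlog (act l (annop xs) (ratpoly u))) * act l' (annop xs) w"
  by (simp add: act_dop_mult act_pCons algebra_simps)

lemma act_annop_eq_0:
  assumes "(l, u) \<in> set xs"
  shows "act l (annop xs) (ratpoly u) = 0"
  using assms
proof (induction xs)
  case (Cons x xs)
  obtain l' u' where x: "x = (l', u')" by force
  show ?case
  proof (cases "(l, u) \<in> set xs")
    case True
    thus ?thesis using Cons.IH by (simp add: x act_annop_Cons del: annop.simps)
  next
    case False
    hence "l' = l" "u' = u" using Cons.prems x by auto
    \<comment> \<open>The newest factor is the first order operator killing e^(lx) r, where r is
      \<open>act l (annop xs) (ratpoly u)\<close>. For r = 0 the value \<open>dlog 0 = 0\<close>
      leaves an equation between zeros.\<close>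
    thus ?thesis by (cases "act l (annop xs) (ratpoly u) = 0")
      (simp_all add: x act_annop_Cons dlog_def tderiv_def field_simps del: annop.simps)
  qed
qed simp

text \<open>Vanishing of every linear functional that kills the \<open>u\<close> with \<open>(l, u) \<in> set xs\<close>
  expresses membership of \<open>w\<close> in their span.\<close>

lemma annop_kernel:
  assumes "indep_conds xs" "act l (annop xs) (ratpoly w) = 0"
  assumes "\<And>p q. F (p + q) = F p + F q" "\<And>c p. F (smult c p) = c * F p"
  assumes "\<And>u. (l, u) \<in> set xs \<Longrightarrow> F u = 0"
  shows "F w = (0 :: complex)"
  using assms
proof (induction xs arbitrary: w l F)
  case Nil
  thus ?case using Nil.prems(4)[of 0 0] by simp
next
  case (Cons x xs)
  obtain l' u where x: "x = (l', u)" by force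
  define r where "r = act l' (annop xs) (ratpoly u)"
  define y where "y = act l (annop xs) (ratpoly w)"
  have ind: "indep_conds xs" using Cons.prems by (simp add: x)
  have r0: "r \<noteq> 0"
  proof
    assume "r = 0"
    moreover obtain f where f: "\<And>v. (l', v) \<in> set xs \<Longrightarrow> pairing l' v 0 f = 0" "pairing l' u 0 f \<noteq> 0"
      using Cons.prems(1) by (auto simp: x)
    ultimately have "pairing l' u 0 f = 0"
      using Cons.IH[of l' u "\<lambda>v. pairing l' v 0 f"] ind
      by (simp add: r_def pairing_add pairing_smult)
    thus False using f by simp
  qed
  have "ratfun_deriv y + rconst l * y - (rconst l' + dlog r) * y = 0"
    using Cons.prems(2) by (simp add: x act_annop_Cons r_def y_def tderiv_def del: annop.simps)
  hence dy: "ratfun_deriv y = (rconst (l' - l) + dlog r) * y"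
    by (simp add: rconst_diff algebra_simps)
  show ?case
  proof (cases "y = 0")
    case True
    thus ?thesis using Cons.IH[OF ind, of l w F] Cons.prems(3-5) by (simp add: y_def)
  next
    case False
    \<comment> \<open>The quotient \<open>y / r\<close> satisfies f' = (l' - l) f, so l' = l and
      \<open>y\<close> is a constant multiple of \<open>r\<close>. Subtracting the same multiple of
      \<open>u\<close> from \<open>w\<close> gives a kernel element for the shorter list.\<close>
    have "ratfun_deriv (y / r * r) = ratfun_deriv (y / r) * r + (y / r) * ratfun_deriv r"
      by (rule ratfun_deriv_mult)
    hence "ratfun_deriv (y / r) * r = rconst (l' - l) * (y / r) * r"
      using r0 dy by (simp add: dlog_def field_simps)
    hence "ratfun_deriv (y / r) = rconst (l' - l) * (y / r)" using r0 by (metis mult_right_cancel)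
    hence "l' - l = 0 \<and> y / r \<in> range rconst"
      by (rule ratfun_deriv_eigen_imp) (use False r0 in simp)
    then obtain c where c: "l' = l" "y / r = rconst c" by auto
    hence "y = rconst c * r" using r0 by (simp add: field_simps)
    hence "act l (annop xs) (ratpoly (w - smult c u)) = 0"
      using c(1) by (simp add: y_def r_def ratpoly_diff ratpoly_smult act_diff_right act_const_right)
    from Cons.IH[OF ind this] have "F (w - smult c u) = 0" using Cons.prems(3-5) by simp
    moreover have "F u = 0" using Cons.prems(5)[of u] x c by simp
    ultimately show ?thesis
      using Cons.prems(3)[of "w - smult c u" "smult c u"] Cons.prems(4)[of c u] by simp
  qed
qed

lemma annop_head_nonzero:
  assumes "indep_conds ((l, u) # xs)"
  shows "act l (annop xs) (ratpoly u) \<noteq> 0"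
proof
  assume "act l (annop xs) (ratpoly u) = 0"
  moreover obtain f where f: "\<And>v. (l, v) \<in> set xs \<Longrightarrow> pairing l v 0 f = 0" "pairing l u 0 f \<noteq> 0"
    using assms by auto
  ultimately have "pairing l u 0 f = 0"
    using annop_kernel[of xs l u "\<lambda>v. pairing l v 0 f"] assms
    by (simp add: pairing_add pairing_smult)
  thus False using f by simp
qed

text \<open>First order factors are split off on the right one by one; the remainder is a function
  \<open>c\<close> with c r = 0 for a non-zero r, hence zero.\<close>

lemma annop_divides:
  assumes "indep_conds xs" "\<And>l u. (l, u) \<in> set xs \<Longrightarrow> act l D (ratpoly u) = 0"
  shows "\<exists>T. D = dop_mult T (annop xs)"
  using assms
proof (induction xs)
  case (Cons x xs)
  obtain l u where x: "x = (l, u)" by force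
  define r where "r = act l (annop xs) (ratpoly u)"
  have r0: "r \<noteq> 0" using annop_head_nonzero Cons.prems(1) by (simp add: r_def x)
  obtain T where T: "D = dop_mult T (annop xs)"
    using Cons.IH Cons.prems by (auto simp: x)
  define s where "s = rconst l + dlog r"
  obtain T' c where T': "T = dop_mult T' [:- s, 1:] + [:c:]"
    using dop_right_division by blast
  have "act l [:- s, 1:] r = 0"
    using r0 by (simp add: act_pCons s_def tderiv_def dlog_def field_simps)
  moreover have "act l T r = 0"
    using Cons.prems(2)[of l u] T by (simp add: x act_dop_mult r_def)
  ultimately have "c * r = 0" by (simp add: T' act_add act_dop_mult)
  hence "T = dop_mult T' [:- s, 1:]" using r0 T' by simp
  hence "D = dop_mult T' (annop (x # xs))"
    by (simp add: T x s_def r_def dop_mult_assoc)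
  thus ?case by blast
qed (auto intro: exI[of _ D])

text \<open>Non-vanishing of the Wronskian of the e^(lx) u, expressed as solvability for every
  right-hand side so that no determinant appears.\<close>

lemma annop_system_solvable:
  assumes "indep_conds xs"
  shows "\<exists>v. \<forall>n<length xs.
     (\<Sum>i<length xs. v i * (tderiv (fst (xs ! i)) ^^ n) (ratpoly (snd (xs ! i)))) = b n"
  using assms
proof (induction xs arbitrary: b)
  case (Cons x xs)
  obtain l u where x: "x = (l, u)" by force
  define L where "L = annop xs"
  define k where "k = length xs"
  define r where "r = act l L (ratpoly u)"
  have r0: "r \<noteq> 0" using annop_head_nonzero Cons.prems by (simp add: r_def x L_def)
  \<comment> \<open>Combining the equations with the coefficients of \<open>L\<close> kills the
    columns of \<open>xs\<close> and leaves c r, which forces this value. Since \<open>L\<close> is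
    monic, the last equation follows from the same combination.\<close>
  define c where "c = (\<Sum>j\<le>k. coeff L j * b j) / r"
  define \<phi> where "\<phi> i n = (tderiv (fst (xs ! i)) ^^ n) (ratpoly (snd (xs ! i)))" for i n
  obtain v where v: "\<And>n. n < k \<Longrightarrow> (\<Sum>i<k. v i * \<phi> i n) = b n - c * (tderiv l ^^ n) (ratpoly u)"
    using Cons.IH[of "\<lambda>n. b n - c * (tderiv l ^^ n) (ratpoly u)"] Cons.prems
    by (auto simp: x k_def \<phi>_def)
  define F where "F n = c * (tderiv l ^^ n) (ratpoly u) + (\<Sum>i<k. v i * \<phi> i n)" for n
  have F: "F n = b n" if "n < k" for n using v[OF that] by (simp add: F_def)
  have \<phi>0: "(\<Sum>j\<le>k. coeff L j * \<phi> i j) = 0" if "i < k" for i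
    using act_annop_eq_0[of "fst (xs ! i)" "snd (xs ! i)" xs] that
    by (simp add: act_def L_def k_def \<phi>_def)
  have "(\<Sum>j\<le>k. coeff L j * F j) = c * (\<Sum>j\<le>k. coeff L j * (tderiv l ^^ j) (ratpoly u))
     + (\<Sum>i<k. v i * (\<Sum>j\<le>k. coeff L j * \<phi> i j))"
    unfolding F_def sum_distrib_left distrib_left sum.distrib
    by (subst (2) sum.swap) (simp add: mult.left_commute)
  also have "\<dots> = c * r"
    using \<phi>0 by (simp add: r_def act_def L_def k_def)
  also have "\<dots> = (\<Sum>j\<le>k. coeff L j * b j)" using r0 by (simp add: c_def)
  finally have "(\<Sum>j<k. coeff L j * F j) + F k = (\<Sum>j<k. coeff L j * b j) + b k"
    by (simp add: lessThan_Suc_atMost[symmetric] L_def k_def)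
  moreover have "(\<Sum>j<k. coeff L j * F j) = (\<Sum>j<k. coeff L j * b j)" using F by simp
  ultimately have "F k = b k" by simp
  hence F': "F n = b n" if "n < Suc k" for n using F that less_Suc_eq by metis
  show ?case
  proof (rule exI[of _ "case_nat c v"], intro allI impI)
    fix n assume "n < length (x # xs)"
    hence "F n = b n" using F' by (simp add: k_def)
    thus "(\<Sum>i<length (x # xs). case_nat c v i * (tderiv (fst ((x # xs) ! i)) ^^ n)
        (ratpoly (snd ((x # xs) ! i)))) = b n"
      by (simp add: F_def k_def \<phi>_def x sum.lessThan_Suc_shift del: sum.lessThan_Suc)
  qed
qed simp

subsection \<open>Behaviour at infinity\<close>

text \<open>The limit at infinity, phrased through coefficients so that limits of operator
  coefficients become statements about leading coefficients.\<close>

definition lim_infinity :: "ratfun \<Rightarrow> complex \<Rightarrow> bool" where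
  "lim_infinity r c = (\<exists>p q. q \<noteq> 0 \<and> r = Fract p q \<and> degree p \<le> degree q \<and>
      coeff p (degree q) = c * lead_coeff q)"

lemma lim_infinity_Fract:
  assumes "lim_infinity (Fract p q) c" "q \<noteq> 0"
  shows "degree p \<le> degree q" "coeff p (degree q) = c * lead_coeff q"
proof -
  obtain p' q' where *: "q' \<noteq> 0" "Fract p q = Fract p' q'" "degree p' \<le> degree q'"
     "coeff p' (degree q') = c * lead_coeff q'"
    using assms(1) by (auto simp: lim_infinity_def)
  have e: "p * q' = p' * q" using * assms(2) by (simp add: eq_fract)
  show d: "degree p \<le> degree q"
  proof (cases "p = 0")
    case False
    hence "degree p + degree q' = degree (p' * q)" using e * by (metis degree_mult_eq)
    also have "\<dots> \<le> degree q' + degree q" using *(3) degree_mult_le[of p' q] by linarith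
    finally show ?thesis by simp
  qed simp
  have "coeff (p * q') (degree q + degree q') = coeff (p' * q) (degree q' + degree q)"
    by (simp add: e add.commute)
  hence "coeff p (degree q) * lead_coeff q' = c * lead_coeff q' * lead_coeff q"
    by (simp add: coeff_mult_degree_le d *)
  thus "coeff p (degree q) = c * lead_coeff q" using *(1) by simp
qed

lemma lim_infinity_unique: "lim_infinity r c \<Longrightarrow> lim_infinity r d \<Longrightarrow> c = d"
proof (cases r)
  fix p q assume *: "lim_infinity r c" "lim_infinity r d" "r = Fract p q" "q \<noteq> 0"
  hence "c * lead_coeff q = d * lead_coeff q" using lim_infinity_Fract by metis
  thus "c = d" using * by simp
qed

lemma lim_infinity_const [simp]: "lim_infinity (rconst c) c"
  unfolding lim_infinity_def ratpoly_def by (rule exI[of _ "[:c:]"], rule exI[of _ 1]) simp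

lemma lim_infinity_0 [simp]: "lim_infinity 0 0" and lim_infinity_1 [simp]: "lim_infinity 1 1"
  using lim_infinity_const[of 0] lim_infinity_const[of 1] by (simp_all del: lim_infinity_const)

lemma lim_infinity_add: 
  assumes "lim_infinity r c" "lim_infinity s d" shows "lim_infinity (r + s) (c + d)"
proof (cases r, cases s)
  fix p q p' q' assume *: "r = Fract p q" "q \<noteq> 0" "s = Fract p' q'" "q' \<noteq> 0"
  have a: "degree p \<le> degree q" "coeff p (degree q) = c * lead_coeff q"
      "degree p' \<le> degree q'" "coeff p' (degree q') = d * lead_coeff q'"
    using lim_infinity_Fract assms * by metis+
  have "degree (p * q' + p' * q) \<le> degree (q * q')"
    using a * degree_mult_le[of p q'] degree_mult_le[of p' q]
    by (intro degree_add_le) (auto simp: degree_mult_eq)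
  moreover have "coeff (p * q') (degree q + degree q') = c * lead_coeff q * lead_coeff q'"
    using coeff_mult_degree_le[OF a(1), of q' "degree q'"] a by simp
  moreover have "coeff (q * p') (degree q + degree q') = lead_coeff q * (d * lead_coeff q')"
    using coeff_mult_degree_le[OF _ a(3), of q "degree q"] a by simp
  ultimately have "degree (p * q' + p' * q) \<le> degree (q * q')"
    "coeff (p * q' + p' * q) (degree (q * q')) = (c + d) * lead_coeff (q * q')"
    using * by (simp_all add: degree_mult_eq coeff_mult_degree_sum mult.commute[of p' q] distrib_right)
  thus ?thesis using * unfolding lim_infinity_def
    by (intro exI[of _ "p * q' + p' * q"] exI[of _ "q * q'"]) simp
qed

lemma lim_infinity_mult: 
  assumes "lim_infinity r c" "lim_infinity s d" shows "lim_infinity (r * s) (c * d)"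
proof (cases r, cases s)
  fix p q p' q' assume *: "r = Fract p q" "q \<noteq> 0" "s = Fract p' q'" "q' \<noteq> 0"
  have a: "degree p \<le> degree q" "coeff p (degree q) = c * lead_coeff q"
      "degree p' \<le> degree q'" "coeff p' (degree q') = d * lead_coeff q'"
    using lim_infinity_Fract assms * by metis+
  have "degree (p * p') \<le> degree (q * q')"
    using a * degree_mult_le[of p p'] by (auto simp: degree_mult_eq)
  moreover have "coeff (p * p') (degree (q * q')) = (c * d) * lead_coeff (q * q')"
    using coeff_mult_degree_le[OF a(1) a(3)] * a
    by (simp add: degree_mult_eq coeff_mult_degree_sum)
  ultimately show ?thesis using * unfolding lim_infinity_def
    by (intro exI[of _ "p * p'"] exI[of _ "q * q'"]) simp
qed

lemma lim_infinity_diff: 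
  assumes "lim_infinity r c" "lim_infinity s d" shows "lim_infinity (r - s) (c - d)"
proof -
  have "lim_infinity (r + rconst (-1) * s) (c + (-1) * d)"
    by (intro lim_infinity_add lim_infinity_mult assms lim_infinity_const)
  moreover have "rconst (-1) = -1" by (metis minus_pCons one_pCons ratpoly_1 ratpoly_minus minus_zero)
  ultimately show ?thesis by simp
qed

lemma lim_infinity_sum:
  assumes "\<And>i. i \<in> A \<Longrightarrow> lim_infinity (r i) (c i)"
  shows "lim_infinity (\<Sum>i\<in>A. r i) (\<Sum>i\<in>A. c i)"
  using assms by (induction A rule: infinite_finite_induct) (simp_all add: lim_infinity_add)

lemma lim_infinity_coeff_mult:
  assumes "\<And>i. lim_infinity (coeff P i) (coeff p i)" "\<And>i. lim_infinity (coeff Q i) (coeff q i)"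
  shows "lim_infinity (coeff (P * Q) i) (coeff (p * q) i)"
  unfolding coeff_mult by (intro lim_infinity_sum lim_infinity_mult assms)

lemma degree_mult_deriv_lt:
  fixes p q :: "complex poly"
  assumes "degree p \<le> degree q" "degree q > 0"
  shows "degree (pderiv p * q) < degree (q * q)" "degree (p * pderiv q) < degree (q * q)"
proof -
  have q: "q \<noteq> 0" using assms by auto
  have "degree (pderiv p * q) \<le> degree p - 1 + degree q"
    using degree_mult_le[of "pderiv p" q] by (simp add: degree_pderiv)
  thus "degree (pderiv p * q) < degree (q * q)" using assms q by (simp add: degree_mult_eq)
  have "degree (p * pderiv q) \<le> degree p + (degree q - 1)"
    using degree_mult_le[of p "pderiv q"] by (simp add: degree_pderiv)
  thus "degree (p * pderiv q) < degree (q * q)" using assms q by (simp add: degree_mult_eq)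
qed

lemma lim_infinity_deriv: 
  assumes "lim_infinity r c" shows "lim_infinity (ratfun_deriv r) 0"
proof (cases r)
  fix p q assume *: "r = Fract p q" "q \<noteq> 0"
  have a: "degree p \<le> degree q" using lim_infinity_Fract assms * by metis
  show ?thesis
  proof (cases "degree q = 0")
    case True
    hence "pderiv p = 0" "pderiv q = 0" using a by (simp_all add: pderiv_eq_0_iff)
    hence "ratfun_deriv r = 0" using * by (simp add: ratfun_deriv_Fract fract_collapse)
    thus ?thesis by simp
  next
    case False
    have lt: "degree (pderiv p * q - p * pderiv q) < degree (q * q)"
      using degree_mult_deriv_lt[OF a] False by (intro degree_diff_less) auto
    hence z: "coeff (pderiv p * q - p * pderiv q) (degree (q * q)) = 0" by (rule coeff_eq_0)
    show ?thesis unfolding lim_infinity_def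
      by (rule exI[of _ "pderiv p * q - p * pderiv q"], rule exI[of _ "q * q"])
        (use lt z * in \<open>auto simp: ratfun_deriv_Fract simp del: coeff_diff\<close>)
  qed
qed

lemma lim_infinity_dlog: "lim_infinity (dlog r) 0"
proof (cases r)
  fix p q assume *: "r = Fract p q" "q \<noteq> 0"
  have a: "lim_infinity (ratpoly (pderiv p) / ratpoly p) 0" for p
  proof (cases "degree p = 0")
    case True
    hence "pderiv p = 0" by (simp add: pderiv_eq_0_iff)
    thus ?thesis by simp
  next
    case False
    thus ?thesis unfolding lim_infinity_def
      by (intro exI[of _ "pderiv p"] exI[of _ p])
        (auto simp: Fract_eq_divide degree_pderiv coeff_pderiv coeff_eq_0)
  qed
  show ?thesis
  proof (cases "p = 0")
    case True
    thus ?thesis using * by (simp add: dlog_def fract_collapse)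
  next
    case False
    have "dlog r = ratpoly (pderiv p) / ratpoly p - ratpoly (pderiv q) / ratpoly q"
      using * False
      by (simp add: dlog_def ratfun_deriv_Fract ratpoly_def eq_fract)
    thus ?thesis using lim_infinity_diff[OF a a] by simp
  qed
qed

text \<open>At infinity each factor d - l - dlog r of \<open>annop\<close> tends to d - l, and the
  derivatives of the coefficients tend to 0, so the limits multiply like commuting
  polynomials.\<close>

lemma lim_infinity_coeff_annop: "lim_infinity (coeff (annop xs) i) (coeff (conds_poly xs) i)"
proof (induction xs arbitrary: i)
  case Nil
  show ?case by (simp add: coeff_1)
next
  case (Cons x xs)
  obtain l u where x: "x = (l, u)" by force
  define s where "s = rconst l + dlog (act l (annop xs) (ratpoly u))"
  have s: "lim_infinity s l" 
    using lim_infinity_add[OF lim_infinity_const lim_infinity_dlog] by (simp add: s_def)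
  have "lim_infinity (coeff (dop_mult [:- s, 1:] (annop xs)) i)
    ((case i of 0 \<Rightarrow> 0 | Suc k \<Rightarrow> coeff (conds_poly xs) k) + 0 - l * coeff (conds_poly xs) i)"
    unfolding coeff_dop_mult_first_order
    by (intro lim_infinity_diff lim_infinity_add lim_infinity_mult s Cons.IH
        lim_infinity_deriv[OF Cons.IH]) (simp split: nat.splits add: Cons.IH)
  thus ?case by (simp add: x s_def coeff_pCons split: nat.splits)
qed

subsection \<open>Clearing denominators\<close>

lemma ratfun_common_denominator:
  fixes f :: "nat \<Rightarrow> ratfun"
  shows "\<exists>q g. q \<noteq> 0 \<and> (\<forall>i<n. ratpoly q * f i = ratpoly (g i))"
proof (induction n)
  case (Suc n)
  then obtain q g where q: "q \<noteq> 0" "\<And>i. i < n \<Longrightarrow> ratpoly q * f i = ratpoly (g i)" by blast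
  obtain a b where ab: "b \<noteq> 0" "f n = ratpoly a / ratpoly b" by (rule ratfun_cases)
  have "ratpoly (q * b) * f i = ratpoly (if i = n then q * a else b * g i)" if "i < Suc n" for i
  proof (cases "i = n")
    case True
    thus ?thesis using ab by (simp add: ratpoly_mult)
  next
    case False
    thus ?thesis using q(2)[of i] that by (simp add: ratpoly_mult flip: q(2))
  qed
  moreover have "q * b \<noteq> 0" using q ab by simp
  ultimately show ?case
    by (intro exI[of _ "q * b"] exI[of _ "\<lambda>i. if i = n then q * a else b * g i"]) blast
qed (auto intro: exI[of _ 1])

lemma diffop_common_denominator: "\<exists>q P. q \<noteq> 0 \<and> dop_of P = smult (ratpoly q) D"
proof -
  obtain q g where q: "q \<noteq> 0" "\<And>i. i < Suc (degree D) \<Longrightarrow> ratpoly q * coeff D i = ratpoly (g i)"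
    using ratfun_common_denominator[where n = "Suc (degree D)" and f = "coeff D"] by auto
  have "\<exists>p. coeff (smult (ratpoly q) D) i = ratpoly p" for i
    using q(2)[of i] by (cases "i \<le> degree D") (auto simp: coeff_eq_0 intro: exI[of _ 0])
  hence "smult (ratpoly q) D \<in> range dop_of" by (simp add: weyl_eq[symmetric] weyl_def)
  thus ?thesis using q(1) by auto
qed

text \<open>The last clause expresses that \<open>q\<close> is a least denominator. At a root of
  \<open>q\<close> it yields a non-zero polynomial \<open>eval_op P x\<close>, which obstructs
  uniqueness of the Baker function there.\<close>

definition cleared :: "diffop \<Rightarrow> complex poly \<Rightarrow> complex poly poly \<Rightarrow> bool" where
  "cleared D q P \<longleftrightarrow> lead_coeff q = 1 \<and> dop_of P = smult (ratpoly q) D \<and>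
     (\<forall>x. poly q x = 0 \<longrightarrow> (\<exists>i. poly (coeff P i) x \<noteq> 0))"

lemma cleared_exists: "\<exists>q P. cleared D q P"
proof -
  define S where "S q \<longleftrightarrow> q \<noteq> 0 \<and> (\<exists>P. dop_of P = smult (ratpoly q) D)" for q
  obtain q0 where "S q0" using diffop_common_denominator[of D] by (auto simp: S_def)
  from ex_has_least_nat[of S, OF this, of degree]
  obtain q where q: "S q" "\<And>q'. S q' \<Longrightarrow> degree q \<le> degree q'" by blast
  obtain P where P: "dop_of P = smult (ratpoly q) D" using q(1) by (auto simp: S_def)
  define c where "c = inverse (lead_coeff q)"
  have c: "c \<noteq> 0" using q(1) by (simp add: c_def S_def)
  have "\<exists>i. poly (coeff P i) x \<noteq> 0" if x: "poly q x = 0" for x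
  proof (rule ccontr)
    assume "\<not> ?thesis"
    hence dvd: "[:-x, 1:] dvd coeff P i" for i by (simp add: poly_eq_0_iff_dvd)
    obtain q' where q': "q = [:-x, 1:] * q'" using x by (auto simp: poly_eq_0_iff_dvd)
    define P' where "P' = map_poly (\<lambda>a. a div [:-x, 1:]) P"
    have P': "P = smult [:-x, 1:] P'"
      by (rule poly_eqI) (use dvd in \<open>simp add: P'_def coeff_map_poly del: mult_pCons_left\<close>)
    have "smult (ratpoly [:-x, 1:]) (dop_of P') = smult (ratpoly [:-x, 1:]) (smult (ratpoly q') D)"
      using P by (subst (asm) P', subst (asm) q') (simp only: dop_of_smult ratpoly_mult smult_smult)
    hence "dop_of P' = smult (ratpoly q') D"
      by (metis pCons_eq_0_iff one_neq_zero ratpoly_eq_0_iff smult_cancel)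
    moreover have "q' \<noteq> 0" using q(1) q' by (auto simp: S_def)
    ultimately have "S q'" by (auto simp: S_def)
    hence "degree q \<le> degree q'" by (rule q(2))
    moreover have "degree q = Suc (degree q')" using \<open>q' \<noteq> 0\<close> q' by (simp add: degree_mult_eq del: mult_pCons_left)
    ultimately show False by simp
  qed
  hence "cleared D (smult c q) (smult [:c:] P)"
    using q(1) c P by (auto simp: cleared_def c_def S_def dop_of_smult ratpoly_smult)
  thus ?thesis by blast
qed

definition annop_den :: "conds \<Rightarrow> complex poly" where
  "annop_den xs = fst (SOME qP. cleared (annop xs) (fst qP) (snd qP))"

definition annop_num :: "conds \<Rightarrow> complex poly poly" where
  "annop_num xs = snd (SOME qP. cleared (annop xs) (fst qP) (snd qP))"

lemma cleared_annop: "cleared (annop xs) (annop_den xs) (annop_num xs)"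
  unfolding annop_den_def annop_num_def
  by (rule someI_ex[of "\<lambda>qP. cleared (annop xs) (fst qP) (snd qP)"]) (use cleared_exists in auto)

lemma dop_of_annop_num: "dop_of (annop_num xs) = smult (ratpoly (annop_den xs)) (annop xs)"
  and lead_coeff_annop_den [simp]: "lead_coeff (annop_den xs) = 1"
  and annop_num_primitive: "poly (annop_den xs) x = 0 \<Longrightarrow> \<exists>i. poly (coeff (annop_num xs) i) x \<noteq> 0"
  using cleared_annop[of xs] by (auto simp: cleared_def)

lemma annop_den_nonzero [simp]: "annop_den xs \<noteq> 0"
  using lead_coeff_annop_den[of xs] by (metis leading_coeff_0_iff zero_neq_one)

lemma degree_annop_num [simp]: "degree (annop_num xs) = length xs"
  using arg_cong[OF dop_of_annop_num[of xs], of degree] by simp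

lemma ratpoly_coeff_annop_num:
  "ratpoly (coeff (annop_num xs) i) = ratpoly (annop_den xs) * coeff (annop xs) i"
  using arg_cong[OF dop_of_annop_num[of xs], of "\<lambda>D. coeff D i"] by simp

lemma coeff_annop_num_length [simp]: "coeff (annop_num xs) (length xs) = annop_den xs"
  using ratpoly_coeff_annop_num[of xs "length xs"] by simp

lemma annop_num_nonzero [simp]: "annop_num xs \<noteq> 0"
  using coeff_annop_num_length[of xs] by (metis annop_den_nonzero coeff_0)

lemma act_annop_num: "act l (dop_of (annop_num xs)) w = ratpoly (annop_den xs) * act l (annop xs) w"
  by (simp add: dop_of_annop_num act_smult)

lemma pact_annop_num_eq_0_iff:
  "pact l (annop_num xs) u = 0 \<longleftrightarrow> act l (annop xs) (ratpoly u) = 0"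
proof -
  have "pact l (annop_num xs) u = 0 \<longleftrightarrow> ratpoly (pact l (annop_num xs) u) = 0" by simp
  also have "\<dots> \<longleftrightarrow> act l (annop xs) (ratpoly u) = 0"
    unfolding act_dop_of[symmetric] act_annop_num by simp
  finally show ?thesis .
qed

lemma pact_annop_num_eq_0: "(l, u) \<in> set xs \<Longrightarrow> pact l (annop_num xs) u = 0"
  by (simp add: pact_annop_num_eq_0_iff act_annop_eq_0)

text \<open>Since L tends to m(d) at infinity and q is monic, q L read as a polynomial in the space
  variable has degree deg q and leading coefficient m(d). Under b, m becomes the leading coefficient
  of b(q L).\<close>

lemma coeff_annop_num_infinity:
  "degree (coeff (annop_num xs) i) \<le> degree (annop_den xs)"
  "coeff (coeff (annop_num xs) i) (degree (annop_den xs)) = coeff (conds_poly xs) i"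
proof -
  have "coeff (annop xs) i = Fract (coeff (annop_num xs) i) (annop_den xs)"
    by (simp add: Fract_eq_divide ratpoly_coeff_annop_num)
  hence *: "lim_infinity (Fract (coeff (annop_num xs) i) (annop_den xs)) (coeff (conds_poly xs) i)"
    using lim_infinity_coeff_annop by metis
  show "degree (coeff (annop_num xs) i) \<le> degree (annop_den xs)"
    "coeff (coeff (annop_num xs) i) (degree (annop_den xs)) = coeff (conds_poly xs) i"
    using lim_infinity_Fract[OF *] by simp_all
qed

text \<open>Substituting a number for the space variable of an operator and reading the
  derivation symbol as the spectral variable.\<close>

definition eval_op :: "complex poly poly \<Rightarrow> complex \<Rightarrow> complex poly" where
  "eval_op P x = map_poly (\<lambda>c. poly c x) P"

lemma coeff_eval_op [simp]: "coeff (eval_op P x) i = poly (coeff P i) x"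
  by (simp add: eval_op_def coeff_map_poly)

lemma degree_eval_op_le: "degree (eval_op P x) \<le> degree P"
  by (rule degree_le) (simp add: coeff_eq_0)

text \<open>\<open>eval_op P x\<close> is e^(-xz) P e^(xz) with \<open>P\<close> acting in x. The
  functional acts in z and commutes with \<open>P\<close>, so it may be applied to e^(xz)
  beforehand, which gives e^(lx) u(x).\<close>

lemma pairing_eval_op: "pairing l u x (eval_op P x) = poly (pact l P u) x"
proof -
  have "pairing l u x (eval_op P x) = pairing x (eval_op P x) l u"
    by (rule pairing_symmetric)
  also have "\<dots> = (\<Sum>j\<le>degree P. poly (coeff P j) x * poly ((dpoly l ^^ j) u) x)"
    by (simp add: pairing_altdef[OF degree_eval_op_le])
  also have "\<dots> = poly (pact l P u) x"
    by (simp add: pact_def poly_sum)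
  finally show ?thesis .
qed

lemma pairing_eval_annop_num:
  "(l, u) \<in> set xs \<Longrightarrow> pairing l u x (eval_op (annop_num xs) x) = 0"
  by (simp add: pairing_eval_op pact_annop_num_eq_0)

text \<open>For a polynomial of degree below the number of conditions, the conditions form a square
  system with the Wronskian matrix, degenerate at finitely many x only. This gives uniqueness of the
  Baker function for almost all x.\<close>

lemma conditions_imp_zero:
  assumes "indep_conds xs"
  shows "finite {x. \<exists>p. p \<noteq> 0 \<and> degree p < length xs \<and> (\<forall>(l, u) \<in> set xs. pairing l u x p = 0)}"
proof -
  define k where "k = length xs"
  define \<phi> where "\<phi> i n = (dpoly (fst (xs ! i)) ^^ n) (snd (xs ! i))" for i n
  \<comment> \<open>A combination of the conditions with polynomial coefficients \<open>g\<close>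
    that isolates the unknown of index \<open>m\<close> up to the factor \<open>q\<close>. It is
    later applied with \<open>m\<close> the degree of the unknown polynomial.\<close>
  have "\<exists>q g. q \<noteq> 0 \<and> (\<forall>n<k. (\<Sum>i<k. g i * \<phi> i n) = (if n = m then q else 0))" for m
  proof -
    obtain v where v: "\<And>n. n < k \<Longrightarrow> (\<Sum>i<k. v i * ratpoly (\<phi> i n)) = (if n = m then 1 else 0)"
      using annop_system_solvable[OF assms, of "\<lambda>n. if n = m then 1 else 0"]
      by (auto simp: k_def \<phi>_def)
    obtain q g where q: "q \<noteq> 0" "\<And>i. i < k \<Longrightarrow> ratpoly q * v i = ratpoly (g i)"
      using ratfun_common_denominator[of k v] by blast
    have "(\<Sum>i<k. g i * \<phi> i n) = (if n = m then q else 0)" if "n < k" for n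
    proof -
      have "ratpoly (\<Sum>i<k. g i * \<phi> i n) = ratpoly q * (\<Sum>i<k. v i * ratpoly (\<phi> i n))"
        by (simp add: ratpoly_sum ratpoly_mult sum_distrib_left mult.assoc flip: q(2))
      also have "\<dots> = ratpoly (if n = m then q else 0)" using v[OF that] by simp
      finally show ?thesis by simp
    qed
    thus ?thesis using q(1) by blast
  qed
  then obtain q g where q: "\<And>m. q m \<noteq> 0"
    "\<And>m n. n < k \<Longrightarrow> (\<Sum>i<k. g m i * \<phi> i n) = (if n = m then q m else 0)" by metis
  have "{x. \<exists>p. p \<noteq> 0 \<and> degree p < k \<and> (\<forall>(l, u) \<in> set xs. pairing l u x p = 0)}
      \<subseteq> (\<Union>m<k. {x. poly (q m) x = 0})"
  proof safe
    fix x p assume p: "p \<noteq> 0" "degree p < k" "\<forall>(l, u) \<in> set xs. pairing l u x p = 0"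
    have z: "(\<Sum>n<k. coeff p n * poly (\<phi> i n) x) = 0" if "i < k" for i
    proof -
      have "pairing (fst (xs ! i)) (snd (xs ! i)) x p = 0"
        using p(3) that by (auto simp: k_def dest!: nth_mem)
      hence "pairing x p (fst (xs ! i)) (snd (xs ! i)) = 0" by (simp add: pairing_symmetric)
      moreover have "degree p \<le> k - 1" "{..k - 1} = {..<k}" using p(2) by auto
      ultimately show ?thesis by (simp add: pairing_altdef[of p "k - 1"] \<phi>_def)
    qed
    define m where "m = degree p"
    have "0 = (\<Sum>i<k. poly (g m i) x * (\<Sum>n<k. coeff p n * poly (\<phi> i n) x))"
      using z by simp
    also have "\<dots> = (\<Sum>n<k. coeff p n * poly (\<Sum>i<k. g m i * \<phi> i n) x)"
      unfolding sum_distrib_left poly_sum by (subst sum.swap) (simp add: mult.left_commute)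
    also have "\<dots> = (\<Sum>n<k. if n = m then coeff p m * poly (q m) x else 0)"
      by (rule sum.cong) (auto simp: q(2))
    also have "\<dots> = coeff p m * poly (q m) x" using p(2) by (simp add: m_def)
    finally have "poly (q m) x = 0" using p(1) by (simp add: m_def)
    thus "x \<in> (\<Union>m<k. {x. poly (q m) x = 0})" using p(2) by (auto simp: m_def)
  qed
  moreover have "finite (\<Union>m<k. {x. poly (q m) x = 0})"
    using q(1) by (auto intro: poly_roots_finite)
  ultimately show ?thesis unfolding k_def[symmetric] by (rule finite_subset)
qed

section \<open>Antiderivatives of quasi-polynomials and trivial monodromy\<close>

lemma dpoly_surj:
  assumes "c \<noteq> 0"
  shows "\<exists>y. dpoly c y = r"
proof (induction "degree r" arbitrary: r rule: less_induct)
  case less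
  have "\<exists>y. dpoly c y = pderiv r"
  proof (cases "degree r = 0")
    case True
    hence "pderiv r = 0" by (simp add: pderiv_eq_0_iff)
    thus ?thesis by (intro exI[of _ 0]) simp
  next
    case False
    thus ?thesis by (intro less.hyps) (simp add: degree_pderiv)
  qed
  then obtain y where y: "dpoly c y = pderiv r" by blast
  have "dpoly c (r - y) + dpoly c y = dpoly c r" by (simp flip: dpoly_add)
  hence "dpoly c (r - y) = smult c r" unfolding y by (simp add: dpoly_def[of c r])
  hence "dpoly c (smult (1 / c) (r - y)) = r" using assms by (simp add: dpoly_smult)
  thus ?case by blast
qed

text \<open>Leibniz's rule arranged so that, apart from the leading term, \<open>y\<close> occurs
  only through its derivative. For \<open>y\<close> an antiderivative of a given function all
  further terms are then explicit.\<close>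

lemma tderiv_funpow_mult_telescope:
  "(tderiv x ^^ n) (a * y) = (tderiv l ^^ n) a * y +
     (\<Sum>j<n. (tderiv x ^^ (n - 1 - j)) ((tderiv l ^^ j) a * tderiv (x - l) y))"
proof (induction n)
  case (Suc n)
  have s: "tderiv x (sum f A) = (\<Sum>j\<in>A. tderiv x (f j))" for f and A :: "nat set"
    using tderiv_funpow_sum[of 1 x f A] by simp
  have m: "tderiv x ((tderiv l ^^ n) a * y) = (tderiv l ^^ Suc n) a * y + (tderiv l ^^ n) a * tderiv (x - l) y"
    using tderiv_mult[of l "x - l"] by simp
  have t: "tderiv x ((tderiv x ^^ (n - 1 - j)) w) = (tderiv x ^^ (n - j)) w" if "j < n" for j w
  proof -
    have "n - j = Suc (n - 1 - j)" using that by simp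
    thus ?thesis by (simp only: funpow.simps o_apply)
  qed
  have "(tderiv x ^^ Suc n) (a * y) = (tderiv l ^^ Suc n) a * y + ((tderiv l ^^ n) a * tderiv (x - l) y +
     (\<Sum>j<n. tderiv x ((tderiv x ^^ (n - 1 - j)) ((tderiv l ^^ j) a * tderiv (x - l) y))))"
    by (simp only: funpow.simps o_apply Suc.IH tderiv_add s m add.assoc)
  also have "(\<Sum>j<n. tderiv x ((tderiv x ^^ (n - 1 - j)) ((tderiv l ^^ j) a * tderiv (x - l) y)))
    = (\<Sum>j<n. (tderiv x ^^ (n - j)) ((tderiv l ^^ j) a * tderiv (x - l) y))"
    by (rule sum.cong [OF refl], rule t) simp
  finally show ?case by (simp add: add.commute)
qed simp

text \<open>Trivial monodromy: \<open>L\<close> has the right inverse \<open>\<Sum>\<^sub>i \<phi>\<^sub>i \<partial>\<^sup>-\<^sup>1 \<chi>\<^sub>i\<close>, where the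
  \<open>\<chi>\<^sub>i\<close> solve \<open>\<Sum>\<^sub>i \<chi>\<^sub>i \<phi>\<^sub>i\<^sup>(\<^sup>n\<^sup>) = \<delta>\<^sub>n\<^sub>,\<^sub>k\<^sub>-\<^sub>1\<close>, so no logarithms occur.\<close>

lemma annop_image_contains_ideal:
  assumes "indep_conds xs"
  shows "\<exists>f. f \<noteq> 0 \<and> (\<forall>x g. x \<notin> fst ` set xs \<longrightarrow>
     (\<exists>y. act x (annop xs) (ratpoly y) = ratpoly (f * g)))"
proof -
  define k where "k = length xs"
  define L where "L = annop xs"
  define l where "l i = fst (xs ! i)" for i
  define u where "u i = snd (xs ! i)" for i
  define \<phi> where "\<phi> i n = (tderiv (l i) ^^ n) (ratpoly (u i))" for i n
  obtain v where v: "\<And>n. n < k \<Longrightarrow> (\<Sum>i<k. v i * \<phi> i n) = (if n = k - 1 then 1 else 0)"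
    using annop_system_solvable[OF assms, of "\<lambda>n. if n = k - 1 then 1 else 0"]
    by (auto simp: k_def \<phi>_def l_def u_def)
  \<comment> \<open>\<open>f\<close> clears the denominators of the solution \<open>v\<close>, so
    the functions to be integrated below are quasi-polynomials.\<close>
  obtain f h where f: "f \<noteq> 0" "\<And>i. i < k \<Longrightarrow> ratpoly f * v i = ratpoly (h i)"
    using ratfun_common_denominator[of k v] by blast
  have "\<exists>y. act x L (ratpoly y) = ratpoly (f * g)" if x: "x \<notin> fst ` set xs" for x g
  proof (cases "k = 0")
    case True
    hence "L = 1" by (simp add: L_def k_def)
    thus ?thesis by auto
  next
    case k: False
    have "x - l i \<noteq> 0" if "i < k" for i using x that by (auto simp: l_def k_def)
    hence "\<forall>i\<in>{..<k}. \<exists>y. dpoly (x - l i) y = h i * g" using dpoly_surj by blast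
    then obtain y where y: "\<And>i. i < k \<Longrightarrow> dpoly (x - l i) (y i) = h i * g" by (metis lessThan_iff)
    define F where "F = ratpoly (f * g)"
    have ty: "tderiv (x - l i) (ratpoly (y i)) = v i * F" if "i < k" for i
      using y[OF that] f(2)[OF that] by (simp add: F_def ratpoly_mult algebra_simps)
    have z: "(\<Sum>n\<le>k. coeff L n * \<phi> i n) = 0" if "i < k" for i
      using act_annop_eq_0[of "l i" "u i" xs] that
      by (simp add: act_def L_def k_def \<phi>_def l_def u_def)
    have tz: "(tderiv x ^^ m) (\<Sum>i<k. v i * \<phi> i j * F) = (if j = k - 1 then (tderiv x ^^ m) F else 0)"
      if "j < k" for j m
      using v[OF that] by (simp add: sum_distrib_right[symmetric])
    \<comment> \<open>For n < k the extra terms cancel by the choice of \<open>v\<close>; the k-th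
      derivative picks up exactly one copy of \<open>F\<close>, which the monic \<open>L\<close>
      passes on unchanged.\<close>
    have "(tderiv x ^^ n) (\<Sum>i<k. ratpoly (u i) * ratpoly (y i)) = (\<Sum>i<k. \<phi> i n * ratpoly (y i)) +
       (if n = k then F else 0)" if "n \<le> k" for n
    proof -
      have "(tderiv x ^^ n) (\<Sum>i<k. ratpoly (u i) * ratpoly (y i)) = (\<Sum>i<k. \<phi> i n * ratpoly (y i)) +
        (\<Sum>i<k. \<Sum>j<n. (tderiv x ^^ (n - 1 - j)) (\<phi> i j * (v i * F)))"
        unfolding tderiv_funpow_sum sum.distrib[symmetric]
      proof (rule sum.cong [OF refl])
        fix i assume "i \<in> {..<k}"
        thus "(tderiv x ^^ n) (ratpoly (u i) * ratpoly (y i)) = \<phi> i n * ratpoly (y i) +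
          (\<Sum>j<n. (tderiv x ^^ (n - 1 - j)) (\<phi> i j * (v i * F)))"
          by (subst tderiv_funpow_mult_telescope[where x = x and n = n and l = "l i"], subst ty) (simp_all add: \<phi>_def)
      qed
      also have "(\<Sum>i<k. \<Sum>j<n. (tderiv x ^^ (n - 1 - j)) (\<phi> i j * (v i * F))) =
         (\<Sum>j<n. (tderiv x ^^ (n - 1 - j)) (\<Sum>i<k. v i * \<phi> i j * F))"
        by (subst sum.swap) (simp add: tderiv_funpow_sum algebra_simps)
      also have "\<dots> = (\<Sum>j<n. if j = k - 1 then (tderiv x ^^ (n - 1 - j)) F else 0)"
        by (rule sum.cong) (use that tz in auto)
      also have "\<dots> = (if n = k then F else 0)" using that k by (auto simp: sum.delta')
      finally show ?thesis .
    qed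
    hence "act x L (\<Sum>i<k. ratpoly (u i) * ratpoly (y i)) =
      (\<Sum>n\<le>k. coeff L n * ((\<Sum>i<k. \<phi> i n * ratpoly (y i)) + (if n = k then F else 0)))"
      unfolding act_def by (intro sum.cong) (simp_all add: L_def k_def)
    also have "\<dots> = (\<Sum>i<k. (\<Sum>n\<le>k. coeff L n * \<phi> i n) * ratpoly (y i)) + coeff L k * F"
      unfolding distrib_left sum.distrib sum_distrib_left sum_distrib_right
      by (subst sum.swap) (simp add: mult.assoc if_distrib[of "\<lambda>z. _ * z"] cong: if_cong)
    also have "\<dots> = F" using z by (simp add: L_def k_def)
    finally have "act x L (ratpoly (\<Sum>i<k. u i * y i)) = F"
      by (simp add: ratpoly_sum ratpoly_mult)
    thus ?thesis unfolding F_def by blast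
  qed
  thus ?thesis using f(1) unfolding L_def by blast
qed

subsection \<open>Primary decomposable subspaces\<close>

text \<open>\<open>G\<close> is invertible modulo z - l; a solution modulo a power of z - l is
  lifted one power at a time by a constant correction.\<close>

lemma inverse_mod_shift_power:
  assumes "poly G l \<noteq> (0::complex)"
  shows "\<exists>a. [:-l, 1:] ^ n dvd h - G * a"
proof (induction n)
  case (Suc n)
  then obtain a r where a: "h - G * a = [:-l, 1:] ^ n * r" by (auto elim: dvdE)
  define c where "c = poly r l / poly G l"
  have "poly (r - smult c G) l = 0" using assms by (simp add: c_def)
  then obtain r' where r': "r - smult c G = [:-l, 1:] * r'"
    unfolding poly_eq_0_iff_dvd by (elim dvdE)
  have "h - G * (a + smult c ([:-l, 1:] ^ n)) = (h - G * a) - smult c (G * [:-l, 1:] ^ n)"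
    by (simp add: algebra_simps)
  also have "\<dots> = [:-l, 1:] ^ n * (r - smult c G)"
    unfolding a by (simp add: algebra_simps)
  also have "\<dots> = [:-l, 1:] ^ Suc n * r'" unfolding r' by (simp only: power_Suc ac_simps)
  finally have "[:-l, 1:] ^ Suc n dvd h - G * (a + smult c ([:-l, 1:] ^ n))" by (metis dvd_triv_left)
  thus ?case by blast
qed simp

lemma shift_power_dvd_cancel:
  assumes "poly G l \<noteq> (0::complex)" "[:-l, 1:] ^ n dvd G * k"
  shows "[:-l, 1:] ^ n dvd k"
proof -
  obtain a where a: "[:-l, 1:] ^ n dvd 1 - G * a" using inverse_mod_shift_power[OF assms(1)] by blast
  have "k = k * (1 - G * a) + (G * k) * a" by (simp add: algebra_simps)
  thus ?thesis using a assms(2) by (metis dvd_add dvd_mult dvd_mult2)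
qed

lemma poly_prod_shift_power_nonzero:
  assumes "finite A" "l \<notin> A"
  shows "poly (\<Prod>m\<in>A. [:-m, 1:] ^ n m) l \<noteq> (0::complex)"
  using assms by (auto simp: poly_prod)

lemma chinese_remainder_shift_powers:
  assumes "finite A"
  shows "\<exists>F. \<forall>l\<in>A. [:-l, 1:] ^ n dvd F - (f l :: complex poly)"
  using assms
proof (induction A rule: finite_induct)
  case (insert l A)
  then obtain F where F: "\<And>m. m \<in> A \<Longrightarrow> [:-m, 1:] ^ n dvd F - f m" by blast
  define G :: "complex poly" where "G = (\<Prod>m\<in>A. [:-m, 1:] ^ n)"
  have "poly G l \<noteq> 0" using poly_prod_shift_power_nonzero[OF insert.hyps] by (simp add: G_def)
  then obtain a where a: "[:-l, 1:] ^ n dvd (f l - F) - G * a" using inverse_mod_shift_power by blast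
  have "[:-m, 1:] ^ n dvd (F + G * a) - f m" if "m \<in> insert l A" for m
  proof (cases "m = l")
    case True
    have "(F + G * a) - f l = - ((f l - F) - G * a)" by simp
    thus ?thesis using a True by (metis dvd_minus_iff)
  next
    case False
    hence "m \<in> A" using that by simp
    hence "[:-m, 1:] ^ n dvd G" unfolding G_def by (intro dvd_prodI insert.hyps)
    hence "[:-m, 1:] ^ n dvd (F - f m) + G * a" using F \<open>m \<in> A\<close> by (metis dvd_add dvd_mult2)
    thus ?thesis by (simp add: algebra_simps)
  qed
  thus ?case by blast
qed simp

lemma prod_shift_powers_dvd:
  assumes "finite A" "\<And>l. l \<in> A \<Longrightarrow> [:-l, 1:] ^ n l dvd (h :: complex poly)"
  shows "(\<Prod>l\<in>A. [:-l, 1:] ^ n l) dvd h"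
  using assms
proof (induction A rule: finite_induct)
  case (insert l A)
  then obtain k where k: "h = (\<Prod>m\<in>A. [:-m, 1:] ^ n m) * k" by (auto elim: dvdE)
  have "[:-l, 1:] ^ n l dvd k"
    using shift_power_dvd_cancel[OF poly_prod_shift_power_nonzero[OF insert.hyps]] insert.prems k by blast
  hence "(\<Prod>m\<in>A. [:-m, 1:] ^ n m) * [:-l, 1:] ^ n l dvd h" unfolding k by (rule mult_dvd_mono[OF dvd_refl])
  thus ?case using insert.hyps by (simp add: mult.commute)
qed simp

lemma poly_dvd_if_orders:
  assumes "M \<noteq> (0 :: complex poly)" "\<And>l. poly M l = 0 \<Longrightarrow> [:-l, 1:] ^ order l M dvd h"
  shows "M dvd h"
proof -
  have fin: "finite {l. poly M l = 0}" using assms(1) by (rule poly_roots_finite)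
  have "(\<Prod>l | poly M l = 0. [:-l, 1:] ^ order l M) dvd h"
    using assms(2) by (intro prod_shift_powers_dvd fin) auto
  hence "smult (lead_coeff M) (\<Prod>l | poly M l = 0. [:-l, 1:] ^ order l M) dvd h"
    using assms(1) by (simp add: smult_dvd_iff)
  thus ?thesis by (simp only: complex_poly_decompose)
qed

lemma shift_power_dvd_dpoly:
  assumes "[:-l, 1:] ^ (m + i) dvd f"
  shows "[:-l, 1:] ^ m dvd (dpoly t ^^ i) f"
  using assms
proof (induction i arbitrary: f)
  case (Suc i)
  obtain g where g: "f = [:-l, 1:] ^ Suc (m + i) * g" using Suc.prems by auto
  have "[:-l, 1:] ^ (m + i) dvd pderiv f"
    unfolding g pderiv_mult pderiv_power_Suc
  proof (rule dvd_add)
    show "[:-l, 1:] ^ (m + i) dvd [:-l, 1:] ^ Suc (m + i) * pderiv g"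
      by (intro dvd_mult2 le_imp_power_dvd) simp
    show "[:-l, 1:] ^ (m + i) dvd
        g * (smult (of_nat (Suc (m + i))) ([:-l, 1:] ^ (m + i)) * pderiv [:-l, 1:])"
      by (rule dvd_mult, rule dvd_mult2, rule dvd_smult, rule dvd_refl)
  qed
  moreover have "[:-l, 1:] ^ (m + i) dvd f" unfolding g by (intro dvd_mult2 le_imp_power_dvd) simp
  ultimately have "[:-l, 1:] ^ (m + i) dvd dpoly t f" by (simp add: dpoly_def dvd_smult)
  from Suc.IH[OF this] show ?case by (simp add: funpow_swap1)
qed simp

lemma shift_power_dvd_pact:
  assumes "[:-l, 1:] ^ (m + degree P) dvd f"
  shows "[:-l, 1:] ^ m dvd pact t P f"
  unfolding pact_def
proof (intro dvd_sum dvd_mult)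
  fix i assume "i \<in> {..degree P}"
  hence "[:-l, 1:] ^ (m + i) dvd [:-l, 1:] ^ (m + degree P)" by (intro le_imp_power_dvd) simp
  thus "[:-l, 1:] ^ m dvd (dpoly t ^^ i) f"
    by (intro shift_power_dvd_dpoly) (rule dvd_trans[OF _ assms])
qed

text \<open>The components are U + (z - l)^(order l M) C[z] at the roots of \<open>M\<close>. An
  element of all of them agrees locally with values P g_l, and the g_l are glued by the Chinese
  remainder theorem.\<close>

lemma primary_decomposable_operator_image:
  assumes M: "M \<noteq> 0"
  shows "primary_decomposable {pact t P g + M * h | g h. True}"
proof -
  define U where "U = {pact t P g + M * h | g h. True}"
  define Lam where "Lam = {l. poly M l = 0}"
  have fin: "finite Lam" using M by (simp add: Lam_def poly_roots_finite)
  define Vs where "Vs l = {u + [:-l, 1:] ^ order l M * h | u h. u \<in> U}" for l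
  have UI: "pact t P g + M * h \<in> U" for g h by (auto simp: U_def)
  have U0: "0 \<in> U" using UI[of 0 0] by simp
  have Uadd: "a + b \<in> U" if ab: "a \<in> U" "b \<in> U" for a b
  proof -
    obtain g h where "a = pact t P g + M * h" using ab(1) by (auto simp: U_def)
    moreover obtain g' h' where "b = pact t P g' + M * h'" using ab(2) by (auto simp: U_def)
    ultimately have "a + b = pact t P (g + g') + M * (h + h')" by (simp add: pact_add_right algebra_simps)
    thus ?thesis using UI by simp
  qed
  have Usmult: "smult c a \<in> U" if a: "a \<in> U" for a c
  proof -
    obtain g h where "a = pact t P g + M * h" using a by (auto simp: U_def)
    hence "smult c a = pact t P (smult c g) + M * smult c h"
      by (simp add: pact_smult_right smult_add_right)
    thus ?thesis by (simp only: UI)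
  qed
  have sub: "poly_subspace U" using U0 Uadd Usmult by (auto simp: poly_subspace_def)
  have VI: "u + [:-l, 1:] ^ order l M * h \<in> Vs l" if "u \<in> U" for u h l
    using that by (auto simp: Vs_def)
  have "primary l (Vs l)" for l
    unfolding primary_def poly_subspace_def
  proof (intro conjI ballI allI)
    show "0 \<in> Vs l" using VI[OF U0, of _ 0] by simp
    show "\<exists>r. \<forall>p. [:-l, 1:] ^ r dvd p \<longrightarrow> p \<in> Vs l"
      using VI[OF U0] by (intro exI[of _ "order l M"]) (auto elim!: dvdE)
    fix f assume "f \<in> Vs l"
    then obtain u h where f: "u \<in> U" "f = u + [:-l, 1:] ^ order l M * h" by (auto simp: Vs_def)
    show "smult c f \<in> Vs l" for c
    proof -
      have "smult c f = smult c u + [:-l, 1:] ^ order l M * smult c h"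
        unfolding f(2) by (simp only: smult_add_right mult_smult_right)
      thus ?thesis using Usmult[OF f(1)] by (simp only: VI)
    qed
    fix f' assume "f' \<in> Vs l"
    then obtain u' h' where f': "u' \<in> U" "f' = u' + [:-l, 1:] ^ order l M * h'" by (auto simp: Vs_def)
    have "f + f' = (u + u') + [:-l, 1:] ^ order l M * (h + h')"
      unfolding f(2) f'(2) by (simp only: distrib_left add_ac)
    thus "f + f' \<in> Vs l" using Uadd[OF f(1) f'(1)] by (simp only: VI)
  qed
  moreover have "U = (\<Inter>l\<in>Lam. Vs l)"
  proof (intro equalityI subsetI)
    fix u assume "u \<in> U"
    thus "u \<in> (\<Inter>l\<in>Lam. Vs l)" using VI[of u _ 0] by simp
  next
    fix v assume v: "v \<in> (\<Inter>l\<in>Lam. Vs l)"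
    have "\<forall>l\<in>Lam. \<exists>g. [:-l, 1:] ^ order l M dvd v - pact t P g"
    proof
      fix l assume "l \<in> Lam"
      then obtain g h h' where "v = pact t P g + M * h + [:-l, 1:] ^ order l M * h'"
        using v by (auto simp: Vs_def U_def)
      hence "v - pact t P g = M * h + [:-l, 1:] ^ order l M * h'" by simp
      moreover have "[:-l, 1:] ^ order l M dvd M * h" using order_1[of l M] by (rule dvd_mult2)
      ultimately have "[:-l, 1:] ^ order l M dvd v - pact t P g" by simp
      thus "\<exists>g. [:-l, 1:] ^ order l M dvd v - pact t P g" by blast
    qed
    then obtain g where g: "\<And>l. l \<in> Lam \<Longrightarrow> [:-l, 1:] ^ order l M dvd v - pact t P (g l)" by metis
    \<comment> \<open>\<open>P\<close> lowers the order of vanishing by at most its own order, so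
      agreement to order N before applying \<open>P\<close> leaves agreement to order
      \<open>order l M\<close> afterwards.\<close>
    define N where "N = degree M + degree P"
    obtain F where F: "\<And>l. l \<in> Lam \<Longrightarrow> [:-l, 1:] ^ N dvd F - g l"
      using chinese_remainder_shift_powers[OF fin, of N g] by blast
    have "M dvd v - pact t P F"
    proof (rule poly_dvd_if_orders[OF M])
      fix l assume "poly M l = 0"
      hence l: "l \<in> Lam" by (simp add: Lam_def)
      have "[:-l, 1:] ^ (order l M + degree P) dvd [:-l, 1:] ^ N"
        using order_degree[OF M, of l] by (intro le_imp_power_dvd) (simp add: N_def)
      hence "[:-l, 1:] ^ order l M dvd pact t P (F - g l)"
        using F[OF l] by (intro shift_power_dvd_pact) (rule dvd_trans)
      moreover have "pact t P F = pact t P (F - g l) + pact t P (g l)"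
        by (simp flip: pact_add_right)
      hence "v - pact t P F = (v - pact t P (g l)) - pact t P (F - g l)" by simp
      ultimately show "[:-l, 1:] ^ order l M dvd v - pact t P F" using g[OF l] by (metis dvd_diff)
    qed
    then obtain h where "v - pact t P F = M * h" by (auto elim: dvdE)
    hence "v = pact t P F + M * h" by (simp add: algebra_simps)
    thus "v \<in> U" using UI by simp
  qed
  ultimately have "primary_decomp U Lam Vs" using fin by (simp add: primary_decomp_def)
  thus ?thesis using sub unfolding U_def[symmetric] by (auto simp: primary_decomposable_def)
qed

section \<open>Primary subspaces as common zeros of finitely many functionals\<close>

lemma pderiv_surj: "\<exists>q. pderiv q = p \<and> coeff q 0 = c" for p :: "complex poly"
proof -
  define q where "q = [:c:] + (\<Sum>i\<le>degree p. monom (coeff p i / of_nat (Suc i)) (Suc i))"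
  have c: "coeff q (Suc n) = coeff p n / of_nat (Suc n)" for n
    by (simp add: q_def coeff_sum coeff_eq_0)
  have "pderiv q = p" by (rule poly_eqI) (simp add: coeff_pderiv c del: of_nat_Suc)
  moreover have "coeff q 0 = c" by (simp add: q_def coeff_sum)
  ultimately show ?thesis by blast
qed

text \<open>Composing \<open>F\<close> with multiplication by z - l lowers \<open>r\<close> and
  corresponds to differentiating \<open>u\<close>. An antiderivative of the polynomial found, with
  constant term F 1, represents \<open>F\<close>.\<close>

lemma functional_is_pairing:
  assumes "\<And>f g. F (f + g) = F f + F g" "\<And>c f. F (smult c f) = c * F f"
    "\<And>f. [:-l, 1:] ^ r dvd f \<Longrightarrow> F f = (0::complex)"
  shows "\<exists>u. \<forall>f. F f = pairing l u 0 f"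
  using assms
proof (induction r arbitrary: F)
  case 0
  thus ?case by (intro exI[of _ 0]) simp
next
  case (Suc r)
  have a: "[:-l, 1:] * (f + g) = [:-l, 1:] * f + [:-l, 1:] * g"
    "[:-l, 1:] * smult c f = smult c ([:-l, 1:] * f)" for f g c
    by (simp_all only: distrib_left mult_smult_right)
  have "\<exists>u. \<forall>f. F ([:-l, 1:] * f) = pairing l u 0 f"
  proof (rule Suc.IH)
    show "F ([:-l, 1:] * f) = 0" if "[:-l, 1:] ^ r dvd f" for f
      by (rule Suc.prems(3)) (use that in \<open>simp only: power_Suc mult_dvd_mono dvd_refl\<close>)
  qed (simp_all only: a Suc.prems)
  then obtain u where u: "\<And>f. F ([:-l, 1:] * f) = pairing l u 0 f" by blast
  obtain w where w: "pderiv w = u" "coeff w 0 = F 1" using pderiv_surj by blast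
  have "F f = pairing l w 0 f" for f
  proof -
    have "[:-l, 1:] dvd f - [:poly f l:]" by (simp flip: poly_eq_0_iff_dvd)
    then obtain g where g: "f - [:poly f l:] = [:-l, 1:] * g" by (auto elim: dvdE)
    have f: "f = smult (poly f l) 1 + [:-l, 1:] * g" unfolding g[symmetric] by (simp add: one_pCons)
    have "F f = poly f l * F 1 + pairing l u 0 g" by (subst f) (simp only: Suc.prems u)
    also have "\<dots> = pairing l w 0 f"
      by (subst (2) f) (simp only: pairing_add_right pairing_smult_right pairing_one_right pairing_shift
          w poly_0_coeff_0)
    finally show ?thesis .
  qed
  thus ?case by blast
qed

lemma indep_conds_dual:
  assumes "\<And>i. i < length us \<Longrightarrow> \<exists>f. pairing l (us ! i) 0 f \<noteq> 0 \<and>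
     (\<forall>j. i < j \<and> j < length us \<longrightarrow> pairing l (us ! j) 0 f = 0)"
  shows "indep_conds (map (Pair l) us)"
  using assms
proof (induction us)
  case (Cons u us)
  have "indep_conds (map (Pair l) us)"
  proof (rule Cons.IH)
    fix i assume "i < length us"
    then obtain f where f: "pairing l ((u # us) ! Suc i) 0 f \<noteq> 0"
     "\<And>j. Suc i < j \<and> j < length (u # us) \<Longrightarrow> pairing l ((u # us) ! j) 0 f = 0"
      using Cons.prems[of "Suc i"] by auto
    from f(2)[of "Suc _"] have "\<forall>j. i < j \<and> j < length us \<longrightarrow> pairing l (us ! j) 0 f = 0" by simp
    thus "\<exists>f. pairing l (us ! i) 0 f \<noteq> 0 \<and> (\<forall>j. i < j \<and> j < length us \<longrightarrow> pairing l (us ! j) 0 f = 0)"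
      using f(1) by auto
  qed
  moreover obtain f where f: "pairing l u 0 f \<noteq> 0"
     "\<And>j. 0 < j \<and> j < length (u # us) \<Longrightarrow> pairing l ((u # us) ! j) 0 f = 0"
    using Cons.prems[of 0] by auto
  have "pairing l v 0 f = 0" if "v \<in> set us" for v
    using that f(2)[of "Suc _"] by (auto simp: in_set_conv_nth)
  ultimately show ?case using f(1) by auto
qed simp

lemma smult_sum_right: "smult c (sum f A) = (\<Sum>x\<in>A. smult c (f x))"
  by (induction A rule: infinite_finite_induct) (simp_all add: smult_add_right)

text \<open>The \<open>LEAST\<close> in \<open>poly_codim\<close> is attained: monomials of degree
  below \<open>r\<close> span modulo a power (z - l)^r C[z] inside \<open>V\<close>.\<close>

lemma poly_codim_spans:
  assumes "primary l V"
  shows "\<exists>P. length P = poly_codim V \<and> (\<forall>f. \<exists>g\<in>V. \<exists>c. f = g + (\<Sum>i<poly_codim V. smult (c i) (P ! i)))"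
proof -
  obtain r where r: "\<And>p. [:-l, 1:] ^ r dvd p \<Longrightarrow> p \<in> V" using assms by (auto simp: primary_def)
  have "\<exists>P. length P = r \<and> (\<forall>f. \<exists>g\<in>V. \<exists>c. f = g + (\<Sum>i<r. smult (c i) (P ! i)))"
  proof (intro exI conjI allI)
    show "length (map (monom 1) [0..<r]) = r" by simp
    fix f :: "complex poly"
    define s where "s = [:-l, 1:] ^ r"
    have ds: "degree s = r" by (simp add: s_def degree_power_eq)
    have s0: "s \<noteq> 0" by (simp add: s_def)
    have "degree (f mod s) < r \<or> f mod s = 0"
      using degree_mod_less[OF s0, of f] by (auto simp: ds)
    hence "coeff (f mod s) n = 0" if "n \<ge> r" for n using that by (auto simp: coeff_eq_0)
    hence "f mod s = (\<Sum>i<r. smult (coeff (f mod s) i) (monom 1 i))"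
      by (intro poly_eqI) (auto simp: coeff_sum smult_monom)
    hence "f = f div s * s + (\<Sum>i<r. smult (coeff (f mod s) i) (map (monom 1) [0..<r] ! i))"
      by (simp add: div_mult_mod_eq)
    moreover have "f div s * s \<in> V" by (rule r) (simp add: s_def)
    ultimately show "\<exists>g\<in>V. \<exists>c. f = g + (\<Sum>i<r. smult (c i) (map (monom 1) [0..<r] ! i))"
      by blast
  qed
  thus ?thesis unfolding poly_codim_def by (rule LeastI)
qed

text \<open>By minimality: a relation with c i0 non-zero would make \<open>P ! i0\<close> redundant
  and leave a spanning list of length n - 1.\<close>

lemma poly_codim_independent:
  assumes V: "poly_subspace V" and n: "n = poly_codim V"
  assumes P: "length P = n" "\<And>f. \<exists>g\<in>V. \<exists>c. f = g + (\<Sum>i<n. smult (c i) (P ! i))"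
  assumes c: "(\<Sum>i<n. smult (c i) (P ! i)) \<in> V" and i0: "i0 < n"
  shows "c i0 = 0"
proof (rule ccontr)
  assume nz: "c i0 \<noteq> 0"
  define v where "v = (\<Sum>i<n. smult (c i) (P ! i))"
  \<comment> \<open>Enumerates the indices other than \<open>i0\<close> by letting the last index
    take its place.\<close>
  define h where "h i = (if i = i0 then n - 1 else i)" for i
  define P' where "P' = map (\<lambda>i. P ! h i) [0..<n - 1]"
  have bij: "bij_betw h {..<n - 1} ({..<n} - {i0})"
    by (rule bij_betw_byWitness[where f' = "\<lambda>i. if i = n - 1 then i0 else i"])
      (use i0 in \<open>auto simp: h_def\<close>)
  have "\<exists>g\<in>V. \<exists>d. f = g + (\<Sum>i<n - 1. smult (d i) (P' ! i))" for f
  proof -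
    obtain g c' where g: "g \<in> V" "f = g + (\<Sum>i<n. smult (c' i) (P ! i))" using P(2) by blast
    define a where "a = c' i0 / c i0"
    define e where "e i = c' i - a * c i" for i
    have e0: "e i0 = 0" using nz by (simp add: e_def a_def)
    have "(\<Sum>i<n. smult (c' i) (P ! i)) = smult a v + (\<Sum>i<n. smult (e i) (P ! i))"
      by (simp add: v_def e_def smult_sum_right sum.distrib[symmetric] flip: smult_add_left)
    also have "(\<Sum>i<n. smult (e i) (P ! i)) = (\<Sum>i\<in>{..<n} - {i0}. smult (e i) (P ! i))"
      by (rule sum.mono_neutral_right) (auto simp: e0)
    also have "\<dots> = (\<Sum>i<n - 1. smult (e (h i)) (P ! h i))"
      by (rule sum.reindex_bij_betw[OF bij, symmetric])
    also have "\<dots> = (\<Sum>i<n - 1. smult (e (h i)) (P' ! i))"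
      by (intro sum.cong) (simp_all add: P'_def)
    finally have "f = (g + smult a v) + (\<Sum>i<n - 1. smult (e (h i)) (P' ! i))"
      using g(2) by (simp add: add.assoc)
    moreover have "g + smult a v \<in> V" using V g(1) c by (auto simp: poly_subspace_def v_def)
    ultimately show ?thesis by (intro bexI[of _ "g + smult a v"] exI[of _ "\<lambda>i. e (h i)"])
  qed
  moreover have "length P' = n - 1" by (simp add: P'_def)
  ultimately have "poly_codim V \<le> n - 1" unfolding poly_codim_def by (intro Least_le) blast
  thus False using n i0 by simp
qed

text \<open>The conditions are the coordinates with respect to a minimal spanning list modulo
  \<open>V\<close>. Independence modulo \<open>V\<close> makes the coordinates unique, hence linear,
  and they vanish on the power of z - l inside \<open>V\<close>, so they are pairings.\<close>

lemma primary_conds: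
  assumes "primary l V"
  shows "\<exists>us. length us = poly_codim V \<and> indep_conds (map (Pair l) us) \<and>
     conds_space (map (Pair l) us) = V"
proof -
  define n where "n = poly_codim V"
  have V: "poly_subspace V" using assms by (simp add: primary_def)
  obtain r where r: "\<And>p. [:-l, 1:] ^ r dvd p \<Longrightarrow> p \<in> V" using assms by (auto simp: primary_def)
  obtain P where P: "length P = n" "\<And>f. \<exists>g\<in>V. \<exists>c. f = g + (\<Sum>i<n. smult (c i) (P ! i))"
    using poly_codim_spans[OF assms] by (auto simp: n_def)
  then obtain G C where GC: "\<And>f. G f \<in> V" "\<And>f. f = G f + (\<Sum>i<n. smult (C f i) (P ! i))"
    by metis
  note indep = poly_codim_independent[OF V n_def P]
  have neg: "- f \<in> V" if "f \<in> V" for f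
    using V that unfolding poly_subspace_def by (metis smult_1_left smult_minus_left)
  have uniq: "C f i = c i" if "f - (\<Sum>i<n. smult (c i) (P ! i)) \<in> V" "i < n" for f c i
  proof -
    have "(\<Sum>i<n. smult (C f i - c i) (P ! i)) = (f - (\<Sum>i<n. smult (c i) (P ! i))) + - G f"
      by (subst (1) GC(2)[of f]) (simp add: smult_diff_left sum_subtractf)
    also have "\<dots> \<in> V" using V that(1) neg[OF GC(1)] unfolding poly_subspace_def by blast
    finally show ?thesis using indep[of "\<lambda>i. C f i - c i" i] that(2) by simp
  qed
  have add: "C (f + g) i = C f i + C g i" if "i < n" for f g i
  proof (rule uniq[OF _ that])
    have "f + g - (\<Sum>i<n. smult (C f i + C g i) (P ! i)) = G f + G g"
      by (subst (1) GC(2)[of f], subst (1) GC(2)[of g]) (simp add: smult_add_left sum.distrib)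
    thus "f + g - (\<Sum>i<n. smult (C f i + C g i) (P ! i)) \<in> V"
      using V GC(1) by (auto simp: poly_subspace_def)
  qed
  have smult: "C (smult a f) i = a * C f i" if "i < n" for f a i
  proof (rule uniq[OF _ that])
    have "smult a f - (\<Sum>i<n. smult (a * C f i) (P ! i)) = smult a (G f)"
      by (subst (1) GC(2)[of f]) (simp add: smult_add_right smult_sum_right)
    thus "smult a f - (\<Sum>i<n. smult (a * C f i) (P ! i)) \<in> V"
      using V GC(1) by (auto simp: poly_subspace_def)
  qed
  have vanish: "C f i = 0" if "f \<in> V" "i < n" for f i
    using uniq[of f "\<lambda>_. 0" i] that by simp
  have dual: "C (P ! i) j = (if j = i then 1 else 0)" if "i < n" "j < n" for i j
  proof (rule uniq[OF _ that(2)])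
    have "(\<Sum>k<n. smult (if k = i then 1 else 0) (P ! k)) = (\<Sum>k<n. if k = i then P ! i else 0)"
      by (intro sum.cong) auto
    thus "P ! i - (\<Sum>k<n. smult (if k = i then 1 else 0) (P ! k)) \<in> V"
      using V that by (simp add: poly_subspace_def)
  qed
  have "\<exists>u. \<forall>f. C f i = pairing l u 0 f" if "i < n" for i
    by (rule functional_is_pairing[where r = r]) (simp_all add: add smult vanish r that)
  then obtain u where u: "\<And>i f. i < n \<Longrightarrow> pairing l (u i) 0 f = C f i" by metis
  define us where "us = map u [0..<n]"
  have "indep_conds (map (Pair l) us)"
  proof (rule indep_conds_dual)
    fix i assume "i < length us"
    thus "\<exists>f. pairing l (us ! i) 0 f \<noteq> 0 \<and> (\<forall>j. i < j \<and> j < length us \<longrightarrow> pairing l (us ! j) 0 f = 0)"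
      by (intro exI[of _ "P ! i"]) (auto simp: us_def u dual)
  qed
  moreover have "conds_space (map (Pair l) us) = V"
  proof (intro equalityI subsetI)
    fix f assume "f \<in> conds_space (map (Pair l) us)"
    hence "\<forall>x\<in>{0..<n}. pairing l (u x) 0 f = 0" by (simp add: conds_space_def us_def)
    hence "C f i = 0" if "i < n" for i using that u[OF that, of f] by (metis atLeastLessThan_iff le0)
    hence "f = G f" using GC(2)[of f] by simp
    thus "f \<in> V" using GC(1) by metis
  next
    fix f assume "f \<in> V"
    thus "f \<in> conds_space (map (Pair l) us)" by (auto simp: conds_space_def us_def u vanish)
  qed
  ultimately show ?thesis by (intro exI[of _ us]) (simp add: us_def n_def)
qed

lemma indep_conds_append:
  assumes "indep_conds (map (Pair l) us)" "indep_conds ys" "l \<notin> fst ` set ys"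
  shows "indep_conds (map (Pair l) us @ ys)"
  using assms(1)
proof (induction us)
  case (Cons u us)
  have "(l, v) \<notin> set ys" for v using assms(3) by force
  hence "(l, v) \<in> set (map (Pair l) us @ ys) \<longleftrightarrow> (l, v) \<in> set (map (Pair l) us)" for v by simp
  thus ?case using Cons by (simp only: list.map append.simps indep_conds.simps)
qed (simp add: assms(2))

lemma conds_space_append: "conds_space (xs @ ys) = conds_space xs \<inter> conds_space ys"
  by (auto simp: conds_space_def)

theorem primary_decomp_conds:
  assumes "finite Lam" "\<And>l. l \<in> Lam \<Longrightarrow> primary l (Vs l)"
  shows "\<exists>xs. indep_conds xs \<and> fst ` set xs \<subseteq> Lam \<and> conds_space xs = (\<Inter>l\<in>Lam. Vs l) \<and>
     conds_poly xs = (\<Prod>l\<in>Lam. [:-l, 1:] ^ poly_codim (Vs l))"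
  using assms
proof (induction Lam rule: finite_induct)
  case empty
  show ?case by (rule exI[of _ "[]"]) (simp add: conds_space_def)
next
  case (insert l Lam)
  then obtain ys where ys: "indep_conds ys" "fst ` set ys \<subseteq> Lam" "conds_space ys = (\<Inter>l\<in>Lam. Vs l)"
     "conds_poly ys = (\<Prod>l\<in>Lam. [:-l, 1:] ^ poly_codim (Vs l))" by blast
  obtain us where us: "length us = poly_codim (Vs l)" "indep_conds (map (Pair l) us)"
     "conds_space (map (Pair l) us) = Vs l"
    using primary_conds[of l "Vs l"] insert.prems by blast
  have "conds_poly (map (Pair l) us) = [:-l, 1:] ^ length us"
    by (induction us) (simp_all del: mult_pCons_left)
  hence "conds_poly (map (Pair l) us @ ys) = (\<Prod>l\<in>insert l Lam. [:-l, 1:] ^ poly_codim (Vs l))"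
    using insert.hyps by (simp add: conds_poly_append ys us)
  moreover have "l \<notin> fst ` set ys" using ys(2) insert.hyps by blast
  hence "indep_conds (map (Pair l) us @ ys)" by (intro indep_conds_append us ys)
  moreover have "conds_space (map (Pair l) us @ ys) = (\<Inter>l\<in>insert l Lam. Vs l)"
    by (simp add: conds_space_append us ys)
  moreover have "fst ` set (map (Pair l) us @ ys) \<subseteq> insert l Lam" using ys(2) by auto
  ultimately show ?case by blast
qed

text \<open>The list is built from the very decomposition chosen inside \<open>m_poly\<close>, so
  the two polynomials agree whatever that choice is.\<close>

corollary primary_decomposable_conds:
  assumes "primary_decomposable V"
  shows "\<exists>xs. indep_conds xs \<and> conds_space xs = V \<and> conds_poly xs = m_poly V"
proof -
  define LV where "LV = (SOME LV. primary_decomp V (fst LV) (snd LV))"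
  have "\<exists>LV. primary_decomp V (fst LV) (snd LV)"
    using assms by (auto simp: primary_decomposable_def)
  hence LV: "primary_decomp V (fst LV) (snd LV)" unfolding LV_def by (rule someI_ex)
  then obtain xs where "indep_conds xs" "conds_space xs = (\<Inter>l\<in>fst LV. snd LV l)"
     "conds_poly xs = (\<Prod>l\<in>fst LV. [:-l, 1:] ^ poly_codim (snd LV l))"
    using primary_decomp_conds[of "fst LV" "snd LV"] by (auto simp: primary_decomp_def)
  thus ?thesis using LV by (auto simp: primary_decomp_def m_poly_def LV_def Let_def)
qed

section \<open>Generators of the space cut out by a list of conditions\<close>

lemma conds_space_iff: "f \<in> conds_space xs \<longleftrightarrow> (\<forall>l u. (l, u) \<in> set xs \<longrightarrow> pairing l u 0 f = 0)"
  by (auto simp: conds_space_def)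

lemma conds_space_subspace:
  "0 \<in> conds_space xs" "f \<in> conds_space xs \<Longrightarrow> g \<in> conds_space xs \<Longrightarrow> f + g \<in> conds_space xs"
  "f \<in> conds_space xs \<Longrightarrow> smult c f \<in> conds_space xs"
  by (auto simp: conds_space_iff pairing_add_right pairing_smult_right)

lemma conds_space_contains_ideal: "\<exists>M. M \<noteq> 0 \<and> (\<forall>h. M * h \<in> conds_space xs)"
proof (induction xs)
  case Nil
  show ?case by (rule exI[of _ 1]) (simp add: conds_space_iff)
next
  case (Cons x xs)
  then obtain M where M: "M \<noteq> 0" "\<And>h. M * h \<in> conds_space xs" by blast
  obtain l u where x: "x = (l, u)" by force
  define s where "s = [:-l, 1:] ^ Suc (degree u)"
  have "s * M * h \<in> conds_space (x # xs)" for h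
  proof -
    have "pairing l u 0 (s * (M * h)) = 0"
      by (rule pairing_power_shift_eq_0[of u "Suc (degree u)"]) (simp_all add: s_def del: power_Suc)
    moreover have "M * (s * h) \<in> conds_space xs" by (rule M)
    ultimately show ?thesis by (simp add: conds_space_iff x ac_simps)
  qed
  moreover have "s * M \<noteq> 0" using M by (simp add: s_def del: power_Suc)
  ultimately show ?case by blast
qed

text \<open>The transpose of b(q L) is q L, which kills the quasi-polynomials of the conditions.
  Hence m^-1 b(q L) belongs to R_W.\<close>

lemma swap_num_maps_into_conds_space:
  assumes "indep_conds xs"
  shows "pact 0 (swap_op (annop_num xs)) f \<in> conds_space xs"
  by (auto simp: conds_space_iff pairing_transpose pact_annop_num_eq_0)

text \<open>The image of b(q L) for the shorter list contains an element on which the added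
  condition is non-zero and the others vanish; it adjusts one value without disturbing the
  rest.\<close>

lemma conds_surjective:
  assumes "indep_conds xs"
  shows "\<exists>e. \<forall>i<length xs. pairing (fst (xs ! i)) (snd (xs ! i)) 0 e = b i"
  using assms
proof (induction xs arbitrary: b)
  case (Cons x xs)
  obtain l u where x: "x = (l, u)" by force
  have "pact l (annop_num xs) u \<noteq> 0"
    using annop_head_nonzero Cons.prems by (simp add: x pact_annop_num_eq_0_iff)
  then obtain f where f: "pairing l (pact l (annop_num xs) u) 0 f \<noteq> 0"
    using pairing_nondegenerate by blast
  define e0 where "e0 = pact 0 (swap_op (annop_num xs)) f"
  have e0: "e0 \<in> conds_space xs" "pairing l u 0 e0 \<noteq> 0"
    using f Cons.prems by (simp_all add: e0_def swap_num_maps_into_conds_space pairing_transpose x)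
  obtain e where e: "\<And>i. i < length xs \<Longrightarrow> pairing (fst (xs ! i)) (snd (xs ! i)) 0 e = b (Suc i)"
    using Cons.IH[of "\<lambda>i. b (Suc i)"] Cons.prems by (auto simp: x)
  define c where "c = (b 0 - pairing l u 0 e) / pairing l u 0 e0"
  have "pairing (fst ((x # xs) ! i)) (snd ((x # xs) ! i)) 0 (e + smult c e0) = b i"
    if "i < length (x # xs)" for i
  proof (cases i)
    case 0
    thus ?thesis using e0(2) by (simp add: x pairing_add_right pairing_smult_right c_def)
  next
    case (Suc j)
    hence "xs ! j \<in> set xs" using that by simp
    hence "pairing (fst (xs ! j)) (snd (xs ! j)) 0 e0 = 0"
      using e0(1) unfolding conds_space_iff by (metis prod.collapse)
    thus ?thesis using e[of j] that Suc by (simp add: pairing_add_right pairing_smult_right)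
  qed
  thus ?case by blast
qed simp

text \<open>A double annihilator argument. The space on the right is primary decomposable, hence cut
  out by conditions \<open>w\<close>. Each kills the image of b(q L), so L kills e^(lx) w, and
  \<open>annop_kernel\<close> makes \<open>w\<close> a combination of given conditions at the same
  point, which vanish on \<open>v\<close>.\<close>

lemma conds_space_generators:
  assumes xs: "indep_conds xs" and M: "M \<noteq> 0" "\<And>h. M * h \<in> conds_space xs"
    and v: "v \<in> conds_space xs"
  shows "\<exists>g h. v = pact 0 (swap_op (annop_num xs)) g + M * h"
proof -
  define U where "U = {pact 0 (swap_op (annop_num xs)) g + M * h | g h. True}"
  have "primary_decomposable U" unfolding U_def by (rule primary_decomposable_operator_image[OF M(1)])
  then obtain ws where ws: "conds_space ws = U" using primary_decomposable_conds by blast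
  have "pairing l w 0 v = 0" if w: "(l, w) \<in> set ws" for l w
  proof -
    have "pairing l (pact l (annop_num xs) w) 0 f = 0" for f
    proof -
      have "pact 0 (swap_op (annop_num xs)) f = pact 0 (swap_op (annop_num xs)) f + M * 0" by simp
      hence "pact 0 (swap_op (annop_num xs)) f \<in> U" unfolding U_def by blast
      hence "pairing l w 0 (pact 0 (swap_op (annop_num xs)) f) = 0"
        using w unfolding ws[symmetric] by (auto simp: conds_space_iff)
      thus ?thesis by (simp add: pairing_transpose)
    qed
    hence "act l (annop xs) (ratpoly w) = 0"
      using pairing_nondegenerate pact_annop_num_eq_0_iff by blast
    thus ?thesis
      by (rule annop_kernel[OF xs, where F = "\<lambda>w. pairing l w 0 v"])
        (use v in \<open>auto simp: pairing_add pairing_smult conds_space_iff\<close>)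
  qed
  hence "v \<in> U" unfolding ws[symmetric] by (auto simp: conds_space_iff)
  thus ?thesis by (auto simp: U_def)
qed

subsection \<open>Closure in the space of entire functions\<close>

lemma higher_deriv_exp_poly:
  "(deriv ^^ j) (\<lambda>z. exp (x * z) * poly p z) = (\<lambda>z. exp (x * z) * poly ((dpoly x ^^ j) p) z)"
proof (induction j)
  case (Suc j)
  have "deriv (\<lambda>z. exp (x * z) * poly q z) = (\<lambda>z. exp (x * z) * poly (dpoly x q) z)" for q
  proof
    fix z
    have "((\<lambda>z. exp (x * z) * poly q z) has_field_derivative exp (x * z) * poly (dpoly x q) z) (at z)"
      by (auto intro!: derivative_eq_intros poly_DERIV simp: dpoly_def algebra_simps)
    thus "deriv (\<lambda>z. exp (x * z) * poly q z) z = exp (x * z) * poly (dpoly x q) z"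
      by (rule DERIV_imp_deriv)
  qed
  thus ?case by (simp add: Suc.IH)
qed simp

definition entire_functional :: "complex \<Rightarrow> complex poly \<Rightarrow> (complex \<Rightarrow> complex) \<Rightarrow> complex" where
  "entire_functional l u f = (\<Sum>j\<le>degree u. coeff u j * (deriv ^^ j) f l)"

lemma entire_functional_exp_poly:
  "entire_functional l u (\<lambda>z. exp (x * z) * poly p z) = exp (x * l) * pairing l u x p"
  by (simp add: entire_functional_def higher_deriv_exp_poly pairing_def sum_distrib_left mult.left_commute)

lemma entire_functional_poly: "entire_functional l u (poly p) = pairing l u 0 p"
  using entire_functional_exp_poly[of l u 0 p] by simp

lemma entire_functional_limit:
  assumes "\<And>K. compact K \<Longrightarrow> uniform_limit K (\<lambda>n. poly (P n)) f sequentially"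
  shows "(\<lambda>n. pairing l u 0 (P n)) \<longlonglongrightarrow> entire_functional l u f"
proof -
  have "uniform_limit (ball l 1) (\<lambda>n. poly (P n)) f sequentially"
    by (rule uniform_limit_on_subset[OF assms[of "cball l 1"]]) auto
  hence "(\<lambda>n. (deriv ^^ j) (poly (P n)) l) \<longlonglongrightarrow> (deriv ^^ j) f l" for j
    by (rule higher_deriv_complex_uniform_limit) (auto intro!: always_eventually holomorphic_intros
        simp: poly_altdef)
  hence "(\<lambda>n. entire_functional l u (poly (P n))) \<longlonglongrightarrow> entire_functional l u f"
    unfolding entire_functional_def by (intro tendsto_intros)
  thus ?thesis by (simp add: entire_functional_poly)
qed

definition exp_taylor :: "complex \<Rightarrow> nat \<Rightarrow> complex poly" where
  "exp_taylor x n = (\<Sum>k<n. monom (x ^ k / fact k) k)"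

lemma exp_taylor_uniform_limit:
  assumes "compact K"
  shows "uniform_limit K (\<lambda>n. poly (exp_taylor x n * p)) (\<lambda>z. exp (x * z) * poly p z) sequentially"
proof -
  obtain R where R: "\<And>z. z \<in> K \<Longrightarrow> norm z \<le> R"
    using compact_imp_bounded[OF assms] by (auto simp: bounded_iff)
  have "compact (poly p ` K)" by (intro compact_continuous_image assms continuous_intros)
  then obtain B where B: "\<And>z. z \<in> K \<Longrightarrow> norm (poly p z) \<le> B"
    using compact_imp_bounded by (force simp: bounded_iff)
  have "uniform_limit K (\<lambda>n z. \<Sum>k<n. (x * z) ^ k / fact k * poly p z)
     (\<lambda>z. suminf (\<lambda>k. (x * z) ^ k / fact k * poly p z)) sequentially"
  proof (rule Weierstrass_m_test)
    fix k z assume z: "z \<in> K"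
    have "norm ((x * z) ^ k / fact k * poly p z) = norm (x * z) ^ k / fact k * norm (poly p z)"
      by (simp add: norm_mult norm_divide norm_power)
    also have "\<dots> \<le> (norm x * R) ^ k / fact k * B"
      using R[OF z] B[OF z] order_trans[OF norm_ge_zero R[OF z]]
      by (intro mult_mono divide_right_mono power_mono) (auto simp: norm_mult intro!: mult_left_mono)
    finally show "norm ((x * z) ^ k / fact k * poly p z) \<le> (norm x * R) ^ k / fact k * B" .
  next
    show "summable (\<lambda>k. (norm x * R) ^ k / fact k * B)"
      using summable_exp[of "norm x * R"] by (intro summable_mult2) (simp add: field_simps)
  qed
  moreover have "(\<lambda>z. suminf (\<lambda>k. (x * z) ^ k / fact k * poly p z)) = (\<lambda>z. exp (x * z) * poly p z)"
  proof
    fix z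
    have "(\<lambda>k. (x * z) ^ k /\<^sub>R fact k) sums exp (x * z)" by (rule exp_converges)
    hence "(\<lambda>k. (x * z) ^ k / fact k) sums exp (x * z)"
      by (simp add: scaleR_conv_of_real field_simps)
    thus "suminf (\<lambda>k. (x * z) ^ k / fact k * poly p z) = exp (x * z) * poly p z"
      by (intro sums_unique[symmetric] sums_mult2)
  qed
  moreover have "(\<lambda>n z. \<Sum>k<n. (x * z) ^ k / fact k * poly p z) = (\<lambda>n. poly (exp_taylor x n * p))"
    by (intro ext) (simp add: exp_taylor_def poly_sum poly_monom sum_distrib_right power_mult_distrib)
  ultimately show ?thesis by (simp only:)
qed

lemma uniform_limit_sum:
  fixes f :: "'i \<Rightarrow> 'a \<Rightarrow> 'b \<Rightarrow> 'c::real_normed_vector"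
  assumes "\<And>i. i \<in> A \<Longrightarrow> uniform_limit K (f i) (g i) F"
  shows "uniform_limit K (\<lambda>n z. \<Sum>i\<in>A. f i n z) (\<lambda>z. \<Sum>i\<in>A. g i z) F"
  using assms
  by (induction A rule: infinite_finite_induct) (simp_all add: uniform_limit_const uniform_limit_add)

lemma exp_poly_in_closure_iff:
  assumes "indep_conds xs"
  shows "(\<lambda>z. exp (x * z) * poly p z) \<in> ent_closure (conds_space xs) \<longleftrightarrow>
     (\<forall>(l, u) \<in> set xs. pairing l u x p = 0)"
proof
  assume "(\<lambda>z. exp (x * z) * poly p z) \<in> ent_closure (conds_space xs)"
  then obtain P where P: "\<And>n. P n \<in> conds_space xs"
    "\<And>K. compact K \<Longrightarrow> uniform_limit K (\<lambda>n. poly (P n)) (\<lambda>z. exp (x * z) * poly p z) sequentially"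
    by (auto simp: ent_closure_def)
  have "pairing l u x p = 0" if "(l, u) \<in> set xs" for l u
  proof -
    have "(\<lambda>n. pairing l u 0 (P n)) \<longlonglongrightarrow> exp (x * l) * pairing l u x p"
      using entire_functional_limit[OF P(2)] by (simp add: entire_functional_exp_poly)
    moreover have "pairing l u 0 (P n) = 0" for n using P(1)[of n] that by (auto simp: conds_space_iff)
    ultimately have "(\<lambda>n::nat. 0) \<longlonglongrightarrow> exp (x * l) * pairing l u x p" by simp
    hence "exp (x * l) * pairing l u x p = 0" by (metis LIMSEQ_const_iff)
    thus ?thesis by simp
  qed
  thus "\<forall>(l, u) \<in> set xs. pairing l u x p = 0" by auto
next
  assume z: "\<forall>(l, u) \<in> set xs. pairing l u x p = 0"
  define k where "k = length xs"
  define F where "F i q = pairing (fst (xs ! i)) (snd (xs ! i)) 0 q" for i q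
  have "\<exists>e. \<forall>i<k. F i e = (if i = j then 1 else 0)" for j
    using conds_surjective[OF assms, of "\<lambda>i. if i = j then 1 else 0"] by (simp add: F_def k_def)
  then obtain e where e: "\<And>i j. i < k \<Longrightarrow> F i (e j) = (if i = j then 1 else 0)" by metis
  define T where "T n = exp_taylor x n * p" for n
  have lim: "uniform_limit K (\<lambda>n. poly (T n)) (\<lambda>z. exp (x * z) * poly p z) sequentially"
    if "compact K" for K using exp_taylor_uniform_limit[OF that] by (simp add: T_def)
  \<comment> \<open>The Taylor approximations violate the conditions slightly. Multiples of the dual
    elements \<open>e j\<close> restore them exactly, and these multiples tend to the values of the
    conditions on the limit function, which are zero.\<close>
  define Q where "Q n = T n - (\<Sum>j<k. smult (F j (T n)) (e j))" for n
  have "Q n \<in> conds_space xs" for n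
  proof -
    have "F i (Q n) = 0" if "i < k" for i
    proof -
      have "F i (Q n) = F i (T n) - (\<Sum>j<k. F j (T n) * F i (e j))"
        by (simp add: F_def Q_def pairing_diff_right pairing_sum_right pairing_smult_right)
      also have "(\<Sum>j<k. F j (T n) * F i (e j)) = (\<Sum>j<k. if j = i then F i (T n) else 0)"
        using that by (intro sum.cong) (auto simp: e)
      finally show ?thesis using that by simp
    qed
    thus ?thesis unfolding conds_space_iff F_def k_def in_set_conv_nth by (metis fst_conv snd_conv)
  qed
  moreover have "uniform_limit K (\<lambda>n. poly (Q n)) (\<lambda>z. exp (x * z) * poly p z) sequentially"
    if K: "compact K" for K
  proof -
    have b: "bounded (poly q ` K)" for q
      by (intro compact_imp_bounded compact_continuous_image K continuous_intros)
    have "uniform_limit K (\<lambda>n z. F j (T n) * poly (e j) z) (\<lambda>z. 0 * poly (e j) z) sequentially"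
      if j: "j < k" for j
    proof (rule uniform_lim_mult)
      have "xs ! j \<in> set xs" using j by (simp add: k_def)
      hence "pairing (fst (xs ! j)) (snd (xs ! j)) x p = 0" using z by auto
      hence "entire_functional (fst (xs ! j)) (snd (xs ! j)) (\<lambda>z. exp (x * z) * poly p z) = 0"
        by (simp add: entire_functional_exp_poly)
      moreover have "(\<lambda>n. F j (T n)) \<longlonglongrightarrow>
          entire_functional (fst (xs ! j)) (snd (xs ! j)) (\<lambda>z. exp (x * z) * poly p z)"
        unfolding F_def by (rule entire_functional_limit) (rule lim)
      ultimately have "(\<lambda>n. F j (T n)) \<longlonglongrightarrow> 0" by (simp only:)
      thus "uniform_limit K (\<lambda>n z. F j (T n)) (\<lambda>z. 0) sequentially"
        by (auto simp: uniform_limit_iff tendsto_iff elim!: eventually_mono)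
    qed (auto simp: b uniform_limit_const image_constant_conv)
    hence "uniform_limit K (\<lambda>n z. poly (T n) z - (\<Sum>j<k. F j (T n) * poly (e j) z))
       (\<lambda>z. exp (x * z) * poly p z - (\<Sum>j<k. 0 * poly (e j) z)) sequentially"
      by (intro uniform_limit_minus uniform_limit_sum lim K) auto
    moreover have "(\<lambda>n z. poly (T n) z - (\<Sum>j<k. F j (T n) * poly (e j) z)) = (\<lambda>n. poly (Q n))"
      by (intro ext) (simp add: Q_def poly_sum)
    ultimately show ?thesis by simp
  qed
  moreover have "(\<lambda>z. exp (x * z) * poly p z) holomorphic_on UNIV"
    by (intro holomorphic_intros)
  ultimately show "(\<lambda>z. exp (x * z) * poly p z) \<in> ent_closure (conds_space xs)"
    by (auto simp: ent_closure_def)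
qed

subsection \<open>Points of the adelic Grassmannian and their Baker functions\<close>

text \<open>\<open>gamma_act\<close> works with a representative \<open>V\<close> of \<open>W\<close> picked by \<open>SOME\<close>, and \<open>m_poly\<close> with a
  decomposition picked by \<open>SOME\<close>; the last conjunct says that \<open>xs\<close> belongs to these choices.\<close>

definition grass_conds :: "ratfun set \<Rightarrow> conds \<Rightarrow> bool" where
  "grass_conds W xs \<longleftrightarrow> indep_conds xs \<and> W = (\<lambda>p. Fract p (conds_poly xs)) ` conds_space xs \<and>
     (\<forall>x. gamma_act [:0, -x:] W = (\<lambda>p. Fract p (conds_poly xs)) `
        {p. \<forall>(l, u) \<in> set xs. pairing l u x p = 0})"

theorem Gr_ad_conds:
  assumes "W \<in> Gr_ad"
  shows "\<exists>xs. grass_conds W xs"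
proof -
  define V where "V = (SOME V. grad_rep W V)"
  have V: "grad_rep W V" using assms unfolding V_def Gr_ad_def by (auto intro: someI)
  then obtain xs where xs: "indep_conds xs" "conds_space xs = V" "conds_poly xs = m_poly V"
    using primary_decomposable_conds by (auto simp: grad_rep_def)
  have "{p. \<exists>f\<in>ent_closure V. \<forall>z. poly p z = exp (poly [:0, -x:] z) * f z} =
     {p. \<forall>(l, u) \<in> set xs. pairing l u x p = 0}" for x
  proof -
    have "(\<exists>f\<in>ent_closure V. \<forall>z. poly p z = exp (poly [:0, -x:] z) * f z) \<longleftrightarrow>
        (\<lambda>z. exp (x * z) * poly p z) \<in> ent_closure V" for p
    proof
      assume "\<exists>f\<in>ent_closure V. \<forall>z. poly p z = exp (poly [:0, -x:] z) * f z"
      then obtain f where f: "f \<in> ent_closure V" "\<And>z. poly p z = exp (poly [:0, -x:] z) * f z" by blast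
      have "(\<lambda>z. exp (x * z) * poly p z) = f"
        by (rule ext) (simp add: f(2) mult.assoc[symmetric] mult.commute[of _ x] flip: exp_add)
      thus "(\<lambda>z. exp (x * z) * poly p z) \<in> ent_closure V" using f(1) by simp
    next
      assume "(\<lambda>z. exp (x * z) * poly p z) \<in> ent_closure V"
      moreover have "poly p z = exp (poly [:0, -x:] z) * (exp (x * z) * poly p z)" for z
        by (simp add: mult.assoc[symmetric] mult.commute[of _ x] flip: exp_add)
      ultimately show "\<exists>f\<in>ent_closure V. \<forall>z. poly p z = exp (poly [:0, -x:] z) * f z"
        by (intro bexI[of _ "\<lambda>z. exp (x * z) * poly p z"]) blast+
    qed
    thus ?thesis using exp_poly_in_closure_iff[OF xs(1)] by (simp add: xs(2))
  qed
  moreover have "gamma_act g W = (\<lambda>p. Fract p (m_poly V)) `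
      {p. \<exists>f\<in>ent_closure V. \<forall>z. poly p z = exp (poly g z) * f z}" for g
    by (simp only: gamma_act_def Let_def V_def[symmetric])
  moreover have "W = (\<lambda>p. Fract p (m_poly V)) ` V" using V by (simp add: grad_rep_def)
  ultimately have "grass_conds W xs"
    unfolding grass_conds_def xs using xs(1) by (simp only: simp_thms)
  thus ?thesis by blast
qed

lemma one_plus_O_Fract_iff:
  assumes "degree m = k" "coeff m k = 1"
  shows "one_plus_O (Fract p m) \<longleftrightarrow> degree p \<le> k \<and> coeff p k = 1"
proof
  have m0: "m \<noteq> 0" using assms(2) by auto
  assume "one_plus_O (Fract p m)"
  then obtain a b where ab: "b \<noteq> 0" "Fract p m = Fract a b" "degree (a - b) < degree b"
    by (auto simp: one_plus_O_def)
  have "p * b = a * m" using ab m0 by (simp add: eq_fract)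
  hence e: "(p - m) * b = (a - b) * m" by (simp add: algebra_simps)
  have "p = m \<or> degree (p - m) < k"
  proof (cases "a = b")
    case True
    thus ?thesis using e ab(1) by simp
  next
    case False
    hence "p - m \<noteq> 0" using e m0 by auto
    hence "degree (p - m) + degree b = degree ((a - b) * m)" using ab(1) e by (metis degree_mult_eq)
    also have "\<dots> = degree (a - b) + k" using False m0 assms by (simp add: degree_mult_eq)
    finally show ?thesis using ab(3) by linarith
  qed
  hence c: "coeff (p - m) n = 0" if "n \<ge> k" for n
    using that coeff_eq_0[of "p - m" n] by fastforce
  have "degree p \<le> k"
  proof (rule degree_le, safe)
    fix n assume "n > k"
    thus "coeff p n = 0" using c[of n] assms(1) by (simp add: coeff_eq_0)
  qed
  thus "degree p \<le> k \<and> coeff p k = 1" using c[of k] assms(2) by simp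
next
  have m0: "m \<noteq> 0" using assms(2) by auto
  assume p: "degree p \<le> k \<and> coeff p k = 1"
  \<comment> \<open>Expanding the fraction by z serves the case k = 0, where p = m = 1 and the
    strict inequality in \<open>one_plus_O\<close> fails for the given representative.\<close>
  have "degree ([:0, 1:] * p - [:0, 1:] * m) < degree ([:0, 1:] * m)"
  proof -
    have "coeff (p - m) n = 0" if "n \<ge> k" for n
      using that p assms by (cases "n = k") (auto simp: coeff_eq_0)
    hence "coeff ([:0, 1:] * p - [:0, 1:] * m) n = 0" if "n > k" for n
      using that by (simp add: coeff_pCons split: nat.splits)
    hence "degree ([:0, 1:] * p - [:0, 1:] * m) \<le> k" by (intro degree_le) blast
    moreover have "degree ([:0, 1:] * m) = Suc k" using m0 assms by simp
    ultimately show ?thesis by simp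
  qed
  moreover have "Fract p m = Fract ([:0, 1:] * p) ([:0, 1:] * m)"
    using m0 by (simp add: eq_fract)
  ultimately show "one_plus_O (Fract p m)" using m0 unfolding one_plus_O_def
    by (metis mult_pCons_left mult_zero_left no_zero_divisors pCons_eq_0_iff zero_neq_one)
qed

lemma baker_candidates:
  assumes "grass_conds W xs"
  shows "r \<in> gamma_act [:0, -x:] W \<and> one_plus_O r \<longleftrightarrow>
    (\<exists>p. r = Fract p (conds_poly xs) \<and> (\<forall>(l, u) \<in> set xs. pairing l u x p = 0) \<and>
       degree p \<le> length xs \<and> coeff p (length xs) = 1)"
proof -
  have "gamma_act [:0, -x:] W = (\<lambda>p. Fract p (conds_poly xs)) `
        {p. \<forall>(l, u) \<in> set xs. pairing l u x p = 0}"
    using assms unfolding grass_conds_def by blast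
  moreover have "one_plus_O (Fract p (conds_poly xs)) \<longleftrightarrow> degree p \<le> length xs \<and> coeff p (length xs) = 1"
    for p by (rule one_plus_O_Fract_iff) simp_all
  ultimately show ?thesis by auto
qed

text \<open>The polynomial e^(-xz) L e^(xz) in z, with L acting in x; it is monic wherever the
  denominator of L is non-zero.\<close>

definition baker_num :: "conds \<Rightarrow> complex \<Rightarrow> complex poly" where
  "baker_num xs x = smult (inverse (poly (annop_den xs) x)) (eval_op (annop_num xs) x)"

lemma baker_num_candidate:
  assumes "poly (annop_den xs) x \<noteq> 0"
  shows "(\<forall>(l, u) \<in> set xs. pairing l u x (baker_num xs x) = 0) \<and>
     degree (baker_num xs x) \<le> length xs \<and> coeff (baker_num xs x) (length xs) = 1"
  using assms degree_eval_op_le[of "annop_num xs" x]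
  by (auto simp: baker_num_def pairing_smult_right pairing_eval_annop_num)

lemma Fract_eq_iff_same: "q \<noteq> 0 \<Longrightarrow> Fract a q = Fract b q \<longleftrightarrow> a = (b :: 'a :: idom)"
  by (simp add: eq_fract)

lemma baker_tilde_eq:
  assumes W: "grass_conds W xs" and ex: "baker_tilde_exists W x"
  shows "poly (annop_den xs) x \<noteq> 0" "baker_tilde W x = Fract (baker_num xs x) (conds_poly xs)"
proof -
  have uniq: "\<exists>!r. \<exists>p. r = Fract p (conds_poly xs) \<and> (\<forall>(l, u) \<in> set xs. pairing l u x p = 0) \<and>
       degree p \<le> length xs \<and> coeff p (length xs) = 1"
    using ex unfolding baker_tilde_exists_def baker_candidates[OF W] .
  show den: "poly (annop_den xs) x \<noteq> 0"
  proof
    assume den: "poly (annop_den xs) x = 0"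
    then obtain i where i: "poly (coeff (annop_num xs) i) x \<noteq> 0" using annop_num_primitive by blast
    \<comment> \<open>Minimality of the denominator gives a non-zero \<open>e\<close> of degree
      below \<open>length xs\<close> satisfying all conditions at x. Adding it to one Baker
      numerator produces another, against uniqueness.\<close>
    define e where "e = eval_op (annop_num xs) x"
    have e0: "e \<noteq> 0" using i unfolding e_def by (metis coeff_0 coeff_eval_op)
    have e: "degree e \<le> length xs" "coeff e (length xs) = 0"
      using degree_eval_op_le[of "annop_num xs" x] den by (simp_all add: e_def)
    obtain p where p: "\<forall>(l, u) \<in> set xs. pairing l u x p = 0" "degree p \<le> length xs" "coeff p (length xs) = 1"
      using uniq by blast
    have "\<forall>(l, u) \<in> set xs. pairing l u x (p + e) = 0"
      using p(1) by (auto simp: pairing_add_right e_def pairing_eval_annop_num)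
    moreover have "degree (p + e) \<le> length xs" using p e by (intro degree_add_le)
    moreover have "coeff (p + e) (length xs) = 1" using p e by simp
    ultimately have "Fract (p + e) (conds_poly xs) = Fract p (conds_poly xs)"
      using p uniq by blast
    thus False using e0 by (simp add: Fract_eq_iff_same)
  qed
  have "Fract (baker_num xs x) (conds_poly xs) \<in> gamma_act [:0, -x:] W \<and>
     one_plus_O (Fract (baker_num xs x) (conds_poly xs))"
    unfolding baker_candidates[OF W] using baker_num_candidate[OF den] by blast
  thus "baker_tilde W x = Fract (baker_num xs x) (conds_poly xs)"
    unfolding baker_tilde_def using ex unfolding baker_tilde_exists_def by (rule the1_equality[rotated])
qed

lemma baker_tilde_exists_cofinite:
  assumes W: "grass_conds W xs"
  shows "finite {x. \<not> baker_tilde_exists W x}"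
proof -
  define B where "B = {x. \<exists>p. p \<noteq> 0 \<and> degree p < length xs \<and> (\<forall>(l, u) \<in> set xs. pairing l u x p = 0)}"
  have "baker_tilde_exists W x" if x: "poly (annop_den xs) x \<noteq> 0" "x \<notin> B" for x
    unfolding baker_tilde_exists_def baker_candidates[OF W]
  proof (rule ex1I)
    show "\<exists>p. Fract (baker_num xs x) (conds_poly xs) = Fract p (conds_poly xs) \<and>
      (\<forall>(l, u) \<in> set xs. pairing l u x p = 0) \<and> degree p \<le> length xs \<and> coeff p (length xs) = 1"
      using baker_num_candidate[OF x(1)] by blast
  next
    fix r assume "\<exists>p. r = Fract p (conds_poly xs) \<and>
      (\<forall>(l, u) \<in> set xs. pairing l u x p = 0) \<and> degree p \<le> length xs \<and> coeff p (length xs) = 1"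
    then obtain p where p: "r = Fract p (conds_poly xs)" "\<forall>(l, u) \<in> set xs. pairing l u x p = 0"
      "degree p \<le> length xs" "coeff p (length xs) = 1" by blast
    define d where "d = p - baker_num xs x"
    have "d = 0"
    proof (rule ccontr)
      assume d0: "d \<noteq> 0"
      have "\<forall>(l, u) \<in> set xs. pairing l u x d = 0"
        using p(2) baker_num_candidate[OF x(1)] unfolding d_def pairing_diff_right by fastforce
      moreover have "degree d \<le> length xs" "coeff d (length xs) = 0"
        using p baker_num_candidate[OF x(1)] by (auto simp: d_def intro: degree_diff_le)
      hence "degree d < length xs" using d0 by (metis le_neq_implies_less leading_coeff_0_iff)
      ultimately show False using x(2) d0 by (auto simp: B_def)
    qed
    thus "r = Fract (baker_num xs x) (conds_poly xs)" using p(1) by (simp add: d_def)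
  qed
  hence "{x. \<not> baker_tilde_exists W x} \<subseteq> {x. poly (annop_den xs) x = 0} \<union> B" by blast
  moreover have "finite B" unfolding B_def
    by (rule conditions_imp_zero) (use W in \<open>simp add: grass_conds_def\<close>)
  ultimately show ?thesis
    using poly_roots_finite[OF annop_den_nonzero] by (meson finite_UnI finite_subset)
qed

subsection \<open>The ideals of operators attached to a point\<close>

text \<open>m D maps polynomials into V, so it has polynomial coefficients and can be transposed.
  The conditions vanish on its image, hence b(m D) kills every e^(lx) u and is divisible by
  L.\<close>

lemma R_of_conds:
  assumes W: "grass_conds W xs" and D: "D \<in> R_of W"
  shows "\<exists>E T. smult (ratpoly (conds_poly xs)) D = dop_of E \<and> dop_of (swap_op E) = dop_mult T (annop xs)"
proof -
  define m where "m = conds_poly xs"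
  have *: "\<exists>v\<in>conds_space xs. act 0 (smult (ratpoly m) D) (ratpoly f) = ratpoly v" for f
  proof -
    have "act 0 D (ratpoly f) \<in> W" using D by (simp add: R_of_def dop_apply_eq_act)
    then obtain v where "v \<in> conds_space xs" "act 0 D (ratpoly f) = Fract v m"
      using W unfolding grass_conds_def m_def by blast
    thus ?thesis by (intro bexI[of _ v]) (auto simp: act_smult Fract_eq_divide m_def)
  qed
  hence "smult (ratpoly m) D \<in> weyl" by (intro weylI) (metis rangeI)
  then obtain E where E: "smult (ratpoly m) D = dop_of E" by (auto simp: weyl_eq)
  have "pairing l u 0 (pact 0 E f) = 0" if "(l, u) \<in> set xs" for l u f
    using *[of f] that by (auto simp: E conds_space_iff)
  hence "pact l (swap_op E) u = 0" if "(l, u) \<in> set xs" for l u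
    using that by (intro pairing_nondegenerate[of l _ 0]) (simp flip: pairing_transpose)
  hence "\<exists>T. dop_of (swap_op E) = dop_mult T (annop xs)"
    using W by (intro annop_divides) (simp_all add: grass_conds_def)
  thus ?thesis using E by (auto simp: m_def)
qed

lemma conds_R_of:
  assumes W: "grass_conds W xs" and E: "smult (ratpoly (conds_poly xs)) D = dop_of E"
    and T: "dop_of (swap_op E) = dop_mult T (annop xs)"
  shows "D \<in> R_of W"
proof -
  have "act 0 D (ratpoly f) \<in> W" for f
  proof -
    have "ratpoly (pact l (swap_op E) u) = 0" if "(l, u) \<in> set xs" for l u
      using that by (simp only: act_dop_of[symmetric] T act_dop_mult act_annop_eq_0 act_0_right)
    hence "pact l (swap_op E) u = 0" if "(l, u) \<in> set xs" for l u
      using that by simp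
    hence "pact 0 E f \<in> conds_space xs" by (simp add: conds_space_iff pairing_transpose)
    moreover have "ratpoly (conds_poly xs) * act 0 D (ratpoly f) = ratpoly (pact 0 E f)"
      using act_dop_of[of 0 E f] by (simp add: E[symmetric] act_smult)
    hence "act 0 D (ratpoly f) = Fract (pact 0 E f) (conds_poly xs)"
      by (simp add: Fract_eq_divide field_simps)
    ultimately show ?thesis using W by (auto simp: grass_conds_def)
  qed
  thus ?thesis by (simp add: R_of_def dop_apply_eq_act)
qed

text \<open>The two operators are m^-1 b(q L) and multiplication by M/m. Consequently R_W determines
  W, on which the uniqueness of the dual point rests.\<close>

lemma grass_generated_by_R_of:
  assumes W: "grass_conds W xs" and w: "w \<in> W"
  shows "\<exists>D1\<in>R_of W. \<exists>D2\<in>R_of W. \<exists>g h. w = act 0 D1 (ratpoly g) + act 0 D2 (ratpoly h)"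
proof -
  define m where "m = conds_poly xs"
  have xs: "indep_conds xs" using W by (simp add: grass_conds_def)
  obtain v where v: "v \<in> conds_space xs" "w = Fract v m" using W w by (auto simp: grass_conds_def m_def)
  obtain M where M: "M \<noteq> 0" "\<And>h. M * h \<in> conds_space xs" using conds_space_contains_ideal by blast
  obtain g h where gh: "v = pact 0 (swap_op (annop_num xs)) g + M * h"
    using conds_space_generators[OF xs M v(1)] by blast
  define D1 where "D1 = smult (inverse (ratpoly m)) (dop_of (swap_op (annop_num xs)))"
  define D2 where "D2 = [:ratpoly M / ratpoly m:]"
  have "act 0 D1 (ratpoly f) = Fract (pact 0 (swap_op (annop_num xs)) f) m" for f
    by (simp add: D1_def act_smult Fract_eq_divide field_simps)
  hence "D1 \<in> R_of W"
    using W swap_num_maps_into_conds_space[OF xs] by (simp add: R_of_def dop_apply_eq_act grass_conds_def m_def)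
  moreover have d2: "act 0 D2 (ratpoly f) = Fract (M * f) m" for f
    by (simp add: D2_def Fract_eq_divide ratpoly_mult)
  hence "D2 \<in> R_of W"
    using W M(2) by (simp add: R_of_def dop_apply_eq_act grass_conds_def m_def)
  moreover have "w = act 0 D1 (ratpoly g) + act 0 D2 (ratpoly h)"
    by (simp add: d2 v(2) gh D1_def act_smult Fract_eq_divide ratpoly_add add_divide_distrib field_simps)
  ultimately show ?thesis by blast
qed

lemma grass_closed:
  assumes "grass_conds W xs"
  shows "a \<in> W \<Longrightarrow> b \<in> W \<Longrightarrow> a + b \<in> W"
proof -
  assume "a \<in> W" "b \<in> W"
  then obtain v v' where "v \<in> conds_space xs" "v' \<in> conds_space xs"
    "a = Fract v (conds_poly xs)" "b = Fract v' (conds_poly xs)"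
    using assms by (auto simp: grass_conds_def)
  moreover from this have "a + b = Fract (v + v') (conds_poly xs)"
    by (simp add: Fract_eq_divide ratpoly_add add_divide_distrib)
  ultimately show "a + b \<in> W"
    using assms conds_space_subspace(2)[of v xs v'] by (auto simp: grass_conds_def)
qed

lemma R_of_determines:
  assumes "grass_conds W xs" "grass_conds W' xs'" "R_of W \<subseteq> R_of W'"
  shows "W \<subseteq> W'"
proof
  fix w assume "w \<in> W"
  then obtain D1 D2 g h where D: "D1 \<in> R_of W" "D2 \<in> R_of W" "w = act 0 D1 (ratpoly g) + act 0 D2 (ratpoly h)"
    using grass_generated_by_R_of[OF assms(1)] by blast
  hence "act 0 D1 (ratpoly g) \<in> W'" "act 0 D2 (ratpoly h) \<in> W'"
    using assms(3) by (auto simp: R_of_def dop_apply_eq_act)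
  thus "w \<in> W'" unfolding D(3) by (rule grass_closed[OF assms(2)])
qed

subsection \<open>Construction of the bispectral dual\<close>

lemma degree_dpoly_funpow_le: "degree ((dpoly t ^^ i) y) \<le> degree y"
proof (induction i)
  case (Suc i)
  have "degree (dpoly t f) \<le> degree f" for f
    unfolding dpoly_def by (intro degree_add_le) (simp_all add: degree_pderiv)
  from order_trans[OF this Suc] show ?case by simp
qed simp

lemma coeff_dpoly_funpow: "coeff ((dpoly t ^^ i) y) (degree y) = t ^ i * lead_coeff y"
proof (induction i)
  case (Suc i)
  have "coeff ((dpoly t ^^ i) y) (Suc (degree y)) = 0"
    using degree_dpoly_funpow_le[of i t y] by (simp add: coeff_eq_0)
  thus ?case using Suc by (simp add: dpoly_def[of _ "(dpoly t ^^ i) y"] coeff_pderiv)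
qed simp

text \<open>At infinity q L_t behaves like z^(deg q) m(d + t), so it raises the degree by deg q and
  multiplies the leading coefficient by m(t), which is non-zero.\<close>

lemma degree_pact_annop_num_ge:
  assumes "y \<noteq> 0" "t \<notin> fst ` set xs"
  shows "degree (annop_den xs) \<le> degree (pact t (annop_num xs) y)"
proof -
  define d where "d = degree (annop_den xs)"
  have "coeff (pact t (annop_num xs) y) (d + degree y) =
      (\<Sum>i\<le>length xs. coeff (conds_poly xs) i * (t ^ i * lead_coeff y))"
    unfolding pact_def coeff_sum
    by (intro sum.cong) (simp_all add: coeff_mult_degree_le coeff_annop_num_infinity d_def
        degree_dpoly_funpow_le coeff_dpoly_funpow)
  also have "\<dots> = poly (conds_poly xs) t * lead_coeff y"
    by (simp add: poly_altdef sum_distrib_right mult.assoc)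
  also have "\<dots> \<noteq> 0" using assms by (simp add: poly_conds_poly_eq_0_iff)
  finally have "d + degree y \<le> degree (pact t (annop_num xs) y)" by (rule le_degree)
  thus ?thesis by (simp add: d_def)
qed

lemma degree_dop_mult_d_left:
  assumes "X \<noteq> 0"
  shows "degree (dop_mult [:0, 1:] X) = Suc (degree X)" "lead_coeff (dop_mult [:0, 1:] X) = lead_coeff X"
proof -
  have c: "coeff (dop_mult [:0, 1:] X) (Suc n) = coeff X n + ratfun_deriv (coeff X (Suc n))" for n
    by (simp add: dop_mult_d_left coeff_map_poly)
  have "degree (dop_mult [:0, 1:] X) \<le> Suc (degree X)"
  proof (rule degree_le, safe)
    fix i assume "i > Suc (degree X)"
    then obtain n where "i = Suc n" "n > degree X" by (metis Suc_lessE)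
    thus "coeff (dop_mult [:0, 1:] X) i = 0" by (simp add: c coeff_eq_0)
  qed
  moreover have l: "coeff (dop_mult [:0, 1:] X) (Suc (degree X)) = lead_coeff X"
    by (simp add: c coeff_eq_0)
  hence "Suc (degree X) \<le> degree (dop_mult [:0, 1:] X)" using assms by (intro le_degree) simp
  ultimately show d: "degree (dop_mult [:0, 1:] X) = Suc (degree X)" by simp
  show "lead_coeff (dop_mult [:0, 1:] X) = lead_coeff X" using l by (simp add: d)
qed

lemma degree_dop_mult:
  assumes "T \<noteq> 0" "X \<noteq> 0"
  shows "degree (dop_mult T X) = degree T + degree X \<and>
    lead_coeff (dop_mult T X) = lead_coeff T * lead_coeff X"
  using assms
proof (induction T arbitrary: X)
  case (pCons a T)
  have e: "dop_mult (pCons a T) X = smult a X + dop_mult T (dop_mult [:0, 1:] X)"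
    by (rule dop_mult_pCons_left)
  show ?case
  proof (cases "T = 0")
    case True
    thus ?thesis using pCons.prems by (simp add: lead_coeff_smult)
  next
    case False
    define Y where "Y = dop_mult [:0, 1:] X"
    have Y: "degree Y = Suc (degree X)" "lead_coeff Y = lead_coeff X"
      using degree_dop_mult_d_left[OF pCons.prems(2)] by (simp_all add: Y_def)
    hence "Y \<noteq> 0" by auto
    hence IH: "degree (dop_mult T Y) = degree T + degree Y"
      "lead_coeff (dop_mult T Y) = lead_coeff T * lead_coeff Y"
      using pCons.IH[OF False, of Y] by blast+
    have lt: "degree (smult a X) < degree (dop_mult T Y)"
      using degree_smult_le[of a X] IH Y by simp
    show ?thesis unfolding e Y_def[symmetric]
      using IH Y False lt by (simp add: degree_add_eq_right lead_coeff_add_le coeff_eq_0)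
  qed
qed simp

abbreviation const_dop :: "complex poly \<Rightarrow> diffop" where
  "const_dop p \<equiv> dop_of (const_op p)"

text \<open>A factor d on the right only shifts coefficients, so composition with g(d) from the
  right is the commutative polynomial product. This is why such products are written with
  \<open>*\<close> from here on.\<close>

lemma dop_mult_times_const_dop: "dop_mult T X * const_dop g = dop_mult T (X * const_dop g)"
proof (induction g)
  case (pCons c g)
  have a: "Y * const_dop (pCons c g) = smult (rconst c) Y + dop_mult (Y * const_dop g) [:0, 1:]" for Y
    by (simp add: const_op_pCons dop_of_pCons dop_mult_d_right)
  show ?case
    unfolding a pCons.IH dop_mult_add_right dop_mult_const_right[symmetric] dop_mult_assoc ..
qed simp

lemma coeff_swap_annop_num_degree:
  "coeff (swap_op (annop_num xs)) (degree (annop_den xs)) = conds_poly xs"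
  by (rule poly_eqI) (simp add: coeff_annop_num_infinity)

lemma degree_swap_annop_num: "degree (swap_op (annop_num xs)) = degree (annop_den xs)"
proof (rule antisym)
  show "degree (swap_op (annop_num xs)) \<le> degree (annop_den xs)"
  proof (rule degree_le, safe)
    fix i assume "degree (annop_den xs) < i"
    hence "degree (coeff (annop_num xs) j) < i" for j
      using coeff_annop_num_infinity(1)[of xs j] by simp
    thus "coeff (swap_op (annop_num xs)) i = 0" by (intro poly_eqI) (simp add: coeff_eq_0)
  qed
  show "degree (annop_den xs) \<le> degree (swap_op (annop_num xs))"
    by (rule le_degree) (simp add: coeff_swap_annop_num_degree)
qed

text \<open>The conditions cutting out \<open>q L\<^sub>t.\<complex>[z]\<close>, with \<open>L\<^sub>t = e\<^sup>-\<^sup>t\<^sup>z L e\<^sup>t\<^sup>z\<close>, become conditions satisfied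
  by \<open>V'\<close> after translating the polynomials \<open>u\<close> by \<open>t\<close>; hence the numerator of the Baker
  function of \<open>V'\<close> at \<open>x = t\<close> lies in \<open>q L\<^sub>t.\<complex>[z]\<close>, whose elements have degree at least \<open>deg q\<close>.\<close>

lemma degree_annop_den_le_codim:
  assumes xs: "indep_conds xs" and ws: "indep_conds ws"
    and V: "conds_space ws = {pact 0 (annop_num xs) g + annop_den xs * f * h | g h. True}"
    and f: "f \<noteq> 0" "\<And>x g. x \<notin> fst ` set xs \<Longrightarrow> \<exists>y. act x (annop xs) (ratpoly y) = ratpoly (f * g)"
  shows "degree (annop_den xs) \<le> length ws"
proof -
  define M where "M = annop_den xs * f"
  have M0: "M \<noteq> 0" using f(1) by (simp add: M_def)
  have "finite (fst ` set xs \<union> {t. poly (annop_den ws) t = 0})"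
    by (simp add: poly_roots_finite)
  \<comment> \<open>\<open>t\<close> avoids the points of \<open>xs\<close>, for the degree bound
    and for solvability, and the roots of \<open>annop_den ws\<close>, so that \<open>p\<close>
    below has a non-zero coefficient in degree \<open>length ws\<close>.\<close>
  then obtain t where t: "t \<notin> fst ` set xs" "poly (annop_den ws) t \<noteq> 0"
    using ex_new_if_finite[OF infinite_UNIV_char_0] by blast
  define U where "U = {pact t (annop_num xs) g + M * h | g h. True}"
  have "primary_decomposable U" unfolding U_def by (rule primary_decomposable_operator_image[OF M0])
  then obtain ys where ys: "conds_space ys = U" using primary_decomposable_conds by blast
  define p where "p = eval_op (annop_num ws) t"
  have "pairing l y 0 p = 0" if y: "(l, y) \<in> set ys" for l y
  proof -
    define y' where "y' = pcompose y [:-t, 1:]"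
    have y': "pairing l y' t q = pairing l y 0 q" for q
      using pairing_pcompose_shift[of l y "-t" t q] by (simp add: y'_def)
    have U0: "pairing l y 0 u = 0" if "u \<in> U" for u
      using that y unfolding ys[symmetric] by (simp add: conds_space_iff)
    have "pairing l (pact l (swap_op (annop_num xs)) y') t g = 0" for g
    proof -
      have "pact t (annop_num xs) g = pact t (annop_num xs) g + M * 0" by simp
      hence "pact t (annop_num xs) g \<in> U" unfolding U_def by blast
      thus ?thesis using U0 by (simp add: y' flip: pairing_transpose)
    qed
    hence 1: "pact l (swap_op (annop_num xs)) y' = 0" by (rule pairing_nondegenerate)
    have "pairing l (pact l (const_op M) y') t h = 0" for h
    proof -
      have "M * h = pact t (annop_num xs) 0 + M * h" by simp
      hence "M * h \<in> U" unfolding U_def by blast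
      thus ?thesis using U0 by (simp add: y' flip: pairing_mult_right)
    qed
    hence 2: "pact l (const_op M) y' = 0" by (rule pairing_nondegenerate)
    \<comment> \<open>The facts \<open>1\<close> and \<open>2\<close> do not involve the spectral
      value, so \<open>y'\<close> also kills the generators of \<open>conds_space ws\<close>, which
      live at the value 0.\<close>
    have perp: "pairing l y' 0 v = 0" if v: "v \<in> conds_space ws" for v
    proof -
      obtain g h where "v = pact 0 (annop_num xs) g + M * h"
        using v unfolding V M_def by blast
      thus ?thesis by (simp add: pairing_add_right pairing_transpose pairing_mult_right 1 2)
    qed
    have "pairing l (pact l (annop_num ws) y') 0 g = 0" for g
      using perp[OF swap_num_maps_into_conds_space[OF ws]] by (simp add: pairing_transpose)
    hence "act l (annop ws) (ratpoly y') = 0"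
      using pairing_nondegenerate pact_annop_num_eq_0_iff by blast
    hence "pairing l y' t p = 0"
      by (rule annop_kernel[OF ws, where F = "\<lambda>u. pairing l u t p"])
        (simp_all add: pairing_add pairing_smult p_def pairing_eval_annop_num)
    thus ?thesis by (simp add: y')
  qed
  hence "p \<in> U" unfolding ys[symmetric] by (simp add: conds_space_iff)
  then obtain g h where p: "p = pact t (annop_num xs) g + M * h" unfolding U_def by blast
  \<comment> \<open>Trivial monodromy absorbs the ideal part: \<open>M * h\<close> is itself q L_t
    y, so \<open>p\<close> lies in the image of q L_t.\<close>
  obtain y where y: "act t (annop xs) (ratpoly y) = ratpoly (f * h)" using f(2)[OF t(1)] by blast
  have "ratpoly (pact t (annop_num xs) y) = ratpoly (M * h)"
    unfolding act_dop_of[symmetric] act_annop_num y by (simp add: M_def ratpoly_mult)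
  hence "p = pact t (annop_num xs) (g + y)" by (simp add: p pact_add_right)
  moreover have "coeff p (length ws) \<noteq> 0" using t(2) by (simp add: p_def)
  hence "p \<noteq> 0" by auto
  ultimately have "degree (annop_den xs) \<le> degree p"
    using degree_pact_annop_num_ge[OF _ t(1)] by (metis pact_0_right)
  also have "\<dots> \<le> length ws" using degree_eval_op_le[of "annop_num ws" t] by (simp add: p_def)
  finally show ?thesis .
qed

text \<open>The identity is K' = b(K), that is L' b(m')^-1 = m^-1 b(L) with primes for the dual
  point, multiplied by m on the left and by b(m') b(q) on the right.\<close>

theorem bispectral_dual_exists:
  assumes xs: "indep_conds xs"
  shows "\<exists>W' xs'. W' \<in> Gr_ad \<and> grass_conds W' xs' \<and>
    smult (ratpoly (conds_poly xs)) (annop xs') * const_dop (annop_den xs) =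
    dop_of (swap_op (annop_num xs)) * const_dop (conds_poly xs')"
proof -
  define q where "q = annop_den xs"
  define m where "m = conds_poly xs"
  obtain f where f: "f \<noteq> 0" "\<And>x g. x \<notin> fst ` set xs \<Longrightarrow> \<exists>y. act x (annop xs) (ratpoly y) = ratpoly (f * g)"
    using annop_image_contains_ideal[OF xs] by blast
  define V where "V = {pact 0 (annop_num xs) g + annop_den xs * f * h | g h. True}"
  have pd: "primary_decomposable V" unfolding V_def
    by (rule primary_decomposable_operator_image) (simp add: f(1))
  then obtain ws where ws: "indep_conds ws" "conds_space ws = V" "conds_poly ws = m_poly V"
    using primary_decomposable_conds by blast
  have len: "degree q \<le> length ws" unfolding q_def
    by (rule degree_annop_den_le_codim[OF xs ws(1) _ f]) (simp_all add: ws V_def)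
  define W' where "W' = (\<lambda>p. Fract p (m_poly V)) ` V"
  have W': "W' \<in> Gr_ad" using pd by (auto simp: Gr_ad_def grad_rep_def W'_def)
  then obtain xs' where xs': "grass_conds W' xs'" using Gr_ad_conds by blast
  \<comment> \<open>Two lists describe \<open>W'\<close>: \<open>ws\<close> comes from the
    constructed space \<open>V\<close>, \<open>xs'\<close> from the representative underlying
    \<open>gamma_act\<close>. Their polynomials \<open>m'\<close> and \<open>m''\<close> are kept
    apart.\<close>
  define m' where "m' = conds_poly ws"
  define m'' where "m'' = conds_poly xs'"
  define D where "D = smult (inverse (ratpoly m')) (dop_of (annop_num xs))"
  have "D \<in> R_of W'"
  proof -
    have "act 0 D (ratpoly g) \<in> W'" for g
    proof -
      have "pact 0 (annop_num xs) g = pact 0 (annop_num xs) g + annop_den xs * f * 0" by simp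
      hence "pact 0 (annop_num xs) g \<in> V" unfolding V_def by blast
      moreover have "act 0 D (ratpoly g) = Fract (pact 0 (annop_num xs) g) (m_poly V)"
        by (simp add: D_def act_smult Fract_eq_divide m'_def ws(3) field_simps)
      ultimately show ?thesis by (simp add: W'_def)
    qed
    thus ?thesis by (simp add: R_of_def dop_apply_eq_act)
  qed
  then obtain E T where E: "smult (ratpoly m'') D = dop_of E" and
    T: "dop_of (swap_op E) = dop_mult T (annop xs')"
    using R_of_conds[OF xs'] unfolding m''_def by blast
  have "dop_of (smult m' E) = dop_of (smult m'' (annop_num xs))"
    unfolding dop_of_smult E[symmetric] D_def by (simp add: m'_def field_simps)
  hence "smult m' E = smult m'' (annop_num xs)" by simp
  hence "const_op m' * swap_op E = const_op m'' * swap_op (annop_num xs)"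
    by (simp flip: swap_op_smult)
  hence "const_dop m' * dop_mult T (annop xs') = const_dop m'' * dop_of (swap_op (annop_num xs))"
    unfolding T[symmetric] dop_of_mult[symmetric] by simp
  hence rel: "dop_mult T (annop xs' * const_dop m') = dop_of (swap_op (annop_num xs)) * const_dop m''"
    unfolding dop_mult_times_const_dop[symmetric] by (simp add: mult.commute)
  have nz: "annop xs' * const_dop m' \<noteq> 0" "dop_of (swap_op (annop_num xs)) * const_dop m'' \<noteq> 0"
    using swap_op_swap_op[of "annop_num xs"] annop_num_nonzero[of xs]
    by (auto simp: m'_def m''_def simp del: swap_op_swap_op)
  have T0: "T \<noteq> 0" using rel nz by auto
  have d1: "degree (annop xs' * const_dop m') = length xs' + length ws"
    using nz(1) by (auto simp: degree_mult_eq m'_def)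
  have l1: "lead_coeff (annop xs' * const_dop m') = 1"
    by (subst lead_coeff_mult) (simp add: m'_def)
  have d2: "degree (dop_of (swap_op (annop_num xs)) * const_dop m'') = degree q + length xs'"
    using nz(2) by (auto simp: degree_mult_eq degree_swap_annop_num m''_def q_def)
  have l2: "lead_coeff (dop_of (swap_op (annop_num xs)) * const_dop m'') = ratpoly m"
    by (subst lead_coeff_mult)
      (simp add: degree_swap_annop_num coeff_swap_annop_num_degree m''_def m_def)
  \<comment> \<open>Orders in \<open>rel\<close> give deg T + length ws = deg q, so the bound
    \<open>len\<close> leaves only order 0 for \<open>T\<close>; leading coefficients then identify
    \<open>T\<close> with m.\<close>
  have "degree T = 0" "length ws = degree q"
    using degree_dop_mult[OF T0 nz(1)] d1 d2 rel len by auto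
  moreover have "lead_coeff T = ratpoly m"
    using degree_dop_mult[OF T0 nz(1)] l1 l2 rel by auto
  ultimately have T: "T = [:ratpoly m:]" by (metis degree_eq_zeroE lead_coeff_pCons(2) coeff_pCons_0 degree_pCons_0)
  have rel': "smult (ratpoly m) (annop xs') * const_dop m' = dop_of (swap_op (annop_num xs)) * const_dop m''"
    using rel by (simp add: T)
  \<comment> \<open>Limits at infinity of both sides: L' tends to m''(d), and m^-1 b(q L) tends to
    q(d), because q is the leading coefficient of q L. Cancelling m'' identifies m' with q.\<close>
  have "m'' * m' = q * m''"
  proof (rule poly_eqI)
    fix i
    have c: "lim_infinity (coeff (const_dop g) j) (coeff g j)" for g j by simp
    have "annop xs' * const_dop m' = smult (inverse (ratpoly m)) (dop_of (swap_op (annop_num xs))) * const_dop m''"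
      using arg_cong[OF rel', of "smult (inverse (ratpoly m))"] by (simp add: m_def)
    moreover have "lim_infinity (coeff (annop xs' * const_dop m') i) (coeff (m'' * m') i)"
      unfolding m''_def by (intro lim_infinity_coeff_mult lim_infinity_coeff_annop c)
    moreover have "lim_infinity (coeff (smult (inverse (ratpoly m)) (dop_of (swap_op (annop_num xs)))) j) (coeff q j)" for j
    proof -
      have e: "coeff (smult (inverse (ratpoly m)) (dop_of (swap_op (annop_num xs)))) j =
          Fract (coeff (swap_op (annop_num xs)) j) m"
        by (simp add: Fract_eq_divide field_simps)
      have "degree (coeff (swap_op (annop_num xs)) j) \<le> length xs"
        by (rule degree_le) (simp add: coeff_eq_0)
      thus ?thesis unfolding lim_infinity_def e
        by (intro exI[of _ "coeff (swap_op (annop_num xs)) j"] exI[of _ m]) (simp add: m_def q_def)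
    qed
    hence "lim_infinity (coeff (smult (inverse (ratpoly m)) (dop_of (swap_op (annop_num xs))) * const_dop m'') i)
       (coeff (q * m'') i)" by (intro lim_infinity_coeff_mult c)
    ultimately show "coeff (m'' * m') i = coeff (q * m'') i" using lim_infinity_unique by metis
  qed
  hence "m' = q" by (simp add: m''_def)
  thus ?thesis using rel' xs' W' unfolding m_def q_def m''_def by blast
qed

section \<open>Equality of the Baker functions of a point and its dual\<close>

lemma eval_op_mult: "eval_op (P * Q) x = eval_op P x * eval_op Q x"
  by (rule poly_eqI) (simp add: coeff_mult poly_sum)

lemma eval_op_const_op [simp]: "eval_op (const_op g) x = g"
  by (rule poly_eqI) simp

lemma eval_op_smult: "eval_op (smult p Q) x = smult (poly p x) (eval_op Q x)"
  by (rule poly_eqI) simp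

lemma eval_op_add: "eval_op (P + Q) x = eval_op P x + eval_op Q x"
  by (rule poly_eqI) simp

lemma poly_eval_swap_op: "poly (eval_op (swap_op P) x) z = poly (eval_op P z) x"
proof (induction P)
  case (pCons a P)
  have "eval_op (pCons a P) z = pCons (poly a z) (eval_op P z)"
    by (rule poly_eqI) (simp add: coeff_pCons split: nat.splits)
  thus ?case using pCons.IH by (simp add: swap_op_pCons eval_op_add eval_op_smult)
qed (simp add: eval_op_def)

text \<open>Descending recursion: the coefficient of order i + deg g of D g(d) is a non-zero
  constant times \<open>coeff D i\<close> plus constant multiples of higher coefficients of
  \<open>D\<close>. \<open>A\<close> will be the polynomials, or the multiples of a fixed
  polynomial.\<close>

lemma const_dop_factor_coeffs:
  assumes A: "0 \<in> A" "\<And>a b. a \<in> A \<Longrightarrow> b \<in> A \<Longrightarrow> a - b \<in> A" "\<And>c a. a \<in> A \<Longrightarrow> rconst c * a \<in> A"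
    and g: "g \<noteq> 0" and P: "\<And>i. coeff (D * const_dop g) i \<in> A"
  shows "coeff D i \<in> A"
proof (induction "degree D - i" arbitrary: i rule: less_induct)
  case less
  show ?case
  proof (cases "i \<le> degree D")
    case False
    thus ?thesis using A(1) by (simp add: coeff_eq_0)
  next
    case True
    define d where "d = degree g"
    have add: "a + b \<in> A" if "a \<in> A" "b \<in> A" for a b
      using A(2)[OF that(1) A(2)[OF A(1) that(2)]] by simp
    have sumA: "sum f S \<in> A" if "\<And>s. s \<in> S \<Longrightarrow> f s \<in> A" for f and S :: "nat set"
      using that by (induction S rule: infinite_finite_induct) (auto simp: A(1) add)
    have "coeff (D * const_dop g) (i + d) =
       (\<Sum>k\<le>i + d. coeff D k * rconst (coeff g (i + d - k)))"
      by (simp add: coeff_mult)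
    also have "\<dots> = coeff D i * rconst (coeff g d) +
       (\<Sum>k\<in>{..i + d} - {i}. coeff D k * rconst (coeff g (i + d - k)))"
      by (subst sum.remove[of _ i]) simp_all
    finally have e: "rconst (lead_coeff g) * coeff D i = coeff (D * const_dop g) (i + d) -
       (\<Sum>k\<in>{..i + d} - {i}. coeff D k * rconst (coeff g (i + d - k)))"
      by (simp add: d_def mult.commute)
    have "coeff D k * rconst (coeff g (i + d - k)) \<in> A" if "k \<in> {..i + d} - {i}" for k
    proof (cases "k < i")
      case True
      hence "coeff g (i + d - k) = 0" by (intro coeff_eq_0) (simp add: d_def)
      thus ?thesis using A(1) by simp
    next
      case False
      hence k: "i < k" using that by auto
      have "coeff D k \<in> A"
      proof (cases "k \<le> degree D")
        case True
        thus ?thesis using k by (intro less.hyps) simp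
      qed (simp add: coeff_eq_0 A(1))
      thus ?thesis using A(3) by (simp add: mult.commute)
    qed
    hence "rconst (lead_coeff g) * coeff D i \<in> A" unfolding e by (intro A(2) P sumA)
    hence "rconst (inverse (lead_coeff g)) * (rconst (lead_coeff g) * coeff D i) \<in> A" by (rule A(3))
    moreover have "rconst (inverse (lead_coeff g)) * rconst (lead_coeff g) = 1"
      using g by (simp flip: rconst_mult)
    ultimately show ?thesis by (metis mult.assoc mult_1)
  qed
qed

lemma weyl_if_times_const_dop:
  assumes "g \<noteq> 0" "D * const_dop g \<in> weyl"
  shows "D \<in> weyl"
proof -
  have "coeff D i \<in> range ratpoly" for i
  proof (rule const_dop_factor_coeffs[OF _ _ _ assms(1)])
    show "0 \<in> range ratpoly" by (metis ratpoly_0 rangeI)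
    show "a - b \<in> range ratpoly" if "a \<in> range ratpoly" "b \<in> range ratpoly" for a b
      using that by (auto simp flip: ratpoly_diff)
    show "rconst c * a \<in> range ratpoly" if "a \<in> range ratpoly" for c a
      using that by (auto simp flip: ratpoly_mult)
    show "coeff (D * const_dop g) i \<in> range ratpoly" for i
      using assms(2) by (auto simp: weyl_def)
  qed
  thus ?thesis by (auto simp: weyl_def)
qed

lemma smult_factor_if_times_const_op:
  assumes "g \<noteq> 0" "\<And>i. s dvd coeff (P * const_op g) i"
  shows "\<exists>Q. P = smult s Q"
proof -
  define A where "A = ratpoly ` {p. s dvd p}"
  have "coeff (dop_of P) i \<in> A" for i
  proof (rule const_dop_factor_coeffs[OF _ _ _ assms(1)])
    show "0 \<in> A" unfolding A_def by (rule image_eqI[of _ _ 0]) simp_all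
    show "a - b \<in> A" if "a \<in> A" "b \<in> A" for a b
      using that unfolding A_def by (auto simp flip: ratpoly_diff)
    show "rconst c * a \<in> A" if "a \<in> A" for c a
      using that unfolding A_def by (auto simp flip: ratpoly_mult intro!: imageI dvd_smult)
    show "coeff (dop_of P * const_dop g) i \<in> A" for i
      using assms(2)[of i] unfolding A_def by (simp flip: dop_of_mult)
  qed
  hence "s dvd coeff P i" for i unfolding A_def by fastforce
  hence "P = smult s (map_poly (\<lambda>a. a div s) P)"
    by (intro poly_eqI) (simp add: coeff_map_poly)
  thus ?thesis by blast
qed

lemma ratfun_eval_Fract:
  assumes "poly q z \<noteq> 0"
  shows "ratfun_eval (Fract p q) z = poly p z / poly q z"
  unfolding ratfun_eval_def
proof (rule some_equality)
  show "\<exists>p' q'. Fract p q = Fract p' q' \<and> poly q' z \<noteq> 0 \<and> poly p z / poly q z = poly p' z / poly q' z"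
    using assms by blast
next
  fix v assume "\<exists>p' q'. Fract p q = Fract p' q' \<and> poly q' z \<noteq> 0 \<and> v = poly p' z / poly q' z"
  then obtain p' q' where *: "Fract p q = Fract p' q'" "poly q' z \<noteq> 0" "v = poly p' z / poly q' z"
    by blast
  hence "p * q' = p' * q" using assms by (subst (asm) eq_fract) auto
  hence "poly p z * poly q' z = poly p' z * poly q z" by (metis poly_mult)
  thus "v = poly p z / poly q z"
    unfolding *(3) by (subst frac_eq_eq) (use * assms in simp_all)
qed

text \<open>Serves to divide a zero of \<open>conds_poly\<close> out of a Baker numerator. After
  \<open>swap_op\<close> the factors q(d) and n(d) become scalars; q is prime to the power of the
  shift, and the remaining factor m(d) can be stripped off.\<close>

lemma smult_shift_power_factor:
  assumes rel: "smult m A * const_op q = smult d B * const_op n"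
    and n: "n = [:-z, 1:] ^ k * n1" and q: "poly q z \<noteq> 0" and m: "m \<noteq> 0"
  shows "\<exists>A1. swap_op A = smult ([:-z, 1:] ^ k) A1"
proof (rule smult_factor_if_times_const_op[OF m])
  fix i
  have "swap_op (X * const_op h) = smult h (swap_op X)" for X h
    by (metis mult.commute swap_op_smult swap_op_swap_op)
  hence "smult q (swap_op A * const_op m) = smult n (const_op d * swap_op B)"
    using arg_cong[OF rel, of swap_op] by (simp add: swap_op_smult mult.commute)
  hence "q * coeff (swap_op A * const_op m) i = [:-z, 1:] ^ k * (n1 * coeff (const_op d * swap_op B) i)"
    unfolding n by (metis coeff_smult mult.assoc)
  hence "[:-z, 1:] ^ k dvd q * coeff (swap_op A * const_op m) i" by simp
  thus "[:-z, 1:] ^ k dvd coeff (swap_op A * const_op m) i" by (rule shift_power_dvd_cancel[OF q])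
qed

lemma baker_bispectral:
  assumes W: "grass_conds W xs" and W': "grass_conds W' xs'"
    and rel: "smult (ratpoly (conds_poly xs)) (annop xs') * const_dop (annop_den xs) =
      dop_of (swap_op (annop_num xs)) * const_dop (conds_poly xs')"
    and def': "baker_defined W' x z" and "def": "baker_defined W z x"
  shows "baker W' x z = baker W z x"
proof -
  define m where "m = conds_poly xs"
  define m' where "m' = conds_poly xs'"
  define q where "q = annop_den xs"
  define q' where "q' = annop_den xs'"
  define A where "A = annop_num xs'"
  define B where "B = annop_num xs"
  have q: "poly q z \<noteq> 0" and t: "baker_tilde W z = Fract (baker_num xs z) m"
    using baker_tilde_eq[OF W] "def" by (simp_all add: baker_defined_def q_def m_def)
  have q': "poly q' x \<noteq> 0" and t': "baker_tilde W' x = Fract (baker_num xs' x) m'"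
    using baker_tilde_eq[OF W'] def' by (simp_all add: baker_defined_def q'_def m'_def)
  have nz: "m \<noteq> 0" "m' \<noteq> 0" "q \<noteq> 0" "q' \<noteq> 0" by (simp_all add: m_def m'_def q_def q'_def)
  have "dop_of (smult m A * const_op q) = smult (ratpoly q') (smult (ratpoly m) (annop xs') * const_dop q)"
    by (simp add: dop_of_mult dop_of_smult A_def dop_of_annop_num q'_def mult.commute)
  also have "\<dots> = dop_of (smult q' (swap_op B) * const_op m')"
    unfolding m_def q_def rel by (simp add: dop_of_mult dop_of_smult B_def m'_def)
  finally have rel2: "smult m A * const_op q = smult q' (swap_op B) * const_op m'" by simp
  obtain m1' where m1': "m' = [:-z, 1:] ^ order z m' * m1'" "\<not> [:-z, 1:] dvd m1'"
    using order_decomp[OF nz(2)] by blast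
  obtain m1 where m1: "m = [:-x, 1:] ^ order x m * m1" "\<not> [:-x, 1:] dvd m1"
    using order_decomp[OF nz(1)] by blast
  have v: "poly m1' z \<noteq> 0" "poly m1 x \<noteq> 0" using m1 m1' by (simp_all add: poly_eq_0_iff_dvd)
  define s where "s = [:-z, 1:] ^ order z m'"
  define r where "r = [:-x, 1:] ^ order x m"
  have sr: "s \<noteq> 0" "r \<noteq> 0" by (simp_all add: s_def r_def)
  obtain A1 where A1: "swap_op A = smult s A1"
    using smult_shift_power_factor[OF rel2 m1'(1) q nz(1)] by (auto simp: s_def)
  have swap_r: "swap_op (X * const_op h) = smult h (swap_op X)" for X h
    by (metis mult.commute swap_op_smult swap_op_swap_op)
  \<comment> \<open>Applying \<open>swap_op\<close> gives the same relation with the two points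
    exchanged, so the zero of \<open>m\<close> at x is treated by the same lemma as the zero of
    \<open>m'\<close> at z.\<close>
  have "swap_op (smult q' (swap_op B) * const_op m') = swap_op (smult m A * const_op q)"
    by (simp only: rel2)
  hence "smult m' B * const_op q' = smult q (swap_op A) * const_op m"
    by (simp only: swap_r swap_op_smult swap_op_swap_op mult.commute[of "const_op q'"]
        mult.commute[of "const_op m"] mult_smult_left)
  from smult_shift_power_factor[OF this m1(1) q' nz(2)]
  obtain B1 where B1: "swap_op B = smult r B1" by (auto simp: r_def)
  have A: "A = const_op s * swap_op A1" using arg_cong[OF A1, of swap_op] by (simp add: swap_op_smult)
  have B: "B = const_op r * swap_op B1" using arg_cong[OF B1, of swap_op] by (simp add: swap_op_smult)
  have "smult r (const_op s * (smult m1 (swap_op A1) * const_op q)) =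
      smult r (const_op s * (smult q' B1 * const_op m1'))"
  proof -
    have m': "const_op m' = const_op s * const_op m1'"
      using m1'(1) swap_op_smult[of s "[:m1':]"] by (simp add: s_def)
    have m: "m = r * m1" using m1(1) by (simp add: r_def)
    show ?thesis using rel2[unfolded A B1 m' m] by (simp add: ac_simps)
  qed
  hence "const_op s * (smult m1 (swap_op A1) * const_op q) = const_op s * (smult q' B1 * const_op m1')"
    by (simp only: smult_cancel[OF sr(2)])
  hence "smult m1 (swap_op A1) * const_op q = smult q' B1 * const_op m1'"
    by (rule mult_left_cancel[THEN iffD1, rotated]) (use sr(1) in simp)
  hence "poly (eval_op (smult m1 (swap_op A1) * const_op q) x) z = poly (eval_op (smult q' B1 * const_op m1') x) z"
    by simp
  hence key: "poly m1 x * poly (eval_op A1 z) x * poly q z = poly q' x * poly (eval_op B1 x) z * poly m1' z"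
    by (simp add: eval_op_mult eval_op_smult poly_eval_swap_op mult.assoc)
  have e': "eval_op A x = s * eval_op (swap_op A1) x" unfolding A by (simp add: eval_op_mult)
  have e: "eval_op B z = r * eval_op (swap_op B1) z" unfolding B by (simp add: eval_op_mult)
  have fr: "Fract (smult (inverse c) (a * b)) (a * d) = Fract b (smult c d)"
    if "a \<noteq> 0" "d \<noteq> 0" "c \<noteq> 0" for a b d :: "complex poly" and c
    using that by (subst eq_fract) (simp_all add: ac_simps)
  have sm: "m' = s * m1'" "m = r * m1" using m1'(1) m1(1) by (simp_all add: s_def r_def)
  have "baker_tilde W' x = Fract (eval_op (swap_op A1) x) (smult (poly q' x) m1')"
    unfolding t' baker_num_def A_def[symmetric] q'_def[symmetric] e' sm(1)
    by (rule fr) (use q' sr v in auto)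
  hence "ratfun_eval (baker_tilde W' x) z = poly (eval_op A1 z) x / (poly q' x * poly m1' z)"
    using q' v by (simp add: ratfun_eval_Fract poly_eval_swap_op)
  moreover have "baker_tilde W z = Fract (eval_op (swap_op B1) z) (smult (poly q z) m1)"
    unfolding t baker_num_def B_def[symmetric] q_def[symmetric] e sm(2)
    by (rule fr) (use q sr v in auto)
  hence "ratfun_eval (baker_tilde W z) x = poly (eval_op B1 x) z / (poly q z * poly m1 x)"
    using q v by (simp add: ratfun_eval_Fract poly_eval_swap_op)
  moreover have "poly (eval_op A1 z) x / (poly q' x * poly m1' z) =
      poly (eval_op B1 x) z / (poly q z * poly m1 x)"
    by (subst frac_eq_eq) (use key q q' v in \<open>simp_all add: ac_simps\<close>)
  ultimately have "ratfun_eval (baker_tilde W' x) z = ratfun_eval (baker_tilde W z) x"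
    by simp
  thus ?thesis by (simp add: baker_def mult.commute)
qed

section \<open>Uniqueness of the dual point\<close>

lemma ratfun_defined_at_Fract: "poly q z \<noteq> 0 \<Longrightarrow> ratfun_defined_at (Fract p q) z"
  by (auto simp: ratfun_defined_at_def)

lemma poly_eq_cofinite:
  fixes p q :: "complex poly"
  assumes "finite B" "\<And>z. z \<notin> B \<Longrightarrow> poly p z = poly q z"
  shows "p = q"
proof (rule ccontr)
  assume "p \<noteq> q"
  hence "finite {z. poly (p - q) z = 0}" by (intro poly_roots_finite) simp
  hence "finite (B \<union> {z. poly (p - q) z = 0})" using assms(1) by simp
  moreover have "UNIV \<subseteq> B \<union> {z. poly (p - q) z = 0}" using assms(2) by auto
  ultimately show False using infinite_UNIV_char_0 by (metis finite_subset)
qed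

text \<open>For almost every x the two Baker functions agree as rational functions of z, and then
  coefficients agree as functions of x. The conclusion is equality of the two K, with the factors
  b(m_i) cleared.\<close>

lemma baker_determines_annop:
  assumes W: "grass_conds W xs" and W1: "grass_conds W1 xs1" and W2: "grass_conds W2 xs2"
    and eq1: "\<And>x z. baker_defined W1 x z \<Longrightarrow> baker_defined W z x \<Longrightarrow> baker W1 x z = baker W z x"
    and eq2: "\<And>x z. baker_defined W2 x z \<Longrightarrow> baker_defined W z x \<Longrightarrow> baker W2 x z = baker W z x"
  shows "annop xs1 * const_dop (conds_poly xs2) = annop xs2 * const_dop (conds_poly xs1)"
proof -
  define m1 where "m1 = conds_poly xs1"
  define m2 where "m2 = conds_poly xs2"
  define q1 where "q1 = annop_den xs1"
  define q2 where "q2 = annop_den xs2"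
  define N1 where "N1 = annop_num xs1"
  define N2 where "N2 = annop_num xs2"
  define B where "B = {x. \<not> baker_tilde_exists W1 x} \<union> {x. \<not> baker_tilde_exists W2 x} \<union>
     {x. poly (conds_poly xs) x = 0}"
  have fB: "finite B" using baker_tilde_exists_cofinite[OF W1] baker_tilde_exists_cofinite[OF W2]
    by (simp add: B_def poly_roots_finite)
  have ev: "eval_op (smult q2 N1 * const_op m2) x = eval_op (smult q1 N2 * const_op m1) x"
    if x: "x \<notin> B" for x
  proof -
    have q: "poly q1 x \<noteq> 0" "poly q2 x \<noteq> 0"
      and t: "baker_tilde W1 x = Fract (baker_num xs1 x) m1" "baker_tilde W2 x = Fract (baker_num xs2 x) m2"
      using baker_tilde_eq[OF W1] baker_tilde_eq[OF W2] x
      by (auto simp: B_def m1_def m2_def q1_def q2_def)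
    define C where "C = {z. \<not> baker_tilde_exists W z} \<union> {z. poly m1 z = 0} \<union> {z. poly m2 z = 0}"
    have "finite C" using baker_tilde_exists_cofinite[OF W]
      by (simp add: C_def poly_roots_finite m1_def m2_def)
    hence "baker_num xs1 x * m2 = baker_num xs2 x * m1"
    proof (rule poly_eq_cofinite)
      fix z assume z: "z \<notin> C"
      have "baker_defined W z x"
        using z x baker_tilde_eq(2)[OF W, of z]
        by (simp add: baker_defined_def C_def B_def ratfun_defined_at_Fract)
      moreover have "baker_defined W1 x z" "baker_defined W2 x z"
        using z x t by (auto simp: baker_defined_def C_def B_def ratfun_defined_at_Fract)
      ultimately have "baker W1 x z = baker W2 x z" using eq1 eq2 by metis
      hence "ratfun_eval (baker_tilde W1 x) z = ratfun_eval (baker_tilde W2 x) z"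
        by (simp add: baker_def)
      thus "poly (baker_num xs1 x * m2) z = poly (baker_num xs2 x * m1) z"
        using z by (simp add: t ratfun_eval_Fract C_def field_simps)
    qed
    hence "smult (poly q1 x * poly q2 x) (baker_num xs1 x * m2) =
        smult (poly q1 x * poly q2 x) (baker_num xs2 x * m1)" by simp
    thus ?thesis using q
      by (simp add: eval_op_mult eval_op_smult baker_num_def field_simps
        flip: N1_def N2_def q1_def q2_def)
  qed
  have "smult q2 N1 * const_op m2 = smult q1 N2 * const_op m1"
  proof (rule poly_eqI)
    fix i
    show "coeff (smult q2 N1 * const_op m2) i = coeff (smult q1 N2 * const_op m1) i"
    proof (rule poly_eq_cofinite[OF fB])
      fix x assume "x \<notin> B"
      from arg_cong[OF ev[OF this], of "\<lambda>p. coeff p i"]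
      show "poly (coeff (smult q2 N1 * const_op m2) i) x = poly (coeff (smult q1 N2 * const_op m1) i) x"
        by (simp only: coeff_eval_op)
    qed
  qed
  hence "dop_of (smult q2 N1 * const_op m2) = dop_of (smult q1 N2 * const_op m1)" by simp
  hence "smult (ratpoly q2 * ratpoly q1) (annop xs1 * const_dop m2) =
      smult (ratpoly q2 * ratpoly q1) (annop xs2 * const_dop m1)"
    by (simp add: dop_of_mult dop_of_smult N1_def N2_def dop_of_annop_num q1_def q2_def mult.commute)
  moreover have "ratpoly q2 * ratpoly q1 \<noteq> 0" by (simp add: q1_def q2_def)
  ultimately have "annop xs1 * const_dop m2 = annop xs2 * const_dop m1" by (metis smult_cancel)
  thus ?thesis by (simp only: m1_def m2_def)
qed

subsection \<open>The quotient skew field\<close>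

locale weyl_quotient =
  fixes j :: "diffop \<Rightarrow> 'q::division_ring" and bQ :: "'q \<Rightarrow> 'q"
  assumes quotient: "weyl_quotient_field j" and anti: "bispectral_anti j bQ"
begin

lemma j_add: "j (D + E) = j D + j E"
  and j_mult: "j (dop_mult D E) = j D * j E"
  and inj_j: "inj j"
  using quotient by (auto simp: weyl_quotient_field_def)

lemma j_eq_iff: "j D = j E \<longleftrightarrow> D = E"
  using inj_j by (auto dest: injD)

lemma j_0: "j 0 = 0"
  using j_add[of 0 0] by simp

lemma j_eq_0_iff: "j D = 0 \<longleftrightarrow> D = 0"
  using j_eq_iff[of D 0] by (simp add: j_0)

lemma bQ_add: "bQ (x + y) = bQ x + bQ y"
  and bQ_mult: "bQ (x * y) = bQ y * bQ x"
  and bQ_const: "bQ (j (dop_const c)) = j (dop_const c)"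
  and bQ_z: "bQ (j dop_z) = j dop_d"
  and bQ_d: "bQ (j dop_d) = j dop_z"
  and inj_bQ: "inj bQ"
  using anti by (auto simp: bispectral_anti_def bij_is_inj)

lemma bQ_eq_iff: "bQ x = bQ y \<longleftrightarrow> x = y"
  using inj_bQ by (auto dest: injD)

lemma bQ_0: "bQ 0 = 0"
  using bQ_add[of 0 0] by simp

lemma j_smult: "j (smult a D) = j [:a:] * j D"
  by (simp flip: j_mult)

lemma j_pCons: "j (pCons a D) = j [:a:] + j D * j [:0, 1:]"
proof -
  have "pCons a D = [:a:] + dop_mult D [:0, 1:]" by (simp add: dop_mult_d_right)
  thus ?thesis by (simp only: j_add j_mult)
qed

lemma j_times_const_dop: "j (D * const_dop g) = j D * j (const_dop g)"
  using dop_mult_times_const_dop[of D 1 g] by (simp add: j_mult)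

lemma j_const_dop_commute: "j (const_dop g) * j (const_dop h) = j (const_dop h) * j (const_dop g)"
  by (simp add: mult.commute flip: j_times_const_dop)

lemma j_const_dop_eq_0_iff: "j (const_dop g) = 0 \<longleftrightarrow> g = 0"
  by (simp add: j_eq_0_iff)

lemma bQ_j_poly: "bQ (j [:ratpoly a:]) = j (const_dop a)"
proof (induction a)
  case (pCons c a)
  have "[:ratpoly (pCons c a):] = dop_const c + dop_mult dop_z [:ratpoly a:]"
    by (simp add: dop_const_def dop_z_def flip: ratpoly_mult ratpoly_add)
  hence "bQ (j [:ratpoly (pCons c a):]) = j (dop_const c) + j (const_dop a) * j dop_d"
    by (simp only: j_add j_mult bQ_add bQ_mult bQ_const bQ_z pCons.IH)
  also have "\<dots> = j (const_dop (pCons c a))"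
    by (simp add: const_op_pCons dop_of_pCons j_pCons[of _ "const_dop a"] dop_const_def dop_d_def)
  finally show ?case .
qed (simp add: j_0 bQ_0)

lemma bQ_j_dop_of: "bQ (j (dop_of P)) = j (dop_of (swap_op P))"
proof (induction P)
  case (pCons a P)
  have "bQ (j (dop_of (pCons a P))) = j (const_dop a) + j dop_z * j (dop_of (swap_op P))"
    using bQ_d by (simp add: dop_of_pCons j_pCons[of _ "dop_of P"] bQ_add bQ_mult bQ_j_poly pCons.IH dop_d_def)
  also have "\<dots> = j (dop_of (swap_op (pCons a P)))"
    by (simp add: swap_op_pCons dop_of_add dop_of_smult j_add j_smult dop_z_def)
  finally show ?case .
qed (simp add: j_0 bQ_0)

lemma bQ_j_const_dop: "bQ (j (const_dop a)) = j [:ratpoly a:]"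
  by (simp add: bQ_j_dop_of dop_of_pCons)

text \<open>Values of \<open>bQ\<close> are prescribed on generators only. It is an involution on
  the Weyl algebra, and clearing denominators from the left extends this to rational
  coefficients.\<close>

lemma bQ_bQ_j: "bQ (bQ (j D)) = j D"
proof -
  obtain q P where q: "q \<noteq> 0" "dop_of P = smult (ratpoly q) D" using diffop_common_denominator by blast
  have "bQ (bQ (j [:ratpoly q:] * j D)) = j [:ratpoly q:] * j D"
    using bQ_j_dop_of[of P] bQ_j_dop_of[of "swap_op P"] by (simp add: q(2) flip: j_smult)
  hence "j [:ratpoly q:] * bQ (bQ (j D)) = j [:ratpoly q:] * j D"
    by (simp add: bQ_mult bQ_j_poly bQ_j_const_dop)
  moreover have "j [:ratpoly q:] \<noteq> 0" using q(1) by (simp add: j_eq_0_iff)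
  ultimately show ?thesis by simp
qed

text \<open>C(z)[d] and its image under b meet in the Weyl algebra: clearing denominators of b(X)
  multiplies X by some g(d) on the right, and such a factor cannot cancel denominators in z.\<close>

lemma weyl_if_bQ:
  assumes "bQ (j X) = j Y"
  shows "X \<in> weyl"
proof -
  obtain g P where g: "g \<noteq> 0" "dop_of P = smult (ratpoly g) Y" using diffop_common_denominator by blast
  have "bQ (j (dop_of (swap_op P))) = j [:ratpoly g:] * j Y"
    by (simp add: bQ_j_dop_of g(2) j_smult)
  also have "\<dots> = bQ (j X * j (const_dop g))" by (simp add: bQ_mult bQ_j_const_dop assms)
  finally have "dop_of (swap_op P) = X * const_dop g"
    by (simp add: bQ_eq_iff j_eq_iff flip: j_times_const_dop)
  hence "X * const_dop g \<in> weyl" by (simp add: weyl_eq flip: \<open>dop_of (swap_op P) = _\<close>)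
  thus ?thesis using weyl_if_times_const_dop g(1) by blast
qed

text \<open>In terms of K: b(D) lies in C(z)[d] K. In the backward direction
  \<open>weyl_if_bQ\<close> supplies the polynomial coefficients of m D.\<close>

lemma R_of_iff:
  assumes W: "grass_conds W xs"
  shows "D \<in> R_of W \<longleftrightarrow> (\<exists>T. bQ (j D) * j (const_dop (conds_poly xs)) = j T * j (annop xs))"
proof
  assume "D \<in> R_of W"
  then obtain E T where E: "smult (ratpoly (conds_poly xs)) D = dop_of E"
    and T: "dop_of (swap_op E) = dop_mult T (annop xs)" using R_of_conds[OF W] by blast
  have "bQ (j (smult (ratpoly (conds_poly xs)) D)) = j (dop_mult T (annop xs))"
    unfolding E bQ_j_dop_of T ..
  hence "bQ (j D) * j (const_dop (conds_poly xs)) = j T * j (annop xs)"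
    by (simp add: j_smult bQ_mult bQ_j_poly j_mult)
  thus "\<exists>T. bQ (j D) * j (const_dop (conds_poly xs)) = j T * j (annop xs)" by blast
next
  assume "\<exists>T. bQ (j D) * j (const_dop (conds_poly xs)) = j T * j (annop xs)"
  then obtain T where T: "bQ (j (smult (ratpoly (conds_poly xs)) D)) = j (dop_mult T (annop xs))"
    by (auto simp: j_smult bQ_mult bQ_j_poly j_mult)
  hence "smult (ratpoly (conds_poly xs)) D \<in> weyl" by (rule weyl_if_bQ)
  then obtain E where E: "smult (ratpoly (conds_poly xs)) D = dop_of E" by (auto simp: weyl_eq)
  have "dop_of (swap_op E) = dop_mult T (annop xs)"
    using T unfolding E bQ_j_dop_of j_eq_iff .
  thus "D \<in> R_of W" by (rule conds_R_of[OF W E])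
qed

lemma grass_subset_if_annop_eq:
  assumes W1: "grass_conds W1 xs1" and W2: "grass_conds W2 xs2"
    and eq: "annop xs1 * const_dop (conds_poly xs2) = annop xs2 * const_dop (conds_poly xs1)"
  shows "W1 \<subseteq> W2"
proof (rule R_of_determines[OF W1 W2], rule subsetI)
  fix D assume "D \<in> R_of W1"
  then obtain T where T: "bQ (j D) * j (const_dop (conds_poly xs1)) = j T * j (annop xs1)"
    using R_of_iff[OF W1] by blast
  define c1 where "c1 = j (const_dop (conds_poly xs1))"
  define c2 where "c2 = j (const_dop (conds_poly xs2))"
  have "bQ (j D) * c2 * c1 = bQ (j D) * c1 * c2"
    by (simp add: c1_def c2_def j_const_dop_commute mult.assoc)
  also have "\<dots> = j T * (j (annop xs1) * c2)" using T by (simp add: c1_def mult.assoc)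
  also have "j (annop xs1) * c2 = j (annop xs2) * c1"
    using eq by (simp add: c1_def c2_def flip: j_times_const_dop)
  finally have "bQ (j D) * c2 * c1 = j T * j (annop xs2) * c1" by (simp add: mult.assoc)
  moreover have "c1 \<noteq> 0" by (simp add: c1_def j_const_dop_eq_0_iff)
  ultimately show "D \<in> R_of W2" unfolding R_of_iff[OF W2] c2_def by auto
qed

lemma bisp_eq:
  assumes W: "grass_conds W xs" and W': "W' \<in> Gr_ad" "grass_conds W' xs'"
    and rel: "smult (ratpoly (conds_poly xs)) (annop xs') * const_dop (annop_den xs) =
      dop_of (swap_op (annop_num xs)) * const_dop (conds_poly xs')"
  shows "bisp W = W'"
  unfolding bisp_def
proof (rule the_equality)
  have eq: "baker W' x z = baker W z x" if "baker_defined W' x z" "baker_defined W z x" for x z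
    by (rule baker_bispectral[OF W W'(2) rel that])
  thus "W' \<in> Gr_ad \<and> (\<forall>x z. baker_defined W' x z \<and> baker_defined W z x \<longrightarrow> baker W' x z = baker W z x)"
    using W'(1) by blast
  fix W1 assume *: "W1 \<in> Gr_ad \<and>
    (\<forall>x z. baker_defined W1 x z \<and> baker_defined W z x \<longrightarrow> baker W1 x z = baker W z x)"
  then obtain xs1 where W1: "grass_conds W1 xs1" using Gr_ad_conds by blast
  have "annop xs1 * const_dop (conds_poly xs') = annop xs' * const_dop (conds_poly xs1)"
    by (rule baker_determines_annop[OF W W1 W'(2)]) (use * eq in blast)+
  thus "W1 = W'"
    using grass_subset_if_annop_eq[OF W1 W'(2)] grass_subset_if_annop_eq[OF W'(2) W1]
    by (metis subset_antisym)
qed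

theorem R_of_dual_image:
  assumes W: "grass_conds W xs" and W': "grass_conds W' xs'"
    and rel: "smult (ratpoly (conds_poly xs)) (annop xs') * const_dop (annop_den xs) =
      dop_of (swap_op (annop_num xs)) * const_dop (conds_poly xs')"
  defines "c \<equiv> j (const_dop (conds_poly xs)) * inverse (j (annop xs))"
  shows "(\<lambda>x. c * x) ` j ` R_of W' = bQ ` j ` L_of W"
proof -
  define m where "m = conds_poly xs"
  define m' where "m' = conds_poly xs'"
  define q where "q = annop_den xs"
  define L where "L = annop xs"
  define L' where "L' = annop xs'"
  define S where "S = dop_of (swap_op (annop_num xs))"
  have xs: "indep_conds xs" using W by (simp add: grass_conds_def)
  have nz: "j L \<noteq> 0" "j (const_dop m) \<noteq> 0" "j (const_dop m') \<noteq> 0" "j (const_dop q) \<noteq> 0" "j [:ratpoly q:] \<noteq> 0"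
    by (simp_all add: j_eq_0_iff L_def j_const_dop_eq_0_iff m_def m'_def q_def)
  have num: "j (dop_of (annop_num xs)) = j [:ratpoly q:] * j L"
    by (simp add: dop_of_annop_num q_def L_def j_smult)
  have bS: "bQ (j S) = j [:ratpoly q:] * j L"
    by (simp add: S_def bQ_j_dop_of num)
  have "bQ (j (dop_of (annop_num xs))) = j S" by (simp add: S_def bQ_j_dop_of)
  hence S: "j S = bQ (j L) * j (const_dop q)" by (simp add: num bQ_mult bQ_j_poly)
  have "j [:ratpoly m:] * j L' * j (const_dop q) = j S * j (const_dop m')"
    using arg_cong[OF rel, of j] by (simp add: j_times_const_dop j_smult m_def m'_def L'_def q_def S_def mult.assoc)
  also have "\<dots> = bQ (j L) * j (const_dop m') * j (const_dop q)"
    by (simp add: S mult.assoc j_const_dop_commute)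
  \<comment> \<open>This is K' = b(K) in the skew field, with the auxiliary denominator q
    cancelled.\<close>
  finally have dual: "j [:ratpoly m:] * j L' = bQ (j L) * j (const_dop m')"
    using nz(4) by simp
  have split: "j D = j (dop_mult D [:inverse (ratpoly m):]) * j [:ratpoly m:]" for D
  proof -
    have "dop_mult [:inverse (ratpoly m):] [:ratpoly m:] = 1" by (simp add: m_def one_pCons)
    hence "dop_mult (dop_mult D [:inverse (ratpoly m):]) [:ratpoly m:] = D"
      by (simp only: dop_mult_assoc dop_mult_1_right)
    thus ?thesis by (simp only: j_mult[symmetric])
  qed
  have bsplit: "bQ (j D) = j (const_dop m) * bQ (j (dop_mult D [:inverse (ratpoly m):]))" for D
    by (subst split) (simp add: bQ_mult bQ_j_poly)
  have L_of: "D \<in> L_of W \<longleftrightarrow> (\<forall>v\<in>conds_space xs. act 0 (dop_mult D [:inverse (ratpoly m):]) (ratpoly v) \<in> range ratpoly)"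
    for D
  proof -
    have "W = (\<lambda>p. Fract p m) ` conds_space xs" using W by (simp add: grass_conds_def m_def)
    thus ?thesis by (simp add: L_of_def dop_apply_eq_act act_dop_mult Fract_eq_divide field_simps)
  qed
  show ?thesis
  proof (intro equalityI subsetI)
    fix y assume "y \<in> bQ ` j ` L_of W"
    then obtain D where D: "D \<in> L_of W" "y = bQ (j D)" by blast
    \<comment> \<open>D = D' m, and \<open>D'\<close> maps V into polynomials. The preimage sought
      is d = L b(D'); it is an operator because q d = b(D' S) with D' S in the Weyl algebra.\<close>
    define D' where "D' = dop_mult D [:inverse (ratpoly m):]"
    have "act 0 (dop_mult D' S) (ratpoly f) \<in> range ratpoly" for f
      using D(1) swap_num_maps_into_conds_space[OF xs] unfolding L_of D'_def[symmetric]
      by (simp add: act_dop_mult S_def)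
    hence "dop_mult D' S \<in> weyl" by (rule weylI)
    then obtain E where E: "dop_mult D' S = dop_of E" by (auto simp: weyl_eq)
    define d where "d = smult (inverse (ratpoly q)) (dop_of (swap_op E))"
    have "j [:ratpoly q:] * j d = bQ (j (dop_of E))"
      by (simp add: d_def bQ_j_dop_of q_def flip: j_smult)
    also have "\<dots> = j [:ratpoly q:] * (j L * bQ (j D'))"
      unfolding E[symmetric] by (simp add: j_mult bQ_mult bS mult.assoc)
    finally have d: "j d = j L * bQ (j D')" using nz(5) by simp
    have "bQ (j d) * j (const_dop m') = j D' * (bQ (j L) * j (const_dop m'))"
      by (simp add: d bQ_mult bQ_bQ_j mult.assoc)
    also have "\<dots> = j D * j L'" by (simp add: D'_def split[of D] mult.assoc flip: dual)
    finally have "d \<in> R_of W'" unfolding R_of_iff[OF W'] m'_def L'_def by blast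
    moreover have "y = c * j d"
      using nz(1) by (simp add: D(2) bsplit[of D] D'_def[symmetric] d c_def m_def[symmetric]
          L_def[symmetric] mult.assoc[symmetric]) (simp add: mult.assoc)
    ultimately show "y \<in> (\<lambda>x. c * x) ` j ` R_of W'" by blast
  next
    fix y assume "y \<in> (\<lambda>x. c * x) ` j ` R_of W'"
    then obtain d where d: "d \<in> R_of W'" "y = c * j d" by blast
    obtain D where "bQ (j d) * j (const_dop m') = j D * j L'"
      using d(1) unfolding R_of_iff[OF W'] m'_def L'_def by blast
    define D' where "D' = dop_mult D [:inverse (ratpoly m):]"
    have "bQ (j d) * j (const_dop m') = j D' * (j [:ratpoly m:] * j L')"
      using \<open>bQ (j d) * j (const_dop m') = j D * j L'\<close> split[of D] by (simp add: D'_def mult.assoc)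
    also have "\<dots> = j D' * bQ (j L) * j (const_dop m')" by (simp add: dual mult.assoc)
    finally have "bQ (j d) = j D' * bQ (j L)" using nz(3) by simp
    hence "bQ (bQ (j d)) = bQ (bQ (j L)) * bQ (j D')" by (simp add: bQ_mult)
    hence jd: "j d = j L * bQ (j D')" by (simp add: bQ_bQ_j)
    \<comment> \<open>V is generated by the image of \<open>S\<close> and the multiples of
      \<open>M\<close>, so it suffices that D' S and D' M lie in the Weyl algebra. Their images
      under b are q d and Z d, where \<open>Z\<close> is the quotient of M(d) by L.\<close>
    obtain M where M: "M \<noteq> 0" "\<And>h. M * h \<in> conds_space xs" using conds_space_contains_ideal by blast
    have "pact l (const_op M) u = 0" if "(l, u) \<in> set xs" for l u
      by (rule pairing_nondegenerate[of l _ 0]) (use M(2) that in \<open>simp add: conds_space_iff flip: pairing_mult_right\<close>)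
    hence "\<exists>Z. const_dop M = dop_mult Z L" unfolding L_def by (intro annop_divides[OF xs]) simp
    then obtain Z where Z: "const_dop M = dop_mult Z L" by blast
    have "bQ (j (dop_mult D' S)) = j (smult (ratpoly q) d)"
      by (simp add: j_mult bQ_mult bS jd j_smult mult.assoc)
    hence w1: "dop_mult D' S \<in> weyl" by (rule weyl_if_bQ)
    have "bQ (j (dop_mult D' [:ratpoly M:])) = j (dop_mult Z d)"
      by (simp add: j_mult bQ_mult bQ_j_poly Z jd mult.assoc)
    hence w2: "dop_mult D' [:ratpoly M:] \<in> weyl" by (rule weyl_if_bQ)
    have weyl_act: "act 0 X (ratpoly f) \<in> range ratpoly" if "X \<in> weyl" for X f
      using that by (auto simp: weyl_eq)
    have "act 0 D' (ratpoly v) \<in> range ratpoly" if v: "v \<in> conds_space xs" for v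
    proof -
      obtain g h where "v = pact 0 (swap_op (annop_num xs)) g + M * h"
        using conds_space_generators[OF xs M v] by blast
      hence "act 0 D' (ratpoly v) = act 0 (dop_mult D' S) (ratpoly g) + act 0 (dop_mult D' [:ratpoly M:]) (ratpoly h)"
        by (simp add: S_def act_dop_mult act_add_right ratpoly_add ratpoly_mult)
      moreover have "\<exists>a. act 0 (dop_mult D' S) (ratpoly g) = ratpoly a"
        "\<exists>b. act 0 (dop_mult D' [:ratpoly M:]) (ratpoly h) = ratpoly b"
        using weyl_act[OF w1, of g] weyl_act[OF w2, of h] by auto
      ultimately show ?thesis by (metis ratpoly_add rangeI)
    qed
    hence "D \<in> L_of W" unfolding L_of D'_def[symmetric] by blast
    moreover have "y = bQ (j D)"
      using nz(1) by (simp add: d(2) bsplit[of D] D'_def[symmetric] jd c_def m_def[symmetric]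
          L_def[symmetric] mult.assoc[symmetric]) (simp add: mult.assoc)
    ultimately show "y \<in> bQ ` j ` L_of W" by blast
  qed
qed

end

theorem theorem1p4:
  fixes j :: "diffop \<Rightarrow> 'q::division_ring" and bQ :: "'q \<Rightarrow> 'q" and W :: "ratfun set"
  assumes "weyl_quotient_field j"
    and "bispectral_anti j bQ"
    and "W \<in> Gr_ad"
  shows "right_mod_iso j (j ` R_of (bisp W)) (bQ ` j ` L_of W)"
proof -
  interpret weyl_quotient j bQ using assms(1,2) by unfold_locales
  obtain xs where W: "grass_conds W xs" using Gr_ad_conds[OF assms(3)] by blast
  hence "indep_conds xs" by (simp add: grass_conds_def)
  from bispectral_dual_exists[OF this] obtain W' xs' where W': "W' \<in> Gr_ad" "grass_conds W' xs'"
    and rel: "smult (ratpoly (conds_poly xs)) (annop xs') * const_dop (annop_den xs) =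
      dop_of (swap_op (annop_num xs)) * const_dop (conds_poly xs')" by blast
  define c where "c = j (const_dop (conds_poly xs)) * inverse (j (annop xs))"
  have "c \<noteq> 0" by (simp add: c_def j_const_dop_eq_0_iff j_eq_0_iff)
  hence "inj_on (\<lambda>x. c * x) (j ` R_of W')" by (simp add: inj_on_def)
  moreover have "(\<lambda>x. c * x) ` j ` R_of W' = bQ ` j ` L_of W"
    unfolding c_def by (rule R_of_dual_image[OF W W'(2) rel])
  ultimately have "bij_betw (\<lambda>x. c * x) (j ` R_of W') (bQ ` j ` L_of W)"
    by (simp add: bij_betw_def)
  thus ?thesis
    unfolding right_mod_iso_def bisp_eq[OF W W' rel]
    by (intro exI[of _ "\<lambda>x. c * x"]) (simp add: distrib_left mult.assoc)
qed

end
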